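(* Let $T=[\boldsymbol{v}_1,\boldsymbol{v}_2,\boldsymbol{v}_3]\subset\mathbb{R}^2$ be a nondegenerate triangle with barycentric coordinate functions $\lambda_1,\lambda_2,\lambda_3$. The 39 functions $S_1,\dots,S_{39}$ constituting $\mathcal{B}_c$ (see context) form a basis of the space $\mathcal{S}^3_5$ of $C^3$ piecewise quintics on the Powell-Sabin 12-split of $T$, and they satisfy the barycentric Marsden identity $$\big(c_1\lambda_1(\boldsymbol{x})+c_2\lambda_2(\boldsymbol{x})+c_3\lambda_3(\boldsymbol{x})\big)^5=\sum_{j=1}^{39}S_j(\boldsymbol{x})\,\Psi_j(c_1,c_2,c_3)\qquad\text{for all }\boldsymbol{x}\in T,\ c_1,c_2,c_3\in\mathbb{R},$$ where $\Psi_j$ is the dual polynomial attached to $S_j$ in the context.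
   Context: Let $\boldsymbol{v}_4=(\boldsymbol{v}_1+\boldsymbol{v}_2)/2$, $\boldsymbol{v}_5=(\boldsymbol{v}_2+\boldsymbol{v}_3)/2$, $\boldsymbol{v}_6=(\boldsymbol{v}_1+\boldsymbol{v}_3)/2$. The Powell-Sabin 12-split of $T$ is the subdivision of $T$ into 12 triangles obtained by drawing all segments connecting pairs among $\boldsymbol{v}_1,\dots,\boldsymbol{v}_6$. $\mathcal{S}^3_5$ is the space of $C^3$ functions on $T$ that are polynomials of total degree at most 5 on each of the 12 triangles. Simplex splines: for nonnegative integers $m_1,\dots,m_6$ with sum 8, let $K$ be the multiset containing $\boldsymbol{v}_i$ with multiplicity $m_i$ (and having convex hull of positive area). Choose a nondegenerate simplex $\sigma\subset\mathbb{R}^7$ whose 8 vertices are mapped onto the elements of $K$ (with multiplicity) by the projection $\pi:\mathbb{R}^7\to\mathbb{R}^2$ onto the first two coordinates, and define $$Q[m_1m_2m_3m_4m_5m_6](\boldsymbol{x})=\frac{\mathrm{area}(T)}{\binom{7}{2}}\cdot\frac{\mathrm{vol}_5(\sigma\cap\pi^{-1}(\boldsymbol{x}))}{\mathrm{vol}_7(\sigma)},\quad \boldsymbol{x}\in T,$$ independent of the choice of $\sigma$. Put $c_4=(c_1+c_2)/2$, $c_5=(c_2+c_3)/2$, $c_6=(c_1+c_3)/2$, $c_{10}=(c_1+c_2+c_3)/3$. The set $\mathcal{B}_c=\{S_1,\dots,S_{39}\}$ with dual polynomials $\Psi_j$ consists of the pairs $(S,\Psi)$ in the $S_3$-orbits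 of the following eight pairs, where a permutation of $\{1,2,3\}$ acts simultaneously on $\boldsymbol{v}_1,\boldsymbol{v}_2,\boldsymbol{v}_3$ and on $c_1,c_2,c_3$, with the induced permutations of the midpoints $\boldsymbol{v}_4,\boldsymbol{v}_5,\boldsymbol{v}_6$ and of $c_4,c_5,c_6$ (each distinct pair taken once, giving $3+6+6+6+3+3+6+6=39$ pairs): $(\frac14Q[600101],\,c_1^5)$, $(\frac14Q[500201],\,c_1^4c_4)$, $(\frac12Q[410201],\,c_1^3c_4^2)$, $(\frac12Q[320201],\,c_1^2c_2c_4^2)$, $(\frac34Q[220211],\,c_1c_2c_4^2c_{10})$, $(Q[141110],\,c_2^3c_4c_5)$, $(\frac12Q[131210],\,c_1c_2^2c_4c_5)$, $(\frac34Q[121211],\,c_1c_2c_4c_5c_{10})$. *)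

theory Defs
  imports
    "HOL-Analysis.Analysis"
    "HOL-Library.Function_Algebras"
    "HOL-Library.Multiset"
begin

(* Pointwise scaling, so that the library's span and independent apply to sets of functions. *)
instantiation "fun" :: (type, real_vector) real_vector
begin

definition scaleR_fun :: "real \<Rightarrow> ('a \<Rightarrow> 'b) \<Rightarrow> 'a \<Rightarrow> 'b"
  where "scaleR_fun a f = (\<lambda>x. a *\<^sub>R f x)"

instance
  by standard (auto simp: scaleR_fun_def fun_eq_iff scaleR_add_right scaleR_add_left)

end

(* A triangle is given by its vertices v 1, v 2, v 3, indexed by the three-element type 3
   (in which the numeral 3 denotes the third element, equal to 0). *)

definition triangle_of :: "(3 \<Rightarrow> real^2) \<Rightarrow> (real^2) set"
  where "triangle_of v = convex hull (range v)"

definition barycentric :: "(3 \<Rightarrow> real^2) \<Rightarrow> real^2 \<Rightarrow> 3 \<Rightarrow> real"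
  where "barycentric v x =
    (THE l. (\<Sum>i\<in>UNIV. l i) = 1 \<and> (\<Sum>i\<in>UNIV. l i *\<^sub>R v i) = x)"

definition ps_points :: "(3 \<Rightarrow> real^2) \<Rightarrow> (real^2) list"
  where "ps_points v = [v 1, v 2, v 3,
    midpoint (v 1) (v 2), midpoint (v 2) (v 3), midpoint (v 1) (v 3)]"

definition ps_segments :: "(3 \<Rightarrow> real^2) \<Rightarrow> (real^2) set"
  where "ps_segments v =
    (\<Union>a\<in>set (ps_points v). \<Union>b\<in>set (ps_points v). closed_segment a b)"

(* The segments include the boundary of the triangle, so the components are the open cells
   and their closures are the 12 (closed) triangles of the split. *)
definition ps12_split :: "(3 \<Rightarrow> real^2) \<Rightarrow> (real^2) set set"
  where "ps12_split v = closure ` components (triangle_of v - ps_segments v)"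

definition is_poly2 :: "nat \<Rightarrow> (real^2 \<Rightarrow> real) \<Rightarrow> bool"
  where "is_poly2 d p \<longleftrightarrow>
    (\<exists>a :: nat \<Rightarrow> nat \<Rightarrow> real. \<forall>x. p x = (\<Sum>i\<le>d. \<Sum>j\<le>d - i. a i j * (x $ 1) ^ i * (x $ 2) ^ j))"

(* C^k on a set S on which derivatives within S are unique, such as an open set or a convex set
   with nonempty interior; at boundary points the derivatives are taken relative to S. *)
primrec Ck_on :: "nat \<Rightarrow> 'a::euclidean_space set \<Rightarrow> ('a \<Rightarrow> real) \<Rightarrow> bool" where
  "Ck_on 0 S f \<longleftrightarrow> continuous_on S f"
| "Ck_on (Suc k) S f \<longleftrightarrow>
    (\<exists>f'. (\<forall>x\<in>S. (f has_derivative f' x) (at x within S)) \<and>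
          (\<forall>b\<in>Basis. Ck_on k S (\<lambda>x. f' x b)))"

(* Functions on the triangle are represented by functions on the plane vanishing off it. *)
definition spline_space :: "nat \<Rightarrow> nat \<Rightarrow> (3 \<Rightarrow> real^2) \<Rightarrow> (real^2 \<Rightarrow> real) set"
  where "spline_space r d v = {f. (\<forall>x. x \<notin> triangle_of v \<longrightarrow> f x = 0) \<and> Ck_on r (triangle_of v) f \<and>
    (\<forall>\<Delta>\<in>ps12_split v. \<exists>p. is_poly2 d p \<and> (\<forall>x\<in>\<Delta>. f x = p x))}"

definition knots :: "(3 \<Rightarrow> real^2) \<Rightarrow> nat list \<Rightarrow> (real^2) multiset"
  where "knots v m = mset (concat (map2 replicate m (ps_points v)))"

(* R^7 is real^2 \<times> real^5, the projection onto the first two coordinates being fst;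
   V is the vertex set of the simplex. *)
definition simplex_over :: "(real^2) multiset \<Rightarrow> ((real^2) \<times> (real^5)) set \<Rightarrow> bool"
  where "simplex_over K V \<longleftrightarrow>
    finite V \<and> \<not> affine_dependent V \<and> image_mset fst (mset_set V) = K"

(* The value does not depend on the chosen simplex: two simplices over the same knots are related
   by an affine bijection commuting with fst. Off the convex hull of the knots it is 0. *)
definition simplex_spline :: "(3 \<Rightarrow> real^2) \<Rightarrow> nat list \<Rightarrow> real^2 \<Rightarrow> real"
  where "simplex_spline v m x =
    (let \<sigma> = convex hull (SOME V. simplex_over (knots v m) V)
     in measure lebesgue (triangle_of v) / real (7 choose 2)
        * (measure lebesgue {y. (x, y) \<in> \<sigma>} / measure lebesgue \<sigma>))"

definition seeds :: "(real \<times> nat list \<times> ((3 \<Rightarrow> real) \<Rightarrow> real)) set"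
  where "seeds =
   (let c4 = (\<lambda>c. (c 1 + c 2) / 2); c5 = (\<lambda>c. (c 2 + c 3) / 2);
        c10 = (\<lambda>c. (c 1 + c 2 + c 3) / 3)
    in {(1/4, [6,0,0,1,0,1], \<lambda>c. c 1 ^ 5),
        (1/4, [5,0,0,2,0,1], \<lambda>c. c 1 ^ 4 * c4 c),
        (1/2, [4,1,0,2,0,1], \<lambda>c. c 1 ^ 3 * c4 c ^ 2),
        (1/2, [3,2,0,2,0,1], \<lambda>c. c 1 ^ 2 * c 2 * c4 c ^ 2),
        (3/4, [2,2,0,2,1,1], \<lambda>c. c 1 * c 2 * c4 c ^ 2 * c10 c),
        (1,   [1,4,1,1,1,0], \<lambda>c. c 2 ^ 3 * c4 c * c5 c),
        (1/2, [1,3,1,2,1,0], \<lambda>c. c 1 * c 2 ^ 2 * c4 c * c5 c),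
        (3/4, [1,2,1,2,1,1], \<lambda>c. c 1 * c 2 * c4 c * c5 c * c10 c)})"

(* Permuting the vertices and the c's induces the permutations of the midpoints and of c4, c5, c6,
   since these are computed from the permuted arguments. *)
definition Bc :: "(3 \<Rightarrow> real^2) \<Rightarrow> ((real^2 \<Rightarrow> real) \<times> ((3 \<Rightarrow> real) \<Rightarrow> real)) set"
  where "Bc v = {(\<lambda>x. a * simplex_spline (v \<circ> \<pi>) m x, \<lambda>c. \<Psi> (c \<circ> \<pi>)) | a m \<Psi> \<pi>.
    (a, m, \<Psi>) \<in> seeds \<and> \<pi> permutes UNIV}"

end

theory Submission
  imports Defs
begin

text \<open>
Throughout, \<open>b\<^sub>1, b\<^sub>2, b\<^sub>3\<close> are the barycentric coordinates of a point, and \<open>x\<^sub>+\<^sup>k\<close> is the truncated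
power \<open>tpow k x\<close>. The theorem rests on three explicit computations and one count of dimensions.

\<^bold>\<open>The simplex splines.\<close> Split the eight knots into three that span a triangle and five others. A point
of the simplex over \<open>x\<close> is determined by the weights \<open>s \<ge> 0\<close> of the five others, and these may be
chosen freely as long as \<open>x - \<Sum>s\<^sub>j k\<^sub>j\<close> stays in the cone over the triangle
(\<open>simplex_slice\<close>); the unknown Jacobian cancels in the quotient of volumes (\<open>simplex_ratio\<close>).
By Fubini the fibre volume is an iterated one-dimensional integral, one for each of the five knots
(\<open>cone_vol\<close>). Up to renumbering the vertices, every knot multiset in question contains the corner triangle
\<open>[v\<^sub>1, v\<^sub>4, v\<^sub>6]\<close> or the medial triangle \<open>[v\<^sub>4, v\<^sub>5, v\<^sub>6]\<close>, and then the five other knots are vertices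
and at most one copy of \<open>v\<^sub>4\<close>. A vertex knot means integration along a coordinate axis, so each step is
verified by differentiating its result (\<open>cone_density_step\<close>). The outcome is \<open>seed_splines\<close>: on the triangle the
seeds are polynomials plus sums of terms \<open>l\<^sub>+\<^sup>4\<close> times a linear form, where \<open>l = 0\<close> is a midline
(\<open>l = b\<^sub>i - b\<^sub>j - b\<^sub>k\<close>) or a median (\<open>l = b\<^sub>i - b\<^sub>j\<close>).

\<^bold>\<open>The spline space.\<close> Two quintic pieces of a \<open>C\<^sup>3\<close> function that meet along an edge on \<open>l = 0\<close> differ by
\<open>l\<^sup>4\<close> times a linear form, the smoothing cofactor (\<open>jump_across_line\<close>, \<open>edge_jump\<close>). Going around the crossing
of a median with a midline shows that both halves of the midline carry the same cofactor
(\<open>crossing_conformality\<close>), and going around the centroid shows the same for the two parts of a median that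
meet there (\<open>centroid_conformality\<close>). Hence the space consists of the sums of a quintic and of terms
\<open>l\<^sub>+\<^sup>4\<close> times a linear form over the six lines (\<open>cofactors_exist\<close>, \<open>spline_space_eq_span\<close>), and the
resulting \<open>21 + 6 \<cdot> 3 = 39\<close> generators are linearly independent (\<open>gens_independent\<close>).

\<^bold>\<open>The Marsden identity.\<close> After rewriting \<open>(-l)\<^sub>+\<^sup>4 = l\<^sup>4 - l\<^sub>+\<^sup>4\<close> both sides are polynomials in the \<open>b\<^sub>i\<close>, the
\<open>c\<^sub>i\<close> and six truncated powers, and they agree as such (\<open>marsden_reals\<close>).

\<^bold>\<open>The basis.\<close> By the Marsden identity the span of the family contains the fifth power of every linear form,
hence by polarization every quintic; the truncated generators are then recovered from the orbits of
the first, second, third, fourth and seventh seed (\<open>gens_subset\<close>). So the family spans a space of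
dimension 39, while the symmetries of the seeds leave at most 39 pairs in the orbits
(\<open>Bc_eq_listing\<close>). This forces exactly 39 distinct pairs with distinct first components, and their
independence.
\<close>

section \<open>Barycentric coordinates\<close>

definition tri_det :: "(3 \<Rightarrow> real^2) \<Rightarrow> real"
  where "tri_det v = (v 1 $ 1 - v 3 $ 1) * (v 2 $ 2 - v 3 $ 2)
                   - (v 2 $ 1 - v 3 $ 1) * (v 1 $ 2 - v 3 $ 2)"

lemma vec2_eq_iff: "(x::real^2) = y \<longleftrightarrow> x $ 1 = y $ 1 \<and> x $ 2 = y $ 2"
  by (simp add: vec_eq_iff forall_2)

lemma tri_det_nonzero_iff: "tri_det v \<noteq> 0 \<longleftrightarrow> \<not> collinear {v 1, v 2, v 3}"
proof -
  have "collinear {v 1, v 2, v 3}" if D: "tri_det v = 0"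
  proof (cases "v 1 = v 3")
    case False
    define a b where "a = v 1 - v 3" and "b = v 2 - v 3"
    have D': "a $ 1 * b $ 2 = b $ 1 * a $ 2"
      using D by (simp add: tri_det_def a_def b_def)
    have "\<exists>t. b = t *\<^sub>R a"
    proof (cases "a $ 1 = 0")
      case True
      then have "a $ 2 \<noteq> 0" using False by (auto simp: a_def vec2_eq_iff)
      then show ?thesis using True D'
        by (intro exI[of _ "b $ 2 / a $ 2"]) (auto simp: vec2_eq_iff field_simps)
    next
      case False
      then show ?thesis using D'
        by (intro exI[of _ "b $ 1 / a $ 1"]) (auto simp: vec2_eq_iff field_simps)
    qed
    then obtain t where t: "b = t *\<^sub>R a" ..
    then have "v 2 = t *\<^sub>R v 1 + (1 - t) *\<^sub>R v 3"
      by (simp add: a_def b_def algebra_simps)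
    then show ?thesis unfolding collinear_3_expand by blast
  qed (simp add: insert_commute)
  moreover have "tri_det v = 0" if "collinear {v 1, v 2, v 3}"
  proof (cases "v 1 = v 3")
    case False
    with that obtain u where u: "v 2 = u *\<^sub>R v 1 + (1 - u) *\<^sub>R v 3"
      unfolding collinear_3_expand by blast
    show ?thesis unfolding tri_det_def u by (simp add: algebra_simps)
  qed (simp add: tri_det_def)
  ultimately show ?thesis by blast
qed

lemma fun3_eqI: "f 1 = g 1 \<Longrightarrow> f 2 = g 2 \<Longrightarrow> f 3 = g 3 \<Longrightarrow> f = (g :: 3 \<Rightarrow> 'a)"
  using forall_3[of "\<lambda>i. f i = g i"] by auto

lemma bary_formula:
  assumes nc: "\<not> collinear {v 1, v 2, v 3}"
  defines "D \<equiv> tri_det v"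
  shows "(l 1 + l 2 + l 3 = 1 \<and> l 1 *\<^sub>R v 1 + l 2 *\<^sub>R v 2 + l 3 *\<^sub>R v 3 = x) \<longleftrightarrow>
    l 1 = ((x $ 1 - v 3 $ 1) * (v 2 $ 2 - v 3 $ 2) - (v 2 $ 1 - v 3 $ 1) * (x $ 2 - v 3 $ 2)) / D \<and>
    l 2 = ((v 1 $ 1 - v 3 $ 1) * (x $ 2 - v 3 $ 2) - (x $ 1 - v 3 $ 1) * (v 1 $ 2 - v 3 $ 2)) / D \<and>
    l 3 = 1 - l 1 - l (2::3)" (is "?A \<longleftrightarrow> ?B")
proof
  have D: "D \<noteq> 0" using tri_det_nonzero_iff[of v] nc by (simp add: D_def)
  {
    assume A: ?A
    then have l3: "l 3 = 1 - l 1 - l 2" by linarith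
    have x: "x = l 1 *\<^sub>R v 1 + l 2 *\<^sub>R v 2 + (1 - l 1 - l 2) *\<^sub>R v 3"
      using A l3 by simp
    have x1: "x $ 1 - v 3 $ 1 = l 1 * (v 1 $ 1 - v 3 $ 1) + l 2 * (v 2 $ 1 - v 3 $ 1)"
      unfolding x by (simp add: algebra_simps)
    have x2: "x $ 2 - v 3 $ 2 = l 1 * (v 1 $ 2 - v 3 $ 2) + l 2 * (v 2 $ 2 - v 3 $ 2)"
      unfolding x by (simp add: algebra_simps)
    have "(x $ 1 - v 3 $ 1) * (v 2 $ 2 - v 3 $ 2) - (v 2 $ 1 - v 3 $ 1) * (x $ 2 - v 3 $ 2) = l 1 * D"
      "(v 1 $ 1 - v 3 $ 1) * (x $ 2 - v 3 $ 2) - (x $ 1 - v 3 $ 1) * (v 1 $ 2 - v 3 $ 2) = l 2 * D"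
      unfolding x1 x2 D_def tri_det_def by (simp_all add: algebra_simps)
    then show ?B using D l3 by simp
  next
    assume B: ?B
    have e: "D * (l 1 * (v 1 $ 1 - v 3 $ 1) + l 2 * (v 2 $ 1 - v 3 $ 1)) = D * (x $ 1 - v 3 $ 1)"
         "D * (l 1 * (v 1 $ 2 - v 3 $ 2) + l 2 * (v 2 $ 2 - v 3 $ 2)) = D * (x $ 2 - v 3 $ 2)"
    proof -
      have l: "D * l 1 = (x $ 1 - v 3 $ 1) * (v 2 $ 2 - v 3 $ 2) - (v 2 $ 1 - v 3 $ 1) * (x $ 2 - v 3 $ 2)"
        "D * l 2 = (v 1 $ 1 - v 3 $ 1) * (x $ 2 - v 3 $ 2) - (x $ 1 - v 3 $ 1) * (v 1 $ 2 - v 3 $ 2)"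
        using B D by auto
      have m: "D * (l 1 * p + l 2 * q) = (D * l 1) * p + (D * l 2) * q" for p q
        by (simp add: algebra_simps)
      show "D * (l 1 * (v 1 $ 1 - v 3 $ 1) + l 2 * (v 2 $ 1 - v 3 $ 1)) = D * (x $ 1 - v 3 $ 1)"
        unfolding m unfolding l unfolding D_def tri_det_def by algebra
      show         "D * (l 1 * (v 1 $ 2 - v 3 $ 2) + l 2 * (v 2 $ 2 - v 3 $ 2)) = D * (x $ 2 - v 3 $ 2)"
        unfolding m unfolding l unfolding D_def tri_det_def by algebra
    qed
    then have e2: "l 1 * (v 1 $ 1 - v 3 $ 1) + l 2 * (v 2 $ 1 - v 3 $ 1) = x $ 1 - v 3 $ 1"
         "l 1 * (v 1 $ 2 - v 3 $ 2) + l 2 * (v 2 $ 2 - v 3 $ 2) = x $ 2 - v 3 $ 2"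
      using D by simp_all
    have l3: "l 3 = 1 - l 1 - l 2" using B by simp
    show ?A using e2 unfolding l3 by (simp add: vec2_eq_iff algebra_simps)
  }
qed

lemma bary_unique:
  assumes nc: "\<not> collinear {v 1, v 2, v 3}"
    and "l 1 + l 2 + l 3 = 1" "l 1 *\<^sub>R v 1 + l 2 *\<^sub>R v 2 + l 3 *\<^sub>R v 3 = x"
  shows "barycentric v x = l"
  unfolding barycentric_def
proof (rule the_equality)
  fix m :: "3 \<Rightarrow> real"
  assume "sum m UNIV = 1 \<and> (\<Sum>i\<in>UNIV. m i *\<^sub>R v i) = x"
  then have "m 1 + m 2 + m 3 = 1 \<and> m 1 *\<^sub>R v 1 + m 2 *\<^sub>R v 2 + m 3 *\<^sub>R v 3 = x"
    by (simp add: sum_3)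
  then show "m = l"
    using bary_formula[OF nc, of m x] bary_formula[OF nc, of l x] assms(2,3)
    by (intro fun3_eqI) auto
qed (use assms in \<open>simp add: sum_3\<close>)

lemma bary_props:
  assumes nc: "\<not> collinear {v 1, v 2, v 3}"
  shows bary_sum: "barycentric v x 1 + barycentric v x 2 + barycentric v x 3 = 1"
    and bary_comb: "barycentric v x 1 *\<^sub>R v 1 + barycentric v x 2 *\<^sub>R v 2 + barycentric v x 3 *\<^sub>R v 3 = x"
proof -
  define D where "D = tri_det v"
  define l1 l2 where
    "l1 = ((x $ 1 - v 3 $ 1) * (v 2 $ 2 - v 3 $ 2) - (v 2 $ 1 - v 3 $ 1) * (x $ 2 - v 3 $ 2)) / D" and
    "l2 = ((v 1 $ 1 - v 3 $ 1) * (x $ 2 - v 3 $ 2) - (x $ 1 - v 3 $ 1) * (v 1 $ 2 - v 3 $ 2)) / D"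
  define l :: "3 \<Rightarrow> real" where "l = (\<lambda>i. if i = 1 then l1 else if i = 2 then l2 else 1 - l1 - l2)"
  have "l 1 + l 2 + l 3 = 1 \<and> l 1 *\<^sub>R v 1 + l 2 *\<^sub>R v 2 + l 3 *\<^sub>R v 3 = x"
    by (subst bary_formula[OF nc]) (simp add: l_def l1_def l2_def D_def)
  moreover from this have "barycentric v x = l" using bary_unique[OF nc] by blast
  ultimately show "barycentric v x 1 + barycentric v x 2 + barycentric v x 3 = 1"
    "barycentric v x 1 *\<^sub>R v 1 + barycentric v x 2 *\<^sub>R v 2 + barycentric v x 3 *\<^sub>R v 3 = x"
    by simp_all
qed

lemma bary_affine:
  assumes nc: "\<not> collinear {v 1, v 2, v 3}"
  obtains A c where "\<And>x i. barycentric v x i = A i \<bullet> x + c i"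
proof -
  define D where "D = tri_det v"
  define A :: "3 \<Rightarrow> real^2" where "A = (\<lambda>i.
     if i = 1 then vector [(v 2 $ 2 - v 3 $ 2) / D, - (v 2 $ 1 - v 3 $ 1) / D]
     else if i = 2 then vector [- (v 1 $ 2 - v 3 $ 2) / D, (v 1 $ 1 - v 3 $ 1) / D]
     else vector [- (v 2 $ 2 - v 3 $ 2) / D + (v 1 $ 2 - v 3 $ 2) / D,
                  (v 2 $ 1 - v 3 $ 1) / D - (v 1 $ 1 - v 3 $ 1) / D])"
  define c where "c = barycentric v 0"
  have "barycentric v x i = A i \<bullet> x + c i" for x i
  proof -
    have *: "barycentric v x 1 = A 1 \<bullet> x + c 1 \<and> barycentric v x 2 = A 2 \<bullet> x + c 2 \<and> barycentric v x 3 = A 3 \<bullet> x + c 3"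
      using iffD1[OF bary_formula[OF nc, of "barycentric v x"], OF conjI[OF bary_props[OF nc]]]
        iffD1[OF bary_formula[OF nc, of "barycentric v 0"], OF conjI[OF bary_props[OF nc]]]
      unfolding c_def A_def
      by (auto simp: inner_vec_def sum_2 D_def add_divide_distrib diff_divide_distrib algebra_simps)
    then show ?thesis using forall_3[of "\<lambda>i. barycentric v x i = A i \<bullet> x + c i"] by blast
  qed
  then show ?thesis using that by blast
qed

lemma range_3: "range (f :: 3 \<Rightarrow> 'a) = {f 1, f 2, f 3}"
  by (simp add: UNIV_3)

lemma mem_triangle_iff:
  assumes nc: "\<not> collinear {v 1, v 2, v 3}"
  shows "x \<in> triangle_of v \<longleftrightarrow> (\<forall>i. barycentric v x i \<ge> 0)"
proof
  assume "x \<in> triangle_of v"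
  then obtain a b c where abc: "a \<ge> 0" "b \<ge> 0" "c \<ge> 0" "a + b + c = 1"
    "a *\<^sub>R v 1 + b *\<^sub>R v 2 + c *\<^sub>R v 3 = x"
    unfolding triangle_of_def range_3 convex_hull_3 by blast
  define l :: "3 \<Rightarrow> real" where "l = (\<lambda>i. if i = 1 then a else if i = 2 then b else c)"
  have "barycentric v x = l"
    by (rule bary_unique[OF nc]) (use abc in \<open>auto simp: l_def\<close>)
  then show "\<forall>i. barycentric v x i \<ge> 0" using abc by (auto simp: l_def)
next
  assume "\<forall>i. barycentric v x i \<ge> 0"
  then show "x \<in> triangle_of v"
    unfolding triangle_of_def range_3 convex_hull_3
    using bary_props[OF nc, of x] by (intro CollectI exI[of _ "barycentric v x _"] conjI) auto
qed

lemma collinear_perm: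
  assumes "\<pi> permutes (UNIV :: 3 set)"
  shows "collinear {(v \<circ> \<pi>) 1, (v \<circ> \<pi>) 2, (v \<circ> \<pi>) 3} \<longleftrightarrow> collinear {v 1, v 2, v 3}"
proof -
  have "range (v \<circ> \<pi>) = range v"
    using permutes_image[OF assms] by (metis image_comp)
  then show ?thesis by (simp add: range_3)
qed

lemma bary_perm:
  assumes nc: "\<not> collinear {v 1, v 2, v 3}" and \<pi>: "\<pi> permutes (UNIV :: 3 set)"
  shows "barycentric (v \<circ> \<pi>) x = barycentric v x \<circ> \<pi>"
proof (rule bary_unique)
  show "\<not> collinear {(v \<circ> \<pi>) 1, (v \<circ> \<pi>) 2, (v \<circ> \<pi>) 3}"
    using nc collinear_perm[OF \<pi>] by blast
  have "sum (barycentric v x \<circ> \<pi>) UNIV = sum (barycentric v x) UNIV"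
    using sum.permute[OF \<pi>, of "barycentric v x"] by simp
  then show "(barycentric v x \<circ> \<pi>) 1 + (barycentric v x \<circ> \<pi>) 2 + (barycentric v x \<circ> \<pi>) 3 = 1"
    using bary_sum[OF nc] by (simp add: sum_3)
  have "sum ((\<lambda>i. barycentric v x i *\<^sub>R v i) \<circ> \<pi>) UNIV = (\<Sum>i\<in>UNIV. barycentric v x i *\<^sub>R v i)"
    using sum.permute[OF \<pi>, of "\<lambda>i. barycentric v x i *\<^sub>R v i"] by simp
  then show "(barycentric v x \<circ> \<pi>) 1 *\<^sub>R (v \<circ> \<pi>) 1 + (barycentric v x \<circ> \<pi>) 2 *\<^sub>R (v \<circ> \<pi>) 2
      + (barycentric v x \<circ> \<pi>) 3 *\<^sub>R (v \<circ> \<pi>) 3 = x"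
    using bary_comb[OF nc] by (simp add: sum_3)
qed

lemma triangle_perm:
  assumes "\<pi> permutes (UNIV :: 3 set)"
  shows "triangle_of (v \<circ> \<pi>) = triangle_of v"
  unfolding triangle_of_def using permutes_image[OF assms] by (metis image_comp)

section \<open>Fibre volumes of a simplex as iterated integrals\<close>

text \<open>The volume of the weights \<open>s \<ge> 0\<close> of the vectors in the list for which subtracting the weighted
vectors from \<open>b\<close> lands in \<open>C\<close>, computed one weight at a time. It is the density at \<open>b\<close>
of a multivariate truncated power, and recursion on the list is what makes closed forms accessible.\<close>

primrec cone_vol :: "'a::euclidean_space set \<Rightarrow> 'a list \<Rightarrow> 'a \<Rightarrow> ennreal" where
  "cone_vol C [] b = indicator C b"
| "cone_vol C (k # K) b = (\<integral>\<^sup>+s. indicator {0..} s * cone_vol C K (b - s *\<^sub>R k) \<partial>lborel)"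

lemma cone_vol_measurable:
  assumes C: "C \<in> sets borel"
  shows "cone_vol C K \<in> borel_measurable borel"
proof (induction K)
  case Nil
  have "cone_vol C [] = indicator C" by (auto simp: fun_eq_iff)
  then show ?case using C by simp
next
  case (Cons k K)
  note [measurable] = Cons
  have "(\<lambda>b. \<integral>\<^sup>+s. indicator {0..} s * cone_vol C K (b - s *\<^sub>R k) \<partial>lborel) \<in> borel_measurable borel"
    by measurable
  then show ?case by simp
qed

text \<open>Tonelli for the product measure: the weight of the first vector is integrated last.\<close>

lemma emeasure_PiM_cone_vol:
  fixes \<kappa> :: "'i \<Rightarrow> 'a::euclidean_space"
  assumes C: "C \<in> sets borel" and "distinct js"
  shows "emeasure (Pi\<^sub>M (set js) (\<lambda>_. lborel))
      {s \<in> space (Pi\<^sub>M (set js) (\<lambda>_. lborel)). (\<forall>i\<in>set js. 0 \<le> s i) \<and> b - (\<Sum>i\<in>set js. s i *\<^sub>R \<kappa> i) \<in> C}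
    = cone_vol C (map \<kappa> js) b"
  using assms(2)
proof (induction js arbitrary: b)
  case Nil
  have "{s \<in> space (Pi\<^sub>M {} (\<lambda>_. lborel :: real measure)). b \<in> C} = (if b \<in> C then {\<lambda>_. undefined} else {})"
    by (auto simp: space_PiM)
  then show ?case
    by (auto simp: PiM_empty indicator_def)
next
  case (Cons i js)
  interpret product_sigma_finite "\<lambda>_::'i. lborel :: real measure" by standard
  let ?I = "set js" and ?M = "\<lambda>J. Pi\<^sub>M J (\<lambda>_::'i. lborel :: real measure)"
  let ?A = "\<lambda>J b. {s \<in> space (?M J). (\<forall>i\<in>J. 0 \<le> s i) \<and> b - (\<Sum>i\<in>J. s i *\<^sub>R \<kappa> i) \<in> C}"
  note [measurable] = C
  have meas: "?A J c \<in> sets (?M J)" if "finite J" for J c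
    using that by measurable
  have ni: "i \<notin> ?I" "finite ?I" using Cons.prems by auto
  have "emeasure (?M (insert i ?I)) (?A (insert i ?I) b)
      = (\<integral>\<^sup>+s. indicator (?A (insert i ?I) b) s \<partial>?M (insert i ?I))"
    using meas[of "insert i ?I" b] by simp
  also have "\<dots> = (\<integral>\<^sup>+y. (\<integral>\<^sup>+x. indicator (?A (insert i ?I) b) (x(i := y)) \<partial>?M ?I) \<partial>lborel)"
    using ni meas[of "insert i ?I" b] by (intro product_nn_integral_insert_rev) auto
  also have "\<dots> = (\<integral>\<^sup>+y. indicator {0..} y * cone_vol C (map \<kappa> js) (b - y *\<^sub>R \<kappa> i) \<partial>lborel)"
  proof (rule nn_integral_cong)
    fix y :: real
    have "(\<integral>\<^sup>+x. indicator (?A (insert i ?I) b) (x(i := y)) \<partial>?M ?I)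
       = (\<integral>\<^sup>+x. indicator {0..} y * indicator (?A ?I (b - y *\<^sub>R \<kappa> i)) x \<partial>?M ?I)"
    proof (rule nn_integral_cong)
      fix x assume x: "x \<in> space (?M ?I)"
      have "(\<Sum>j\<in>?I. (x(i := y)) j *\<^sub>R \<kappa> j) = (\<Sum>j\<in>?I. x j *\<^sub>R \<kappa> j)"
        using ni by (intro sum.cong) auto
      moreover have "x(i := y) \<in> space (?M (insert i ?I))"
        using x by (auto simp: space_PiM PiE_def extensional_def)
      moreover have "(\<forall>j\<in>?I. 0 \<le> (x(i:=y)) j) \<longleftrightarrow> (\<forall>j\<in>?I. 0 \<le> x j)"
        using ni by auto
      ultimately show "indicator (?A (insert i ?I) b) (x(i := y))
         = (indicator {0..} y * indicator (?A ?I (b - y *\<^sub>R \<kappa> i)) x :: ennreal)"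
        using ni x by (auto simp: indicator_def algebra_simps)
    qed
    also have "\<dots> = indicator {0..} y * cone_vol C (map \<kappa> js) (b - y *\<^sub>R \<kappa> i)"
      using meas[OF ni(2)] Cons by (subst nn_integral_cmult) auto
    finally show "(\<integral>\<^sup>+x. indicator (?A (insert i ?I) b) (x(i := y)) \<partial>?M ?I)
      = indicator {0..} y * cone_vol C (map \<kappa> js) (b - y *\<^sub>R \<kappa> i)" .
  qed
  finally show ?case by simp
qed

lemma emeasure_lborel_cone_vol:
  fixes \<kappa> :: "'n::finite \<Rightarrow> 'a::euclidean_space"
  assumes C: "C \<in> sets borel" and js: "distinct js" "set js = (UNIV :: 'n set)"
  shows "emeasure lborel {s :: real^'n. (\<forall>j. 0 \<le> s $ j) \<and> b - (\<Sum>j\<in>UNIV. s $ j *\<^sub>R \<kappa> j) \<in> C}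
    = cone_vol C (map \<kappa> js) b"
proof -
  note [measurable] = C
  define A where "A = {s :: real^'n. (\<forall>j. 0 \<le> s $ j) \<and> b - (\<Sum>j\<in>UNIV. s $ j *\<^sub>R \<kappa> j) \<in> C}"
  define ax where "ax = (\<lambda>j::'n. axis j (1::real))"
  define \<kappa>' where "\<kappa>' = (\<lambda>e. \<kappa> (inv ax e))"
  have inj: "inj ax" by (auto simp: ax_def inj_def axis_eq_axis)
  have Bas: "Basis = ax ` UNIV" by (auto simp: Basis_vec_def ax_def)
  have [measurable]: "A \<in> sets borel" unfolding A_def by measurable
  define g where "g = (\<lambda>f. \<Sum>b\<in>Basis. f b *\<^sub>R (b :: real^'n))"
  have g: "g f $ j = f (ax j)" for f j
  proof -
    have "g f $ j = g f \<bullet> ax j" by (simp add: ax_def inner_axis)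
    also have "\<dots> = f (ax j)" unfolding g_def using Bas
      by (subst inner_sum_left_Basis) auto
    finally show ?thesis .
  qed
  have lb: "lborel = distr (Pi\<^sub>M Basis (\<lambda>_. lborel)) borel g"
    unfolding g_def by (rule lborel_eq)
  have "emeasure lborel A = emeasure (Pi\<^sub>M Basis (\<lambda>_. lborel)) (g -` A \<inter> space (Pi\<^sub>M Basis (\<lambda>_. lborel)))"
    unfolding lb by (rule emeasure_distr) (auto simp: g_def)
  also have "g -` A \<inter> space (Pi\<^sub>M Basis (\<lambda>_. lborel)) = {s \<in> space (Pi\<^sub>M Basis (\<lambda>_. lborel)).
      (\<forall>i\<in>Basis. 0 \<le> s i) \<and> b - (\<Sum>i\<in>Basis. s i *\<^sub>R \<kappa>' i) \<in> C}"
    unfolding A_def Bas using inj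
    by (auto simp: g sum.reindex \<kappa>'_def)
  also have "emeasure (Pi\<^sub>M Basis (\<lambda>_. lborel)) \<dots> = cone_vol C (map \<kappa>' (map ax js)) b"
    using emeasure_PiM_cone_vol[OF C, of "map ax js" b \<kappa>'] js inj
    by (simp add: Bas distinct_map inj_on_subset)
  also have "map \<kappa>' (map ax js) = map \<kappa> js" using inj by (simp add: \<kappa>'_def)
  finally show ?thesis unfolding A_def .
qed

lemma emeasure_affine_image:
  fixes L :: "real^'n::{finite,wellorder} \<Rightarrow> real^'n::_"
  assumes L: "linear L" and S: "compact S"
  shows "emeasure lborel ((\<lambda>s. c + L s) ` S) = ennreal \<bar>det (matrix L)\<bar> * emeasure lborel S"
proof -
  have fin: "emeasure lborel X = ennreal (measure lebesgue X)" if "compact X" for X :: "(real^'n::_) set"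
    using emeasure_compact_finite[OF that] that
    by (simp add: emeasure_eq_ennreal_measure borel_compact measure_completion less_top)
  have LS: "compact (L ` S)"
    using L S by (simp add: compact_continuous_image linear_continuous_on linear_conv_bounded_linear)
  have "(\<lambda>s. c + L s) ` S = (\<lambda>y. c + y) ` L ` S" by auto
  then have "emeasure lborel ((\<lambda>s. c + L s) ` S) = ennreal (measure lebesgue ((\<lambda>y. c + y) ` L ` S))"
    using fin[OF compact_translation[OF LS, of c]] by simp
  also have "measure lebesgue ((\<lambda>y. c + y) ` L ` S) = measure lebesgue (L ` S)"
    by (rule measure_translation)
  also have "\<dots> = \<bar>det (matrix L)\<bar> * measure lebesgue S"
    using L S by (intro measure_linear_image) (auto simp: lmeasurable_compact)
  finally show ?thesis using fin[OF S] by (simp add: ennreal_mult)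
qed

text \<open>Lets a multiset of points over the knots be enumerated by the index type of the knots, so that equal
knots get separate vertices of the simplex.\<close>

lemma image_mset_eq_image_mset_set:
  assumes "finite A" "image_mset f M = image_mset g (mset_set A)"
  shows "\<exists>w. M = image_mset w (mset_set A) \<and> (\<forall>a\<in>A. f (w a) = g a)"
  using assms
proof (induction A arbitrary: M rule: finite_induct)
  case (insert a A)
  then have "image_mset f M = add_mset (g a) (image_mset g (mset_set A))" by simp
  then obtain N b where N: "M = add_mset b N" "f b = g a" "image_mset f N = image_mset g (mset_set A)"
    by (metis msed_map_invR)
  from insert.IH[OF N(3)] obtain w where w: "N = image_mset w (mset_set A)" "\<forall>a\<in>A. f (w a) = g a"
    by blast
  have "image_mset (w(a := b)) (mset_set A) = image_mset w (mset_set A)"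
    using insert.hyps by (intro image_mset_cong) auto
  then show ?case using w N insert.hyps
    by (intro exI[of _ "w(a := b)"]) (auto simp: fun_upd_def)
qed simp

lemma simplex_over_param:
  assumes V: "simplex_over (image_mset g (mset_set (UNIV :: 'i::finite set))) V"
  obtains w where "inj w" "range w = V" "\<And>i. fst (w i) = g i"
proof -
  have fin: "finite V" and K: "image_mset fst (mset_set V) = image_mset g (mset_set UNIV)"
    using V by (auto simp: simplex_over_def)
  obtain w where w: "mset_set V = image_mset w (mset_set UNIV)" "\<And>i. fst (w i) = g i"
    using image_mset_eq_image_mset_set[OF _ K] by auto
  have "set_mset (mset_set V) = range w" unfolding w by simp
  then have V: "V = range w" using fin by simp
  have "card V = CARD('i)" using arg_cong[OF w(1), of size] by simp
  then have "inj w" unfolding V by (intro eq_card_imp_inj_on) auto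
  then show ?thesis using that V w by blast
qed

lemma convex_hull_range:
  assumes "inj (w :: 'i::finite \<Rightarrow> 'a::real_vector)"
  shows "convex hull (range w) = {\<Sum>i\<in>UNIV. t i *\<^sub>R w i | t. (\<forall>i. 0 \<le> t i) \<and> sum t UNIV = 1}"
proof -
  have "convex hull (range w) = {y. \<exists>u. (\<forall>x\<in>range w. 0 \<le> u x) \<and> sum u (range w) = 1 \<and>
      (\<Sum>x\<in>range w. u x *\<^sub>R x) = y}"
    by (rule convex_hull_finite) simp
  also have "\<dots> = {\<Sum>i\<in>UNIV. t i *\<^sub>R w i | t. (\<forall>i. 0 \<le> t i) \<and> sum t UNIV = 1}" (is "?A = ?B")
  proof
    show "?A \<subseteq> ?B"
    proof
      fix y assume "y \<in> ?A"
      then obtain u where "\<forall>x\<in>range w. 0 \<le> u x" "sum u (range w) = 1" "(\<Sum>x\<in>range w. u x *\<^sub>R x) = y"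
        by blast
      then show "y \<in> ?B" using assms
        by (intro CollectI exI[of _ "u \<circ> w"]) (simp add: sum.reindex)
    qed
    show "?B \<subseteq> ?A"
    proof
      fix y assume "y \<in> ?B"
      then obtain t where "\<forall>i. 0 \<le> t i" "sum t UNIV = 1" "(\<Sum>i\<in>UNIV. t i *\<^sub>R w i) = y"
        by blast
      then show "y \<in> ?A" using assms
        by (intro CollectI exI[of _ "t \<circ> inv w"]) (simp add: sum.reindex)
    qed
  qed
  finally show ?thesis .
qed

lemma sum_sum_type: "sum f (UNIV :: ('a::finite + 'b::finite) set) = (\<Sum>i\<in>UNIV. f (Inl i)) + (\<Sum>j\<in>UNIV. f (Inr j))"
  unfolding UNIV_Plus_UNIV[symmetric] by (subst sum.Plus) simp_all

text \<open>The weights \<open>s\<close> of the five extra knots over \<open>x\<close>. They leave \<open>x - \<Sum>s\<^sub>j k\<^sub>j\<close> with total weight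
\<open>1 - \<Sum>s\<^sub>j\<close>, and the second condition says that the weights then forced on the base triangle \<open>u\<close>
are nonnegative.\<close>

definition base_coords :: "(3 \<Rightarrow> real^2) \<Rightarrow> (5 \<Rightarrow> real^2) \<Rightarrow> real^2 \<Rightarrow> (real^5) set" where
  "base_coords u k x = {s. (\<forall>j. 0 \<le> s $ j) \<and>
     (\<forall>i. 0 \<le> barycentric u x i - (\<Sum>j\<in>UNIV. s $ j * barycentric u (k j) i))}"

text \<open>The weights on the base triangle are determined by those on the extra knots, because the vertices
of a nondegenerate triangle are affinely independent.\<close>

lemma bary_comb_sum:
  assumes nc: "\<not> collinear {u 1, u 2, u 3}"
  shows "((\<Sum>i\<in>UNIV. r i *\<^sub>R u i) + (\<Sum>j\<in>UNIV. s j *\<^sub>R k j) = x \<and> sum r UNIV + sum s (UNIV :: 'n::finite set) = 1)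
    \<longleftrightarrow> r = (\<lambda>i. barycentric u x i - (\<Sum>j\<in>UNIV. s j * barycentric u (k j) i))"
proof -
  define q where "q = (\<lambda>i. \<Sum>j\<in>UNIV. s j * barycentric u (k j) i)"
  have q: "(\<Sum>i\<in>UNIV. q i *\<^sub>R u i) = (\<Sum>j\<in>UNIV. s j *\<^sub>R k j)" "sum q UNIV = sum s UNIV"
  proof -
    have "(\<Sum>i\<in>UNIV. q i *\<^sub>R u i) = (\<Sum>j\<in>UNIV. \<Sum>i\<in>UNIV. (s j * barycentric u (k j) i) *\<^sub>R u i)"
      unfolding q_def scaleR_sum_left by (rule sum.swap)
    also have "\<dots> = (\<Sum>j\<in>UNIV. s j *\<^sub>R (\<Sum>i\<in>UNIV. barycentric u (k j) i *\<^sub>R u i))"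
      by (simp add: scaleR_sum_right)
    finally show "(\<Sum>i\<in>UNIV. q i *\<^sub>R u i) = (\<Sum>j\<in>UNIV. s j *\<^sub>R k j)"
      using bary_comb[OF nc] by (simp add: sum_3)
    have "sum q UNIV = (\<Sum>j\<in>UNIV. s j * (\<Sum>i\<in>UNIV. barycentric u (k j) i))"
      unfolding q_def sum_distrib_left by (rule sum.swap)
    then show "sum q UNIV = sum s UNIV" using bary_sum[OF nc] by (simp add: sum_3)
  qed
  have "((\<Sum>i\<in>UNIV. r i *\<^sub>R u i) + (\<Sum>j\<in>UNIV. s j *\<^sub>R k j) = x \<and> sum r UNIV + sum s UNIV = 1)
    \<longleftrightarrow> ((\<Sum>i\<in>UNIV. (r i + q i) *\<^sub>R u i) = x \<and> (\<Sum>i\<in>UNIV. r i + q i) = 1)"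
    by (simp add: q[symmetric] sum.distrib scaleR_add_left)
  also have "\<dots> \<longleftrightarrow> barycentric u x = (\<lambda>i. r i + q i)"
  proof
    assume *: "(\<Sum>i\<in>UNIV. (r i + q i) *\<^sub>R u i) = x \<and> (\<Sum>i\<in>UNIV. r i + q i) = 1"
    show "barycentric u x = (\<lambda>i. r i + q i)"
      by (rule bary_unique[OF nc]) (use * in \<open>auto simp: sum_3\<close>)
  next
    assume *: "barycentric u x = (\<lambda>i. r i + q i)"
    show "(\<Sum>i\<in>UNIV. (r i + q i) *\<^sub>R u i) = x \<and> (\<Sum>i\<in>UNIV. r i + q i) = 1"
      using bary_props[OF nc, of x] unfolding sum_3 * by simp
  qed
  also have "\<dots> \<longleftrightarrow> r = (\<lambda>i. barycentric u x i - q i)"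
    by (auto simp: fun_eq_iff)
  finally show ?thesis unfolding q_def .
qed

text \<open>In the coordinates \<open>s\<close> the fibre over \<open>x\<close> becomes \<open>base_coords u k x\<close>, by an affine map whose linear
part \<open>L\<close> is the same for all \<open>x\<close>. The determinant of \<open>L\<close> depends on the chosen simplex, the set
\<open>base_coords u k x\<close> does not.\<close>

lemma simplex_slice:
  fixes u :: "3 \<Rightarrow> real^2" and k :: "5 \<Rightarrow> real^2" and w :: "3 + 5 \<Rightarrow> (real^2) \<times> (real^5)"
  assumes nc: "\<not> collinear {u 1, u 2, u 3}"
    and w: "inj w" "\<And>i. fst (w i) = case_sum u k i"
  obtains L y where "linear L"
    "\<And>x. {z. (x, z) \<in> convex hull (range w)} = (\<lambda>s. y x + L s) ` base_coords u k x"
proof -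
  define a b where "a = (\<lambda>i. snd (w (Inl i)))" and "b = (\<lambda>j. snd (w (Inr j)))"
  define r where "r = (\<lambda>x s i. barycentric u x i - (\<Sum>j\<in>UNIV. s $ j * barycentric u (k j) i))"
  define y where "y = (\<lambda>x. \<Sum>i\<in>UNIV. barycentric u x i *\<^sub>R a i)"
  define L where "L = (\<lambda>s::real^5. (\<Sum>j\<in>UNIV. s $ j *\<^sub>R b j)
      - (\<Sum>i\<in>UNIV. (\<Sum>j\<in>UNIV. s $ j * barycentric u (k j) i) *\<^sub>R a i))"
  have "linear L"
    by (rule linearI)
       (simp_all add: L_def scaleR_add_left sum.distrib distrib_right scaleR_diff_right scaleR_sum_right
         sum_distrib_left[symmetric] mult.assoc)
  moreover have "{z. (x, z) \<in> convex hull (range w)} = (\<lambda>s. y x + L s) ` base_coords u k x" for x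
  proof -
    have yL: "y x + L s = (\<Sum>i\<in>UNIV. r x s i *\<^sub>R a i) + (\<Sum>j\<in>UNIV. s $ j *\<^sub>R b j)" for s
      unfolding y_def L_def r_def by (simp add: scaleR_diff_left sum_subtractf)
    have fw: "fst (w (Inl i)) = u i" "fst (w (Inr j)) = k j" for i j using w(2) by simp_all
    have eq: "(x, z) = (\<Sum>i\<in>UNIV. t i *\<^sub>R w i) \<and> sum t UNIV = 1 \<longleftrightarrow>
        (\<lambda>i. t (Inl i)) = r x (\<chi> j. t (Inr j)) \<and> z = y x + L (\<chi> j. t (Inr j))" for t z
    proof -
      let ?R = "(\<lambda>i. t (Inl i)) = r x (\<chi> j. t (Inr j))"
      let ?z = "(\<Sum>i\<in>UNIV. t (Inl i) *\<^sub>R a i) + (\<Sum>j\<in>UNIV. t (Inr j) *\<^sub>R b j)"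
      let ?x = "(\<Sum>i\<in>UNIV. t (Inl i) *\<^sub>R u i) + (\<Sum>j\<in>UNIV. t (Inr j) *\<^sub>R k j)"
      have "(\<Sum>i\<in>UNIV. t i *\<^sub>R w i) = (?x, ?z)"
        by (simp add: prod_eq_iff fst_sum snd_sum sum_sum_type fw a_def b_def)
      moreover have "(?x = x \<and> (\<Sum>i\<in>UNIV. t (Inl i)) + (\<Sum>j\<in>UNIV. t (Inr j)) = 1) \<longleftrightarrow> ?R"
        using bary_comb_sum[OF nc, of "\<lambda>i. t (Inl i)" "\<lambda>j. t (Inr j)" k x] by (simp add: r_def)
      moreover have "y x + L (\<chi> j. t (Inr j)) = ?z" if R: ?R
        unfolding yL using fun_cong[OF R] by simp
      ultimately show ?thesis unfolding sum_sum_type[of t] by auto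
    qed
    show ?thesis
    proof (intro set_eqI iffI)
      fix z assume "z \<in> {z. (x, z) \<in> convex hull (range w)}"
      then obtain t where t: "(x, z) = (\<Sum>i\<in>UNIV. t i *\<^sub>R w i)" "\<forall>i. 0 \<le> t i" "sum t UNIV = 1"
        unfolding convex_hull_range[OF w(1)] by blast
      then have e: "(\<lambda>i. t (Inl i)) = r x (\<chi> j. t (Inr j))" "z = y x + L (\<chi> j. t (Inr j))"
        using eq by blast+
      have "r x (\<chi> j. t (Inr j)) i \<ge> 0" for i using t(2) e(1) by metis
      then have "(\<chi> j. t (Inr j)) \<in> base_coords u k x"
        using t(2) by (simp add: base_coords_def r_def)
      then show "z \<in> (\<lambda>s. y x + L s) ` base_coords u k x" using e by blast
    next
      fix z assume "z \<in> (\<lambda>s. y x + L s) ` base_coords u k x"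
      then obtain s where s: "s \<in> base_coords u k x" "z = y x + L s" by blast
      define t where "t = case_sum (r x s) (($) s)"
      have "(x, z) = (\<Sum>i\<in>UNIV. t i *\<^sub>R w i) \<and> sum t UNIV = 1"
        unfolding eq using s by (simp add: t_def)
      moreover have "\<forall>i. 0 \<le> t i"
        using s(1) by (auto simp: t_def base_coords_def r_def split: sum.split)
      ultimately show "z \<in> {z. (x, z) \<in> convex hull (range w)}"
        unfolding convex_hull_range[OF w(1)] by blast
    qed
  qed
  ultimately show ?thesis using that by blast
qed

lemma continuous_on_bary:
  assumes nc: "\<not> collinear {u 1, u 2, u 3}"
  shows "continuous_on S (\<lambda>x. barycentric u x i)"
proof -
  obtain A c where "\<And>x i. barycentric u x i = A i \<bullet> x + c i" using bary_affine[OF nc] by blast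
  then show ?thesis by (auto intro!: continuous_intros)
qed

lemma closed_base_coords_graph:
  assumes nc: "\<not> collinear {u 1, u 2, u 3}"
  shows "closed {p. snd p \<in> base_coords u k (fst p)}"
proof -
  have [continuous_intros]: "continuous_on UNIV (\<lambda>p::(real^2)\<times>(real^5). barycentric u (fst p) i)" for i
    using continuous_on_compose[OF continuous_on_fst[OF continuous_on_id] continuous_on_bary[OF nc]]
    by (simp add: o_def)
  have "{p. snd p \<in> base_coords u k (fst p)} = (\<Inter>j. {p. 0 \<le> snd p $ j}) \<inter>
     (\<Inter>i. {p. 0 \<le> barycentric u (fst p) i - (\<Sum>j\<in>UNIV. snd p $ j * barycentric u (k j) i)})"
    by (auto simp: base_coords_def)
  also have "closed \<dots>"
    by (intro closed_Int closed_INT ballI closed_Collect_le continuous_intros)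
  finally show ?thesis .
qed

lemma compact_base_coords:
  assumes nc: "\<not> collinear {u 1, u 2, u 3}"
  shows "compact (base_coords u k x)"
proof -
  have "base_coords u k x = Pair x -` {p. snd p \<in> base_coords u k (fst p)}" by auto
  also have "closed \<dots>"
    by (rule continuous_closed_vimage[OF closed_base_coords_graph[OF nc]]) (auto intro: continuous_intros)
  finally have cl: "closed (base_coords u k x)" .
  have "base_coords u k x \<subseteq> cbox 0 1"
  proof
    fix s assume s: "s \<in> base_coords u k x"
    then have s0: "s $ j \<ge> 0" for j by (simp add: base_coords_def)
    let ?r = "\<lambda>i. barycentric u x i - (\<Sum>j\<in>UNIV. s $ j * barycentric u (k j) i)"
    have "sum ?r UNIV + (\<Sum>j\<in>UNIV. s $ j) = 1"
      using bary_comb_sum[OF nc, of ?r "\<lambda>j. s $ j" k x] by blast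
    moreover have "sum ?r UNIV \<ge> 0" using s by (intro sum_nonneg) (simp add: base_coords_def)
    ultimately have le: "(\<Sum>j\<in>UNIV. s $ j) \<le> 1" by linarith
    have "s $ j \<le> 1" for j
      using member_le_sum[of j UNIV "\<lambda>j. s $ j"] s0 le by fastforce
    then show "s \<in> cbox 0 1" using s0 by (simp add: mem_box_cart)
  qed
  then show ?thesis using cl bounded_cbox bounded_subset compact_eq_bounded_closed by blast
qed

text \<open>For fixed \<open>s\<close> the admissible points \<open>x\<close> form a shrunken translate of the base triangle, so that slicing
the graph of \<open>base_coords u k\<close> in this direction resembles slicing the standard simplex.\<close>

lemma base_coords_fibre:
  assumes nc: "\<not> collinear {u 1, u 2, u 3}" and s: "\<And>j. 0 \<le> s $ j"
  defines "\<sigma> \<equiv> (\<Sum>j\<in>UNIV. s $ j)"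
  obtains c where "{x. s \<in> base_coords u k x} = (\<lambda>z::real^2. c + (z $ 1 *\<^sub>R (u 1 - u 3) + z $ 2 *\<^sub>R (u 2 - u 3)))
      ` {z. 0 \<le> z $ 1 \<and> 0 \<le> z $ 2 \<and> z $ 1 + z $ 2 + \<sigma> \<le> 1}"
proof -
  define q where "q = (\<lambda>i. \<Sum>j\<in>UNIV. s $ j * barycentric u (k j) i)"
  have q\<sigma>: "q 1 + q 2 + q 3 = \<sigma>"
  proof -
    have "sum q UNIV = (\<Sum>j\<in>UNIV. s $ j * (\<Sum>i\<in>UNIV. barycentric u (k j) i))"
      unfolding q_def sum_distrib_left by (rule sum.swap)
    then show ?thesis using bary_sum[OF nc] by (simp add: sum_3 \<sigma>_def)
  qed
  have *: "s \<in> base_coords u k x \<longleftrightarrow> (\<forall>i. q i \<le> barycentric u x i)" for x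
    using s by (simp add: base_coords_def q_def)
  define c where "c = u 3 + q 1 *\<^sub>R (u 1 - u 3) + q 2 *\<^sub>R (u 2 - u 3)"
  let ?f = "\<lambda>z::real^2. c + (z $ 1 *\<^sub>R (u 1 - u 3) + z $ 2 *\<^sub>R (u 2 - u 3))"
  have "{x. s \<in> base_coords u k x} = ?f ` {z. 0 \<le> z $ 1 \<and> 0 \<le> z $ 2 \<and> z $ 1 + z $ 2 + \<sigma> \<le> 1}"
  proof (intro set_eqI iffI)
    fix x assume "x \<in> {x. s \<in> base_coords u k x}"
    then have b: "q i \<le> barycentric u x i" for i using * by blast
    have l3: "barycentric u x 3 = 1 - barycentric u x 1 - barycentric u x 2" using bary_sum[OF nc, of x] by linarith
    define z :: "real^2" where "z = vector [barycentric u x 1 - q 1, barycentric u x 2 - q 2]"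
    have z: "z $ 1 = barycentric u x 1 - q 1" "z $ 2 = barycentric u x 2 - q 2" by (simp_all add: z_def)
    have "x = barycentric u x 1 *\<^sub>R u 1 + barycentric u x 2 *\<^sub>R u 2 + barycentric u x 3 *\<^sub>R u 3"
      using bary_comb[OF nc] by simp
    also have "\<dots> = ?f z" unfolding z c_def l3 by (simp add: algebra_simps)
    finally have "x = ?f z" .
    moreover have "0 \<le> z $ 1 \<and> 0 \<le> z $ 2 \<and> z $ 1 + z $ 2 + \<sigma> \<le> 1"
      using b[of 1] b[of 2] b[of 3] q\<sigma> l3 z by linarith
    ultimately show "x \<in> ?f ` {z. 0 \<le> z $ 1 \<and> 0 \<le> z $ 2 \<and> z $ 1 + z $ 2 + \<sigma> \<le> 1}" by blast
  next
    fix x assume "x \<in> ?f ` {z. 0 \<le> z $ 1 \<and> 0 \<le> z $ 2 \<and> z $ 1 + z $ 2 + \<sigma> \<le> 1}"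
    then obtain z where z: "x = ?f z" "0 \<le> z $ 1" "0 \<le> z $ 2" "z $ 1 + z $ 2 + \<sigma> \<le> 1" by blast
    define l :: "3 \<Rightarrow> real" where "l = (\<lambda>i. if i = 1 then q 1 + z $ 1 else if i = 2 then q 2 + z $ 2
       else 1 - q 1 - z $ 1 - q 2 - z $ 2)"
    have l: "l 1 = q 1 + z $ 1" "l 2 = q 2 + z $ 2" "l 3 = 1 - q 1 - z $ 1 - q 2 - z $ 2"
      by (simp_all add: l_def)
    have "barycentric u x = l"
    proof (rule bary_unique[OF nc])
      show "l 1 *\<^sub>R u 1 + l 2 *\<^sub>R u 2 + l 3 *\<^sub>R u 3 = x"
        unfolding z(1) c_def l by (simp add: algebra_simps)
    qed (simp add: l)
    moreover have "\<forall>i. q i \<le> l i" unfolding forall_3 l using z q\<sigma> by linarith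
    ultimately show "x \<in> {x. s \<in> base_coords u k x}" using * by simp
  qed
  then show ?thesis using that by blast
qed

lemma std_simplex_prod:
  "convex hull (insert 0 Basis) = {p :: (real^2) \<times> (real^5).
      (\<forall>j. 0 \<le> snd p $ j) \<and> 0 \<le> fst p $ 1 \<and> 0 \<le> fst p $ 2 \<and> fst p $ 1 + fst p $ 2 + (\<Sum>j\<in>UNIV. snd p $ j) \<le> 1}"
proof -
  have B: "Basis = (\<lambda>e. (e, 0)) ` range (\<lambda>j::2. axis j (1::real)) \<union> Pair 0 ` range (\<lambda>j::5. axis j (1::real))"
    by (auto simp: Basis_prod_def Basis_vec_def)
  have i2: "inj (\<lambda>j::2. axis j (1::real))" and i5: "inj (\<lambda>j::5. axis j (1::real))"
    by (auto simp: inj_def axis_eq_axis)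
  have S: "sum ((\<bullet>) p) Basis = fst p $ 1 + fst p $ 2 + (\<Sum>j\<in>UNIV. snd p $ j)" for p :: "(real^2) \<times> (real^5)"
    unfolding Basis_prod_def
    by (subst sum.union_disjoint)
       (auto simp: Basis_vec_def sum.reindex inj_on_def inner_axis sum_2 axis_eq_axis UNION_singleton_eq_range
          inner_prod_def)
  have N: "(\<forall>i\<in>Basis. 0 \<le> p \<bullet> i) \<longleftrightarrow> (\<forall>j. 0 \<le> snd p $ j) \<and> 0 \<le> fst p $ 1 \<and> 0 \<le> fst p $ 2" for p :: "(real^2) \<times> (real^5)"
    unfolding B by (auto simp: ball_Un inner_prod_def inner_axis forall_2)
  show ?thesis
    unfolding substd_simplex[of Basis, OF subset_refl] using S N by (simp add: conj_assoc)
qed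

text \<open>Both this set and the standard 7-simplex, of volume 1/7!, are sliced over \<open>s\<close>; by \<open>base_coords_fibre\<close>
corresponding slices have areas in the ratio \<open>\<bar>tri_det u\<bar>\<close>.\<close>

lemma emeasure_base_coords_graph:
  assumes nc: "\<not> collinear {u 1, u 2, u 3}"
  shows "emeasure lborel {p. snd p \<in> base_coords u k (fst p)} = ennreal (\<bar>tri_det u\<bar> / 5040)"
proof -
  let ?G = "{p. snd p \<in> base_coords u k (fst p)}"
  define M where "M = (\<lambda>z::real^2. z $ 1 *\<^sub>R (u 1 - u 3) + z $ 2 *\<^sub>R (u 2 - u 3))"
  have linM: "linear M" by (rule linearI) (auto simp: M_def algebra_simps)
  have detM: "det (matrix M) = tri_det u"
    by (simp add: det_2 matrix_def M_def tri_det_def axis_def algebra_simps)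
  define Z where "Z = (\<lambda>\<sigma>::real. {z::real^2. 0 \<le> z $ 1 \<and> 0 \<le> z $ 2 \<and> z $ 1 + z $ 2 + \<sigma> \<le> 1})"
  have Zc: "compact (Z \<sigma>)" for \<sigma>
  proof -
    have "Z \<sigma> \<subseteq> cbox 0 (vector [1 - \<sigma>, 1 - \<sigma>])"
      by (auto simp: Z_def mem_box_cart forall_2)
    moreover have "closed (Z \<sigma>)"
      unfolding Z_def by (intro closed_Collect_conj closed_Collect_le continuous_intros)
    ultimately show ?thesis using bounded_cbox bounded_subset compact_eq_bounded_closed by blast
  qed
  let ?S = "convex hull (insert 0 (Basis :: ((real^2) \<times> (real^5)) set))"
  have Gb: "?G \<in> sets (lborel \<Otimes>\<^sub>M lborel)"
    unfolding lborel_prod using closed_base_coords_graph[OF nc] by (simp add: borel_closed)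
  have "closed ?S" by (intro compact_imp_closed compact_convex_hull finite_imp_compact) simp
  then have Sb: "?S \<in> sets (lborel \<Otimes>\<^sub>M lborel)" unfolding lborel_prod by (simp add: borel_closed)
  have "emeasure lborel ?G = (\<integral>\<^sup>+s. emeasure lborel ((\<lambda>x. (x, s)) -` ?G) \<partial>lborel)"
    using lborel_pair.emeasure_pair_measure_alt2[OF Gb] by (simp add: lborel_prod)
  also have "\<dots> = (\<integral>\<^sup>+s. ennreal \<bar>tri_det u\<bar> * emeasure lborel ((\<lambda>x. (x, s)) -` ?S) \<partial>lborel)"
  proof (rule nn_integral_cong)
    fix s :: "real^5"
    show "emeasure lborel ((\<lambda>x. (x, s)) -` ?G) = ennreal \<bar>tri_det u\<bar> * emeasure lborel ((\<lambda>x. (x, s)) -` ?S)"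
    proof (cases "\<forall>j. 0 \<le> s $ j")
      case True
      obtain c where c: "{x. s \<in> base_coords u k x} = (\<lambda>z. c + M z) ` Z (\<Sum>j\<in>UNIV. s $ j)"
        using base_coords_fibre[OF nc, of s k] True unfolding M_def Z_def by blast
      have "(\<lambda>x. (x, s)) -` ?G = {x. s \<in> base_coords u k x}" by auto
      moreover have "(\<lambda>x. (x, s)) -` ?S = Z (\<Sum>j\<in>UNIV. s $ j)"
        unfolding std_simplex_prod using True by (auto simp: Z_def)
      ultimately show ?thesis
        using emeasure_affine_image[OF linM Zc, of c] by (simp add: c detM)
    next
      case False
      then have "(\<lambda>x. (x, s)) -` ?G = {}" "(\<lambda>x. (x, s)) -` ?S = {}"
        unfolding std_simplex_prod by (auto simp: base_coords_def)
      then show ?thesis by simp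
    qed
  qed
  also have "\<dots> = ennreal \<bar>tri_det u\<bar> * (\<integral>\<^sup>+s. emeasure lborel ((\<lambda>x. (x, s)) -` ?S) \<partial>lborel)"
    using lborel_pair.measurable_emeasure_Pair2[OF Sb] by (intro nn_integral_cmult) simp
  also have "(\<integral>\<^sup>+s. emeasure lborel ((\<lambda>x. (x, s)) -` ?S) \<partial>lborel) = emeasure lborel ?S"
    using lborel_pair.emeasure_pair_measure_alt2[OF Sb] by (simp add: lborel_prod)
  also have "\<dots> = ennreal (1 / 5040)"
    by (subst emeasure_std_simplex) (simp add: fact_numeral)
  finally show ?thesis by (simp add: ennreal_mult[symmetric])
qed

text \<open>Numerator and denominator both contain the determinant of the linear part from \<open>simplex_slice\<close>, and it
is nonzero because a simplex has positive volume. This is why the spline does not depend on the simplex.\<close>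

lemma simplex_ratio:
  fixes u :: "3 \<Rightarrow> real^2" and k :: "5 \<Rightarrow> real^2"
  assumes nc: "\<not> collinear {u 1, u 2, u 3}"
    and V: "simplex_over (image_mset (case_sum u k) (mset_set UNIV)) V"
  shows "measure lebesgue {y. (x, y) \<in> convex hull V} / measure lebesgue (convex hull V)
     = 5040 / \<bar>tri_det u\<bar> * measure lborel (base_coords u k x)"
proof -
  obtain w where w: "inj w" "range w = V" "\<And>i. fst (w i) = case_sum u k i"
    using simplex_over_param[OF V] by blast
  obtain L y where L: "linear L"
    and sl: "\<And>x. {z. (x, z) \<in> convex hull V} = (\<lambda>s. y x + L s) ` base_coords u k x"
    using simplex_slice[OF nc w(1,3)] w(2) by blast
  define d where "d = \<bar>det (matrix L)\<bar>"
  have finV: "finite V" and indep: "\<not> affine_dependent V" using V by (auto simp: simplex_over_def)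
  have slm: "emeasure lborel {z. (x, z) \<in> convex hull V} = ennreal d * emeasure lborel (base_coords u k x)" for x
    unfolding sl d_def by (rule emeasure_affine_image[OF L compact_base_coords[OF nc]])
  have cV: "compact (convex hull V)" using finV by (simp add: finite_imp_compact compact_convex_hull)
  then have Vb: "convex hull V \<in> sets (lborel \<Otimes>\<^sub>M lborel)"
    unfolding lborel_prod by (simp add: borel_compact)
  let ?G = "{p. snd p \<in> base_coords u k (fst p)}"
  have Gb: "?G \<in> sets (lborel \<Otimes>\<^sub>M lborel)"
    unfolding lborel_prod using closed_base_coords_graph[OF nc] by (simp add: borel_closed)
  have "emeasure lborel (convex hull V) = (\<integral>\<^sup>+x. emeasure lborel (Pair x -` (convex hull V)) \<partial>lborel)"
    using lborel.emeasure_pair_measure_alt[OF Vb] by (simp add: lborel_prod)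
  also have "\<dots> = (\<integral>\<^sup>+x. ennreal d * emeasure lborel (Pair x -` ?G) \<partial>lborel)"
    using slm by (intro nn_integral_cong) (simp add: vimage_def)
  also have "\<dots> = ennreal d * (\<integral>\<^sup>+x. emeasure lborel (Pair x -` ?G) \<partial>lborel)"
    using lborel.measurable_emeasure_Pair[OF Gb] by (intro nn_integral_cmult) simp
  also have "(\<integral>\<^sup>+x. emeasure lborel (Pair x -` ?G) \<partial>lborel) = emeasure lborel ?G"
    using lborel.emeasure_pair_measure_alt[OF Gb] by (simp add: lborel_prod)
  also have "\<dots> = ennreal (\<bar>tri_det u\<bar> / 5040)" by (rule emeasure_base_coords_graph[OF nc])
  finally have vol: "measure lborel (convex hull V) = d * (\<bar>tri_det u\<bar> / 5040)"
    by (simp add: measure_def d_def enn2real_mult)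
  have "card V = Suc DIM((real^2) \<times> (real^5))"
    using card_image[OF w(1)] w(2) by simp
  then have "interior (convex hull V) \<noteq> {}"
    using interior_convex_hull_eq_empty indep by blast
  then have "\<not> negligible (convex hull V)"
    using negligible_convex_interior[OF convex_convex_hull] by blast
  then have "measure lebesgue (convex hull V) \<noteq> 0"
    using negligible_iff_measure cV lmeasurable_compact by blast
  then have "measure lborel (convex hull V) \<noteq> 0"
    using cV by (simp add: measure_completion borel_compact)
  then have d: "d \<noteq> 0" using vol by auto
  have "closed {z. (x, z) \<in> convex hull V}"
    using continuous_closed_vimage[OF compact_imp_closed[OF cV], of "Pair x"]
    by (auto simp: vimage_def intro: continuous_intros)
  then have "measure lebesgue {z. (x, z) \<in> convex hull V} = measure lborel {z. (x, z) \<in> convex hull V}"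
    by (simp add: measure_completion borel_closed)
  also have "\<dots> = d * measure lborel (base_coords u k x)"
    using slm[of x] by (simp add: measure_def d_def enn2real_mult)
  finally have A: "measure lebesgue {z. (x, z) \<in> convex hull V} = d * measure lborel (base_coords u k x)" .
  have B: "measure lebesgue (convex hull V) = d * (\<bar>tri_det u\<bar> / 5040)"
    using vol cV by (simp add: measure_completion borel_compact)
  have "tri_det u \<noteq> 0" using tri_det_nonzero_iff[of u] nc by simp
  then show ?thesis unfolding A B using d by simp
qed

text \<open>Lifting the extra knots to the five coordinate directions gives a simplex. Existence is needed as the
simplex in the definition of a simplex spline is selected by a choice operator.\<close>

lemma simplex_over_exists:
  fixes u :: "3 \<Rightarrow> real^2" and k :: "5 \<Rightarrow> real^2"
  assumes nc: "\<not> collinear {u 1, u 2, u 3}"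
  shows "\<exists>V. simplex_over (image_mset (case_sum u k) (mset_set UNIV)) V"
proof -
  define w :: "3 + 5 \<Rightarrow> (real^2) \<times> (real^5)"
    where "w = case_sum (\<lambda>i. (u i, 0)) (\<lambda>j. (k j, axis j 1))"
  have indep: "\<forall>i. t i = 0" if t: "sum t UNIV = 0" "(\<Sum>i\<in>UNIV. t i *\<^sub>R w i) = 0" for t
  proof -
    have "fst (\<Sum>i\<in>UNIV. t i *\<^sub>R w i) = 0" "snd (\<Sum>i\<in>UNIV. t i *\<^sub>R w i) = 0" using t by simp_all
    then have f: "(\<Sum>i\<in>UNIV. t (Inl i) *\<^sub>R u i) + (\<Sum>j\<in>UNIV. t (Inr j) *\<^sub>R k j) = 0"
      and s: "(\<Sum>j\<in>UNIV. t (Inr j) *\<^sub>R axis j (1::real)) = (0 :: real^5)"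
      by (simp_all add: fst_sum snd_sum sum_sum_type w_def)
    have r0: "t (Inr j) = 0" for j
    proof -
      have "(\<Sum>i\<in>UNIV. t (Inr i) *\<^sub>R axis i (1::real)) $ j = t (Inr j)"
        by (simp add: axis_def if_distrib cong: if_cong)
      then show ?thesis using s by simp
    qed
    have "(\<Sum>i\<in>UNIV. (barycentric u 0 i + t (Inl i)) *\<^sub>R u i) = 0"
    proof -
      have "(\<Sum>i\<in>UNIV. (barycentric u 0 i + t (Inl i)) *\<^sub>R u i)
          = (\<Sum>i\<in>UNIV. barycentric u 0 i *\<^sub>R u i) + (\<Sum>i\<in>UNIV. t (Inl i) *\<^sub>R u i)"
        by (simp add: scaleR_add_left sum.distrib)
      then show ?thesis using f r0 bary_comb[OF nc, of 0] by (simp add: sum_3)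
    qed
    moreover have "(\<Sum>i\<in>UNIV. barycentric u 0 i + t (Inl i)) = 1"
      using t(1) r0 bary_sum[OF nc, of 0] by (simp add: sum_sum_type sum.distrib sum_3)
    ultimately have "barycentric u 0 = (\<lambda>i. barycentric u 0 i + t (Inl i))"
      by (intro bary_unique[OF nc]) (simp_all add: sum_3)
    then have "t (Inl i) = 0" for i by (metis add_cancel_left_right)
    with r0 show ?thesis by (metis sum.exhaust)
  qed
  have inj: "inj w"
  proof (rule injI)
    fix i j assume e: "w i = w j"
    show "i = j"
    proof (rule ccontr)
      assume ij: "i \<noteq> j"
      define t where "t = (\<lambda>l. (if l = i then 1 else 0) - (if l = j then 1 else (0::real)))"
      have "(\<Sum>l\<in>UNIV. t l *\<^sub>R w l) = w i - w j"
        unfolding t_def scaleR_diff_left sum_subtractf by (simp add: if_distrib[of "\<lambda>c. c *\<^sub>R _"] cong: if_cong)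
      then have "(\<Sum>l\<in>UNIV. t l *\<^sub>R w l) = 0" using e by (simp only: diff_self)
      moreover have "sum t UNIV = 0" by (simp add: t_def sum_subtractf)
      ultimately have "t i = 0" using indep[of t] by blast
      then show False using ij by (simp add: t_def)
    qed
  qed
  have "\<not> affine_dependent (range w)"
  proof
    assume "affine_dependent (range w)"
    then obtain U where U: "sum U (range w) = 0" "\<exists>x\<in>range w. U x \<noteq> 0" "(\<Sum>x\<in>range w. U x *\<^sub>R x) = 0"
      using affine_dependent_explicit_finite[of "range w"] by auto
    have "\<forall>i. (U \<circ> w) i = 0"
      by (rule indep) (use U inj in \<open>simp_all add: sum.reindex\<close>)
    then show False using U(2) by auto
  qed
  moreover have "image_mset fst (mset_set (range w)) = image_mset (case_sum u k) (mset_set UNIV)"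
  proof -
    have "fst \<circ> w = case_sum u k" by (auto simp: w_def fun_eq_iff split: sum.split)
    then show ?thesis using image_mset_mset_set[OF inj] by (metis multiset.map_comp)
  qed
  ultimately have "simplex_over (image_mset (case_sum u k) (mset_set UNIV)) (range w)"
    by (simp add: simplex_over_def)
  then show ?thesis by blast
qed

lemma area_triangle: "measure lebesgue (triangle_of v) = \<bar>tri_det v\<bar> / 2"
proof -
  have "compact (triangle_of v)"
    unfolding triangle_of_def by (intro compact_convex_hull finite_imp_compact) simp
  then have "measure lebesgue (triangle_of v) = measure lborel (convex hull {v 3, v 1, v 2})"
    by (simp add: measure_completion borel_compact triangle_of_def range_3 insert_commute)
  then show ?thesis
    by (simp add: content_triangle tri_det_def)
qed

text \<open>The constant is \<open>120 = 5040 / (2 \<cdot> 21)\<close>, from the volume of the 7-simplex, the area of a triangle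
as half a determinant, and the normalization by \<open>7 choose 2\<close>.\<close>

lemma simplex_spline_eq:
  assumes nc: "\<not> collinear {v 1, v 2, v 3}" "\<not> collinear {u 1, u 2, u 3}"
    and K: "knots v m = image_mset (case_sum u k) (mset_set UNIV)"
  shows "simplex_spline v m x = 120 * (\<bar>tri_det v\<bar> / \<bar>tri_det u\<bar>) * measure lborel (base_coords u k x)"
proof -
  define V where "V = (SOME V. simplex_over (knots v m) V)"
  have V: "simplex_over (image_mset (case_sum u k) (mset_set UNIV)) V"
    using someI_ex[OF simplex_over_exists[OF nc(2), of k]] unfolding V_def K .
  have ch: "real (7 choose 2) = 21" by (simp add: choose_two)
  show ?thesis
    unfolding simplex_spline_def Let_def V_def[symmetric] simplex_ratio[OF nc(2) V] area_triangle ch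
    by simp
qed

section \<open>Simplex splines over the corner and the medial triangle\<close>

definition bary3 :: "(3 \<Rightarrow> real^2) \<Rightarrow> real^2 \<Rightarrow> real \<times> real \<times> real" where
  "bary3 v x = (barycentric v x 1, barycentric v x 2, barycentric v x 3)"

text \<open>The barycentric coordinates of the six points of the split, in the order of \<open>ps_points\<close>.\<close>

definition knot_coords :: "(real \<times> real \<times> real) list" where
  "knot_coords = [(1,0,0), (0,1,0), (0,0,1), (1/2,1/2,0), (0,1/2,1/2), (1/2,0,1/2)]"

lemma bary3_ps_points:
  assumes nc: "\<not> collinear {v 1, v 2, v 3}" and "i < 6"
  shows "bary3 v (ps_points v ! i) = knot_coords ! i"
proof -
  have *: "bary3 v (a *\<^sub>R v 1 + b *\<^sub>R v 2 + c *\<^sub>R v 3) = (a, b, c)" if "a + b + c = 1" for a b c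
  proof -
    define l :: "3 \<Rightarrow> real" where "l = (\<lambda>i. if i = 1 then a else if i = 2 then b else c)"
    have "barycentric v (a *\<^sub>R v 1 + b *\<^sub>R v 2 + c *\<^sub>R v 3) = l"
      by (rule bary_unique[OF nc]) (use that in \<open>simp_all add: l_def\<close>)
    then show ?thesis by (simp add: bary3_def l_def)
  qed
  have "i \<in> {0,1,2,3,4,5}" using assms(2) by auto
  moreover have "bary3 v (v 1) = (1,0,0)" using *[of 1 0 0] by simp
  moreover have "bary3 v (v 2) = (0,1,0)" using *[of 0 1 0] by simp
  moreover have "bary3 v (v 3) = (0,0,1)" using *[of 0 0 1] by simp
  moreover have "bary3 v (midpoint (v 1) (v 2)) = (1/2,1/2,0)"
    using *[of "1/2" "1/2" 0] by (simp add: midpoint_def scaleR_add_right inverse_eq_divide)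
  moreover have "bary3 v (midpoint (v 2) (v 3)) = (0,1/2,1/2)"
    using *[of 0 "1/2" "1/2"] by (simp add: midpoint_def scaleR_add_right inverse_eq_divide)
  moreover have "bary3 v (midpoint (v 1) (v 3)) = (1/2,0,1/2)"
    using *[of "1/2" 0 "1/2"] by (simp add: midpoint_def scaleR_add_right inverse_eq_divide)
  ultimately show ?thesis
    unfolding ps_points_def knot_coords_def by (elim insertE emptyE) simp_all
qed

lemma map2_replicate_map: "map2 replicate m (map f xs) = map (map f) (map2 replicate m xs)"
  by (simp add: zip_map2 case_prod_unfold o_def map_replicate)

lemma UNIV_5: "(UNIV :: 5 set) = {1, 2, 3, 4, 5}"
proof -
  have "card {1, 2, 3, 4, 5 :: 5} = card (UNIV :: 5 set)" by simp
  then show ?thesis by (intro card_subset_eq[symmetric]) auto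
qed

definition base_cone :: "(3 \<Rightarrow> real \<times> real \<times> real \<Rightarrow> real) \<Rightarrow> (real \<times> real \<times> real) set" where
  "base_cone l = {b. \<forall>i. 0 \<le> l i b}"

text \<open>Here everything is moved to the barycentric coordinates of \<open>v\<close>: the linear forms \<open>l\<close> express the
coordinates with respect to the base triangle, whose vertices are the knots numbered \<open>a\<close>, \<open>b\<close>, \<open>c\<close>, and the list \<open>js\<close> numbers the
five extra knots. Both base triangles in use have a quarter of the area of \<open>v\<close>, which gives \<open>480 = 4 \<cdot> 120\<close>.\<close>

lemma simplex_spline_cone_vol:
  assumes nc: "\<not> collinear {v 1, v 2, v 3}"
    and nu: "\<not> collinear {u 1, u 2, u 3}"
    and det: "\<bar>tri_det v\<bar> = 4 * \<bar>tri_det u\<bar>"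
    and lin: "\<And>i. linear (l i)"
    and bu: "\<And>x i. barycentric u x i = l i (bary3 v x)"
    and u: "u 1 = ps_points v ! a" "u 2 = ps_points v ! b" "u 3 = ps_points v ! c"
    and js: "length js = 5" "\<forall>i\<in>set js. i < 6"
    and m: "length m = 6" "mset (concat (map2 replicate m [0..<6])) = mset ([a, b, c] @ js)"
  shows "simplex_spline v m x = 480 * enn2real (cone_vol (base_cone l) (map ((!) knot_coords) js) (bary3 v x))"
proof -
  obtain j1 j2 j3 j4 j5 where jsx: "js = [j1, j2, j3, j4, j5]"
    using js(1) by (auto simp: length_Suc_conv eval_nat_numeral)
  define \<iota> :: "5 \<Rightarrow> nat" where "\<iota> = (\<lambda>j. if j = 1 then j1 else if j = 2 then j2 else if j = 3 then j3 else if j = 4 then j4 else j5)"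
  have js': "js = map \<iota> [1,2,3,4,5]" by (simp add: jsx \<iota>_def)
  define k where "k = (\<lambda>j. ps_points v ! \<iota> j)"
  have lt: "\<iota> j < 6" for j using js(2) by (simp add: jsx \<iota>_def)
  have "knots v m = image_mset ((!) (ps_points v)) (mset (concat (map2 replicate m [0..<6])))"
  proof -
    have "ps_points v = map ((!) (ps_points v)) [0..<6]"
      by (simp add: ps_points_def upt_rec eval_nat_numeral)
    then have "map2 replicate m (ps_points v) = map (map ((!) (ps_points v))) (map2 replicate m [0..<6])"
      by (metis map2_replicate_map)
    then show ?thesis unfolding knots_def by (simp only: map_concat[symmetric] mset_map)
  qed
  also have "\<dots> = image_mset (case_sum u k) (mset_set UNIV)"
  proof -
    have "mset_set (UNIV :: (3 + 5) set) = mset_set (range Inl \<union> range Inr)"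
      by (metis UNIV_sum)
    also have "\<dots> = mset_set (range Inl) + mset_set (range Inr)"
      by (rule mset_set_Union) auto
    finally have S: "mset_set (UNIV :: (3 + 5) set) = image_mset Inl (mset_set UNIV) + image_mset Inr (mset_set UNIV)"
      by (simp add: image_mset_mset_set inj_on_def)
    have "image_mset (case_sum u k) (mset_set UNIV) = image_mset u (mset_set UNIV) + image_mset k (mset_set UNIV)"
      unfolding S by (simp only: image_mset_union multiset.map_comp o_def sum.case)
    moreover have "image_mset u (mset_set UNIV) = {#u 1, u 2, u 3#}"
      unfolding UNIV_3 by simp
    moreover have "image_mset k (mset_set UNIV) = {#k 1, k 2, k 3, k 4, k 5#}"
      unfolding UNIV_5 by simp
    ultimately have "image_mset (case_sum u k) (mset_set UNIV) = {#u 1, u 2, u 3#} + {#k 1, k 2, k 3, k 4, k 5#}"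
      by (simp only:)
    then show ?thesis
      unfolding m(2) jsx by (simp add: k_def u \<iota>_def)
  qed
  finally have K: "knots v m = image_mset (case_sum u k) (mset_set UNIV)" .
  have kb: "bary3 v (k j) = knot_coords ! \<iota> j" for j
    unfolding k_def by (rule bary3_ps_points[OF nc lt])
  have "base_coords u k x = {s. (\<forall>j. 0 \<le> s $ j) \<and>
      bary3 v x - (\<Sum>j\<in>UNIV. s $ j *\<^sub>R (knot_coords ! \<iota> j)) \<in> base_cone l}"
  proof -
    have "l i (bary3 v x - (\<Sum>j\<in>UNIV. s $ j *\<^sub>R (knot_coords ! \<iota> j)))
      = barycentric u x i - (\<Sum>j\<in>UNIV. s $ j * barycentric u (k j) i)" for s :: "real^5" and i
      by (simp add: bu kb linear_diff[OF lin] linear_sum[OF lin] linear_cmul[OF lin])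
    then show ?thesis by (simp add: base_coords_def base_cone_def)
  qed
  moreover have "base_cone l \<in> sets borel"
  proof -
    have "continuous_on UNIV (l i)" for i using lin by (simp add: linear_continuous_on linear_conv_bounded_linear)
    then have "closed (\<Inter>i. {b. 0 \<le> l i b})"
      by (intro closed_INT ballI closed_Collect_le) auto
    also have "(\<Inter>i. {b. 0 \<le> l i b}) = base_cone l" by (auto simp: base_cone_def)
    finally show ?thesis by (rule borel_closed)
  qed
  moreover have js5: "distinct [1,2,3,4,5::5]" "set [1,2,3,4,5::5] = UNIV"
    unfolding UNIV_5 by simp_all
  ultimately have "emeasure lborel (base_coords u k x)
      = cone_vol (base_cone l) (map (\<lambda>j. knot_coords ! \<iota> j) [1,2,3,4,5]) (bary3 v x)"
    using emeasure_lborel_cone_vol[OF _ js5, of "base_cone l" "bary3 v x" "\<lambda>j. knot_coords ! \<iota> j"]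
    by simp
  then have "measure lborel (base_coords u k x)
      = enn2real (cone_vol (base_cone l) (map (\<lambda>j. knot_coords ! \<iota> j) [1,2,3,4,5]) (bary3 v x))"
    by (simp only: measure_def)
  also have "map (\<lambda>j. knot_coords ! \<iota> j) [1,2,3,4,5] = map ((!) knot_coords) js"
    unfolding js' by simp
  finally have "measure lborel (base_coords u k x)
      = enn2real (cone_vol (base_cone l) (map ((!) knot_coords) js) (bary3 v x))" .
  moreover have "tri_det u \<noteq> 0" using nu tri_det_nonzero_iff by blast
  ultimately show ?thesis
    unfolding simplex_spline_eq[OF nc nu K] det by simp
qed

lemma simplex_spline_corner:
  assumes nc: "\<not> collinear {v 1, v 2, v 3}"
    and js: "length js = 5" "\<forall>i\<in>set js. i < 6"
    and m: "length m = 6" "mset (concat (map2 replicate m [0..<6])) = mset ([0, 3, 5] @ js)"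
  shows "simplex_spline v m x = 480 * enn2real (cone_vol {(b1,b2,b3). b2 + b3 \<le> b1 \<and> 0 \<le> b2 \<and> 0 \<le> b3}
     (map ((!) knot_coords) js) (bary3 v x))"
proof -
  define l :: "3 \<Rightarrow> real \<times> real \<times> real \<Rightarrow> real" where
    "l = (\<lambda>i (b1,b2,b3). if i = 1 then b1 - b2 - b3 else if i = 2 then 2 * b2 else 2 * b3)"
  define u :: "3 \<Rightarrow> real^2" where
    "u = (\<lambda>i. if i = 1 then v 1 else if i = 2 then midpoint (v 1) (v 2) else midpoint (v 1) (v 3))"
  have u: "u 1 = v 1" "u 2 = midpoint (v 1) (v 2)" "u 3 = midpoint (v 1) (v 3)" by (simp_all add: u_def)
  have det: "tri_det v = 4 * tri_det u"
    by (simp add: tri_det_def u midpoint_def field_simps)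
  then have nu: "\<not> collinear {u 1, u 2, u 3}" using nc tri_det_nonzero_iff by (metis mult_zero_right)
  have "base_cone l = {(b1,b2,b3). b2 + b3 \<le> b1 \<and> 0 \<le> b2 \<and> 0 \<le> b3}"
    by (auto simp: base_cone_def l_def forall_3)
  moreover have "simplex_spline v m x = 480 * enn2real (cone_vol (base_cone l) (map ((!) knot_coords) js) (bary3 v x))"
  proof (rule simplex_spline_cone_vol[OF nc nu _ _ _ _ _ _ js m])
    show "linear (l i)" for i by (rule linearI) (auto simp: l_def algebra_simps)
    have s: "barycentric v x 1 = 1 - barycentric v x 2 - barycentric v x 3" for x
      using bary_sum[OF nc, of x] by linarith
    have "barycentric u x = (\<lambda>i. l i (bary3 v x))" for x
    proof (rule bary_unique[OF nu])
      show "l 1 (bary3 v x) *\<^sub>R u 1 + l 2 (bary3 v x) *\<^sub>R u 2 + l 3 (bary3 v x) *\<^sub>R u 3 = x"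
      proof -
        have "l 1 (bary3 v x) *\<^sub>R u 1 + l 2 (bary3 v x) *\<^sub>R u 2 + l 3 (bary3 v x) *\<^sub>R u 3
          = barycentric v x 1 *\<^sub>R v 1 + barycentric v x 2 *\<^sub>R v 2 + barycentric v x 3 *\<^sub>R v 3"
          by (simp add: vec2_eq_iff l_def bary3_def u midpoint_def field_simps)
        then show ?thesis using bary_comb[OF nc, of x] by simp
      qed
      show "l 1 (bary3 v x) + l 2 (bary3 v x) + l 3 (bary3 v x) = 1"
        unfolding l_def bary3_def using s[of x] by simp
    qed
    then show "barycentric u x i = l i (bary3 v x)" for x i by simp
  qed (simp_all add: u ps_points_def det)
  ultimately show ?thesis by simp
qed

lemma simplex_spline_medial:
  assumes nc: "\<not> collinear {v 1, v 2, v 3}"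
    and js: "length js = 5" "\<forall>i\<in>set js. i < 6"
    and m: "length m = 6" "mset (concat (map2 replicate m [0..<6])) = mset ([3, 4, 5] @ js)"
  shows "simplex_spline v m x = 480 * enn2real (cone_vol {(b1,b2,b3). b1 \<le> b2 + b3 \<and> b2 \<le> b1 + b3 \<and> b3 \<le> b1 + b2}
     (map ((!) knot_coords) js) (bary3 v x))"
proof -
  define l :: "3 \<Rightarrow> real \<times> real \<times> real \<Rightarrow> real" where
    "l = (\<lambda>i (b1,b2,b3). if i = 1 then b1 + b2 - b3 else if i = 2 then b2 + b3 - b1 else b1 + b3 - b2)"
  define u :: "3 \<Rightarrow> real^2" where
    "u = (\<lambda>i. if i = 1 then midpoint (v 1) (v 2) else if i = 2 then midpoint (v 2) (v 3) else midpoint (v 1) (v 3))"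
  have u: "u 1 = midpoint (v 1) (v 2)" "u 2 = midpoint (v 2) (v 3)" "u 3 = midpoint (v 1) (v 3)" by (simp_all add: u_def)
  have det: "tri_det v = 4 * tri_det u"
    by (simp add: tri_det_def u midpoint_def field_simps)
  then have nu: "\<not> collinear {u 1, u 2, u 3}" using nc tri_det_nonzero_iff by (metis mult_zero_right)
  have "base_cone l = {(b1,b2,b3). b1 \<le> b2 + b3 \<and> b2 \<le> b1 + b3 \<and> b3 \<le> b1 + b2}"
    by (auto simp: base_cone_def l_def forall_3)
  moreover have "simplex_spline v m x = 480 * enn2real (cone_vol (base_cone l) (map ((!) knot_coords) js) (bary3 v x))"
  proof (rule simplex_spline_cone_vol[OF nc nu _ _ _ _ _ _ js m])
    show "linear (l i)" for i by (rule linearI) (auto simp: l_def algebra_simps)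
    have s: "barycentric v x 1 = 1 - barycentric v x 2 - barycentric v x 3" for x
      using bary_sum[OF nc, of x] by linarith
    have "barycentric u x = (\<lambda>i. l i (bary3 v x))" for x
    proof (rule bary_unique[OF nu])
      show "l 1 (bary3 v x) *\<^sub>R u 1 + l 2 (bary3 v x) *\<^sub>R u 2 + l 3 (bary3 v x) *\<^sub>R u 3 = x"
      proof -
        have "l 1 (bary3 v x) *\<^sub>R u 1 + l 2 (bary3 v x) *\<^sub>R u 2 + l 3 (bary3 v x) *\<^sub>R u 3
          = barycentric v x 1 *\<^sub>R v 1 + barycentric v x 2 *\<^sub>R v 2 + barycentric v x 3 *\<^sub>R v 3"
          by (simp add: vec2_eq_iff l_def bary3_def u midpoint_def field_simps)
        then show ?thesis using bary_comb[OF nc, of x] by simp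
      qed
      show "l 1 (bary3 v x) + l 2 (bary3 v x) + l 3 (bary3 v x) = 1"
        unfolding l_def bary3_def using s[of x] by simp
    qed
    then show "barycentric u x i = l i (bary3 v x)" for x i by simp
  qed (simp_all add: u ps_points_def det)
  ultimately show ?thesis by simp
qed

section \<open>Truncated powers and their cone integrals\<close>

text \<open>The value at 0 is chosen such that \<open>x ^ 0 * unit_step x\<close> vanishes for \<open>x \<le> 0\<close>; the truncated power of
exponent 0 is only used up to finitely many points.\<close>

definition unit_step :: "real \<Rightarrow> real" where
  "unit_step x = (if 0 < x then 1 else 0)"

lemma unit_step_pos [simp]: "0 < x \<Longrightarrow> unit_step x = 1"
  and unit_step_nonpos [simp]: "x \<le> 0 \<Longrightarrow> unit_step x = 0"
  by (simp_all add: unit_step_def)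

definition tpow :: "nat \<Rightarrow> real \<Rightarrow> real" where
  "tpow k x = x ^ k * unit_step x"

lemma tpow_pos: "0 < x \<Longrightarrow> tpow k x = x ^ k"
  and tpow_nonpos: "x \<le> 0 \<Longrightarrow> tpow k x = 0"
  by (simp_all add: tpow_def)

lemma has_real_derivative_tpow_nonzero:
  assumes "x \<noteq> 0"
  shows "(tpow (Suc k) has_real_derivative (real (Suc k) * tpow k x)) (at x)"
proof (cases "0 < x")
  case True
  have "((\<lambda>x. x ^ Suc k) has_real_derivative (real (Suc k) * x ^ k)) (at x)"
    by (rule derivative_eq_intros refl | simp)+
  then have "(tpow (Suc k) has_real_derivative (real (Suc k) * x ^ k)) (at x)"
    by (rule has_field_derivative_transform_within_open[of _ _ _ "{0<..}"]) (use True in \<open>auto simp: tpow_pos\<close>)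
  then show ?thesis using True by (simp add: tpow_pos)
next
  case False
  have "((\<lambda>x. 0) has_real_derivative 0) (at x)" by simp
  then have "(tpow (Suc k) has_real_derivative 0) (at x)"
    by (rule has_field_derivative_transform_within_open[of _ _ _ "{..<0}"]) (use False assms in \<open>auto simp: tpow_nonpos\<close>)
  then show ?thesis using False by (simp add: tpow_nonpos)
qed

lemma has_real_derivative_tpow_ge2:
  "(tpow (Suc (Suc k)) has_real_derivative (real (Suc (Suc k)) * tpow (Suc k) x)) (at x)"
proof (cases "x = 0")
  case True
  have "((\<lambda>h. tpow (Suc (Suc k)) h / h) \<longlongrightarrow> 0) (at 0)"
  proof (rule Lim_null_comparison)
    have "norm (tpow (Suc (Suc k)) h / h) \<le> \<bar>h\<bar> ^ Suc k" for h
      by (cases "h = 0") (auto simp: tpow_def unit_step_def abs_mult power_abs)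
    then show "\<forall>\<^sub>F h in at 0. norm (tpow (Suc (Suc k)) h / h) \<le> \<bar>h\<bar> ^ Suc k" by simp
    have "((\<lambda>h::real. \<bar>h\<bar> ^ Suc k) \<longlongrightarrow> \<bar>0\<bar> ^ Suc k) (at 0)" by (intro tendsto_intros)
    then show "((\<lambda>h::real. \<bar>h\<bar> ^ Suc k) \<longlongrightarrow> 0) (at 0)" by simp
  qed
  then show ?thesis using True by (simp add: DERIV_def tpow_nonpos)
qed (rule has_real_derivative_tpow_nonzero)

lemma DERIV_tpow_ge2:
  assumes "(f has_real_derivative D) (at x)"
  shows "((\<lambda>x. tpow (Suc (Suc k)) (f x)) has_real_derivative real (Suc (Suc k)) * tpow (Suc k) (f x) * D) (at x)"
  using DERIV_chain2[OF has_real_derivative_tpow_ge2 assms] .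

lemma DERIV_tpow_1:
  assumes "(f has_real_derivative D) (at x)" "f x \<noteq> 0"
  shows "((\<lambda>x. tpow 1 (f x)) has_real_derivative tpow 0 (f x) * D) (at x)"
  using DERIV_chain2[OF has_real_derivative_tpow_nonzero assms(1), of 0] assms(2) by simp

lemma DERIV_tpow:
  assumes "(f has_real_derivative D) (at x)"
  shows "((\<lambda>x. tpow 2 (f x)) has_real_derivative 2 * tpow 1 (f x) * D) (at x)"
    "((\<lambda>x. tpow 3 (f x)) has_real_derivative 3 * tpow 2 (f x) * D) (at x)"
    "((\<lambda>x. tpow 4 (f x)) has_real_derivative 4 * tpow 3 (f x) * D) (at x)"
    "((\<lambda>x. tpow 5 (f x)) has_real_derivative 5 * tpow 4 (f x) * D) (at x)"
  using DERIV_tpow_ge2[OF assms, of 0] DERIV_tpow_ge2[OF assms, of 1] DERIV_tpow_ge2[OF assms, of 2]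
    DERIV_tpow_ge2[OF assms, of 3]
  by (simp_all add: eval_nat_numeral)

lemma continuous_on_tpow:
  assumes "continuous_on S f" "0 < k"
  shows "continuous_on S (\<lambda>x. tpow k (f x))"
proof -
  have "tpow k x = max 0 x ^ k" for x using assms(2) by (auto simp: tpow_def unit_step_def max_def)
  then show ?thesis using assms(1) by (auto intro!: continuous_intros)
qed

text \<open>Both cones and all knots lie in the closed positive octant, so the volume vanishes off the octant and
the closed form \<open>F\<close> is only claimed on it.\<close>

definition cone_density ::
  "(real \<times> real \<times> real) set \<Rightarrow> (real \<times> real \<times> real) list \<Rightarrow> (real \<Rightarrow> real \<Rightarrow> real \<Rightarrow> real) \<Rightarrow> bool" where
  "cone_density C K F \<longleftrightarrow> C \<in> sets borel \<and>
     (\<forall>b1 b2 b3. cone_vol C K (b1, b2, b3) = (if 0 \<le> b1 \<and> 0 \<le> b2 \<and> 0 \<le> b3 then ennreal (F b1 b2 b3) else 0)) \<and>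
     (\<forall>b1 b2 b3. 0 \<le> b1 \<longrightarrow> 0 \<le> b2 \<longrightarrow> 0 \<le> b3 \<longrightarrow> 0 \<le> F b1 b2 b3)"

text \<open>Fundamental theorem of calculus along the ray \<open>b - s k\<close>, which leaves the positive octant at \<open>s = \<tau>\<close>:
if the candidate \<open>G\<close> has derivative \<open>- F\<close> along the ray and vanishes at its end, then \<open>G b\<close> is the
integral. Finitely many points \<open>S\<close> are exempt since indicator functions and truncated powers of exponent 0 jump.\<close>

lemma cone_density_step:
  assumes d: "cone_density C K F"
    and k: "0 \<le> k1" "0 \<le> k2" "0 \<le> k3"
    and step: "\<And>b1 b2 b3. 0 \<le> b1 \<Longrightarrow> 0 \<le> b2 \<Longrightarrow> 0 \<le> b3 \<Longrightarrow> \<exists>\<tau> S. 0 \<le> \<tau> \<and> finite S \<and>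
        (\<forall>s\<ge>0. (0 \<le> b1 - s * k1 \<and> 0 \<le> b2 - s * k2 \<and> 0 \<le> b3 - s * k3) \<longleftrightarrow> s \<le> \<tau>) \<and>
        G (b1 - \<tau> * k1) (b2 - \<tau> * k2) (b3 - \<tau> * k3) = 0 \<and>
        continuous_on {0..\<tau>} (\<lambda>s. G (b1 - s * k1) (b2 - s * k2) (b3 - s * k3)) \<and>
        (\<forall>s\<in>{0<..<\<tau>} - S. ((\<lambda>s. G (b1 - s * k1) (b2 - s * k2) (b3 - s * k3))
           has_real_derivative - F (b1 - s * k1) (b2 - s * k2) (b3 - s * k3)) (at s))"
  shows "cone_density C ((k1, k2, k3) # K) G"
proof -
  have C: "C \<in> sets borel" and cv: "\<And>b1 b2 b3. cone_vol C K (b1, b2, b3)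
      = (if 0 \<le> b1 \<and> 0 \<le> b2 \<and> 0 \<le> b3 then ennreal (F b1 b2 b3) else 0)"
    and F0: "\<And>b1 b2 b3. 0 \<le> b1 \<Longrightarrow> 0 \<le> b2 \<Longrightarrow> 0 \<le> b3 \<Longrightarrow> 0 \<le> F b1 b2 b3"
    using d by (auto simp: cone_density_def)
  note [measurable] = cone_vol_measurable[OF C]
  have main: "cone_vol C ((k1, k2, k3) # K) (b1, b2, b3) = ennreal (G b1 b2 b3) \<and> 0 \<le> G b1 b2 b3"
    if b: "0 \<le> b1" "0 \<le> b2" "0 \<le> b3" for b1 b2 b3
  proof -
    obtain \<tau> S where \<tau>: "0 \<le> \<tau>" "finite S"
      and dom: "\<And>s. 0 \<le> s \<Longrightarrow> (0 \<le> b1 - s * k1 \<and> 0 \<le> b2 - s * k2 \<and> 0 \<le> b3 - s * k3) \<longleftrightarrow> s \<le> \<tau>"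
      and end0: "G (b1 - \<tau> * k1) (b2 - \<tau> * k2) (b3 - \<tau> * k3) = 0"
      and cont: "continuous_on {0..\<tau>} (\<lambda>s. G (b1 - s * k1) (b2 - s * k2) (b3 - s * k3))"
      and der: "\<And>s. s \<in> {0<..<\<tau>} - S \<Longrightarrow> ((\<lambda>s. G (b1 - s * k1) (b2 - s * k2) (b3 - s * k3))
           has_real_derivative - F (b1 - s * k1) (b2 - s * k2) (b3 - s * k3)) (at s)"
      using step[OF b] by blast
    define f where "f = (\<lambda>s. F (b1 - s * k1) (b2 - s * k2) (b3 - s * k3))"
    have "((\<lambda>s. - f s) has_integral G (b1 - \<tau> * k1) (b2 - \<tau> * k2) (b3 - \<tau> * k3) - G (b1 - 0 * k1) (b2 - 0 * k2) (b3 - 0 * k3)) {0..\<tau>}"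
    proof (rule fundamental_theorem_of_calculus_interior_strong[OF \<tau>(2,1) _ cont])
      show "((\<lambda>s. G (b1 - s * k1) (b2 - s * k2) (b3 - s * k3)) has_vector_derivative - f s) (at s)"
        if "s \<in> {0<..<\<tau>} - S" for s
        using der[OF that] unfolding has_real_derivative_iff_has_vector_derivative f_def .
    qed
    from has_integral_neg[OF this] have int: "(f has_integral G b1 b2 b3) {0..\<tau>}"
      unfolding end0 by simp
    define g where "g = (\<lambda>s. enn2real (indicator {0..} s * cone_vol C K ((b1, b2, b3) - s *\<^sub>R (k1, k2, k3))))"
    have g: "g s = (if s \<in> {0..\<tau>} then f s else 0)" for s
    proof (cases "0 \<le> s")
      case True
      then show ?thesis using dom[OF True] F0[of "b1 - s * k1" "b2 - s * k2" "b3 - s * k3"]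
        by (auto simp: g_def cv f_def)
    qed (simp add: g_def)
    have "(g has_integral G b1 b2 b3) UNIV"
    proof -
      have "g = (\<lambda>s. if s \<in> {0..\<tau>} then f s else 0)" using g by (rule ext)
      then show ?thesis using int has_integral_restrict_UNIV[of "{0..\<tau>}" f] by (simp only:)
    qed
    moreover have gm: "g \<in> borel_measurable borel" unfolding g_def by measurable
    moreover have g0: "0 \<le> g s" for s by (simp add: g_def)
    ultimately have "integral\<^sup>N lborel g = G b1 b2 b3"
      using nn_integral_has_integral_lborel by blast
    moreover have "indicator {0..} s * cone_vol C K ((b1, b2, b3) - s *\<^sub>R (k1, k2, k3)) = ennreal (g s)" for s
      by (auto simp: g_def cv indicator_def)
    moreover have "0 \<le> G b1 b2 b3"
    proof (rule has_integral_nonneg[OF int])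
      show "0 \<le> f s" if "s \<in> {0..\<tau>}" for s using that dom[of s] F0 by (auto simp: f_def)
    qed
    ultimately show ?thesis by simp
  qed
  have "cone_vol C ((k1, k2, k3) # K) (b1, b2, b3) = 0" if "\<not> (0 \<le> b1 \<and> 0 \<le> b2 \<and> 0 \<le> b3)" for b1 b2 b3
  proof -
    have "indicator {0..} s * cone_vol C K ((b1, b2, b3) - s *\<^sub>R (k1, k2, k3)) = 0" for s
    proof (cases "0 \<le> s")
      case True
      then have "0 \<le> s * k1" "0 \<le> s * k2" "0 \<le> s * k3" using k by auto
      then show ?thesis using that by (auto simp: cv)
    qed simp
    then show ?thesis by (simp only: cone_vol.simps nn_integral_const mult_zero_left)
  qed
  with main C show ?thesis by (auto simp: cone_density_def simp del: cone_vol.simps)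
qed

lemma DERIV_reflect:
  assumes "(g has_real_derivative D) (at (b - s))"
  shows "((\<lambda>s. g (b - s)) has_real_derivative - D) (at s)"
proof -
  have "((\<lambda>s. b - s) has_real_derivative -1) (at s)"
    by (auto intro!: derivative_eq_intros)
  from DERIV_chain2[where f = g and g = "\<lambda>s. b - s", OF assms this] show ?thesis by simp
qed

lemma cone_density_axis1:
  assumes d: "cone_density C K F"
    and cont: "\<And>b2 b3. 0 \<le> b2 \<Longrightarrow> 0 \<le> b3 \<Longrightarrow> continuous_on UNIV (\<lambda>u. G u b2 b3)"
    and zero: "\<And>b2 b3. 0 \<le> b2 \<Longrightarrow> 0 \<le> b3 \<Longrightarrow> G 0 b2 b3 = 0"
    and der: "\<And>u b2 b3. 0 < u \<Longrightarrow> 0 \<le> b2 \<Longrightarrow> 0 \<le> b3 \<Longrightarrow> u \<notin> {b2 + b3, b2 - b3, b3 - b2}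
        \<Longrightarrow> ((\<lambda>u. G u b2 b3) has_real_derivative F u b2 b3) (at u)"
  shows "cone_density C ((1, 0, 0) # K) G"
proof (rule cone_density_step[OF d])
  fix b1 b2 b3 :: real assume b: "0 \<le> b1" "0 \<le> b2" "0 \<le> b3"
  have "continuous_on {0..b1} (\<lambda>s. G (b1 - s) b2 b3)"
    by (rule continuous_on_compose2[OF cont[OF b(2,3)]]) (auto intro!: continuous_intros)
  moreover have "((\<lambda>s. G (b1 - s) b2 b3) has_real_derivative - F (b1 - s) b2 b3) (at s)"
    if "s \<in> {0<..<b1} - (\<lambda>u. b1 - u) ` {b2 + b3, b2 - b3, b3 - b2}" for s
  proof (rule DERIV_reflect[where g = "\<lambda>u. G u b2 b3"], rule der)
    have "b1 - s \<in> {b2 + b3, b2 - b3, b3 - b2} \<Longrightarrow> s \<in> (\<lambda>u. b1 - u) ` {b2 + b3, b2 - b3, b3 - b2}"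
      by (rule image_eqI[of _ _ "b1 - s"]) auto
    then show "b1 - s \<notin> {b2 + b3, b2 - b3, b3 - b2}" using that by blast
  qed (use that b in auto)
  ultimately show "\<exists>\<tau> S. 0 \<le> \<tau> \<and> finite S \<and>
        (\<forall>s\<ge>0. (0 \<le> b1 - s * 1 \<and> 0 \<le> b2 - s * 0 \<and> 0 \<le> b3 - s * 0) \<longleftrightarrow> s \<le> \<tau>) \<and>
        G (b1 - \<tau> * 1) (b2 - \<tau> * 0) (b3 - \<tau> * 0) = 0 \<and>
        continuous_on {0..\<tau>} (\<lambda>s. G (b1 - s * 1) (b2 - s * 0) (b3 - s * 0)) \<and>
        (\<forall>s\<in>{0<..<\<tau>} - S. ((\<lambda>s. G (b1 - s * 1) (b2 - s * 0) (b3 - s * 0))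
           has_real_derivative - F (b1 - s * 1) (b2 - s * 0) (b3 - s * 0)) (at s))"
    using b zero
    by (intro exI[of _ b1] exI[of _ "(\<lambda>u. b1 - u) ` {b2 + b3, b2 - b3, b3 - b2}"]) auto
qed auto

lemma cone_density_axis2:
  assumes d: "cone_density C K F"
    and cont: "\<And>b1 b3. 0 \<le> b1 \<Longrightarrow> 0 \<le> b3 \<Longrightarrow> continuous_on UNIV (\<lambda>u. G b1 u b3)"
    and zero: "\<And>b1 b3. 0 \<le> b1 \<Longrightarrow> 0 \<le> b3 \<Longrightarrow> G b1 0 b3 = 0"
    and der: "\<And>u b1 b3. 0 < u \<Longrightarrow> 0 \<le> b1 \<Longrightarrow> 0 \<le> b3
        \<Longrightarrow> ((\<lambda>u. G b1 u b3) has_real_derivative F b1 u b3) (at u)"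
  shows "cone_density C ((0, 1, 0) # K) G"
proof (rule cone_density_step[OF d])
  fix b1 b2 b3 :: real assume b: "0 \<le> b1" "0 \<le> b2" "0 \<le> b3"
  have "continuous_on {0..b2} (\<lambda>s. G b1 (b2 - s) b3)"
    by (rule continuous_on_compose2[OF cont[OF b(1,3)]]) (auto intro!: continuous_intros)
  moreover have "((\<lambda>s. G b1 (b2 - s) b3) has_real_derivative - F b1 (b2 - s) b3) (at s)"
    if "s \<in> {0<..<b2}" for s
    by (rule DERIV_reflect[where g = "\<lambda>u. G b1 u b3"], rule der) (use that b in auto)
  ultimately show "\<exists>\<tau> S. 0 \<le> \<tau> \<and> finite S \<and>
        (\<forall>s\<ge>0. (0 \<le> b1 - s * 0 \<and> 0 \<le> b2 - s * 1 \<and> 0 \<le> b3 - s * 0) \<longleftrightarrow> s \<le> \<tau>) \<and>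
        G (b1 - \<tau> * 0) (b2 - \<tau> * 1) (b3 - \<tau> * 0) = 0 \<and>
        continuous_on {0..\<tau>} (\<lambda>s. G (b1 - s * 0) (b2 - s * 1) (b3 - s * 0)) \<and>
        (\<forall>s\<in>{0<..<\<tau>} - S. ((\<lambda>s. G (b1 - s * 0) (b2 - s * 1) (b3 - s * 0))
           has_real_derivative - F (b1 - s * 0) (b2 - s * 1) (b3 - s * 0)) (at s))"
    using b zero by (intro exI[of _ b2] exI[of _ "{}"]) auto
qed auto

lemma cone_density_axis3:
  assumes d: "cone_density C K F"
    and cont: "\<And>b1 b2. 0 \<le> b1 \<Longrightarrow> 0 \<le> b2 \<Longrightarrow> continuous_on UNIV (\<lambda>u. G b1 b2 u)"
    and zero: "\<And>b1 b2. 0 \<le> b1 \<Longrightarrow> 0 \<le> b2 \<Longrightarrow> G b1 b2 0 = 0"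
    and der: "\<And>u b1 b2. 0 < u \<Longrightarrow> 0 \<le> b1 \<Longrightarrow> 0 \<le> b2
        \<Longrightarrow> ((\<lambda>u. G b1 b2 u) has_real_derivative F b1 b2 u) (at u)"
  shows "cone_density C ((0, 0, 1) # K) G"
proof (rule cone_density_step[OF d])
  fix b1 b2 b3 :: real assume b: "0 \<le> b1" "0 \<le> b2" "0 \<le> b3"
  have "continuous_on {0..b3} (\<lambda>s. G b1 b2 (b3 - s))"
    by (rule continuous_on_compose2[OF cont[OF b(1,2)]]) (auto intro!: continuous_intros)
  moreover have "((\<lambda>s. G b1 b2 (b3 - s)) has_real_derivative - F b1 b2 (b3 - s)) (at s)"
    if "s \<in> {0<..<b3}" for s
    by (rule DERIV_reflect[where g = "\<lambda>u. G b1 b2 u"], rule der) (use that b in auto)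
  ultimately show "\<exists>\<tau> S. 0 \<le> \<tau> \<and> finite S \<and>
        (\<forall>s\<ge>0. (0 \<le> b1 - s * 0 \<and> 0 \<le> b2 - s * 0 \<and> 0 \<le> b3 - s * 1) \<longleftrightarrow> s \<le> \<tau>) \<and>
        G (b1 - \<tau> * 0) (b2 - \<tau> * 0) (b3 - \<tau> * 1) = 0 \<and>
        continuous_on {0..\<tau>} (\<lambda>s. G (b1 - s * 0) (b2 - s * 0) (b3 - s * 1)) \<and>
        (\<forall>s\<in>{0<..<\<tau>} - S. ((\<lambda>s. G (b1 - s * 0) (b2 - s * 0) (b3 - s * 1))
           has_real_derivative - F (b1 - s * 0) (b2 - s * 0) (b3 - s * 1)) (at s))"
    using b zero by (intro exI[of _ b3] exI[of _ "{}"]) auto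
qed auto

declare DERIV_tpow [THEN DERIV_cong, derivative_intros]
declare DERIV_tpow_1 [THEN DERIV_cong, derivative_intros]

lemma tpow_nonneg: "0 \<le> x \<Longrightarrow> 0 < k \<Longrightarrow> tpow k x = x ^ k"
  by (cases "x = 0") (auto simp: tpow_def)

lemma tpow_Suc: "tpow (Suc k) x = x * tpow k x"
  by (simp add: tpow_def)

lemma tpow_unfold:
  "tpow 5 x = x * tpow 4 x" "tpow 4 x = x * tpow 3 x" "tpow 3 x = x * tpow 2 x" "tpow 2 x = x * tpow 1 x"
  "tpow 1 x = x * tpow 0 x"
  using tpow_Suc[of 4 x] tpow_Suc[of 3 x] tpow_Suc[of 2 x] tpow_Suc[of 1 x] tpow_Suc[of 0 x]
  by (simp_all add: eval_nat_numeral)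

lemma power5_eq: "x ^ 5 = x * x * x * x * (x::real)"
  by (simp add: eval_nat_numeral)

definition corner_cone :: "(real \<times> real \<times> real) set" where
  "corner_cone = {(b1, b2, b3). b2 + b3 \<le> b1 \<and> 0 \<le> b2 \<and> 0 \<le> b3}"

definition medial_cone :: "(real \<times> real \<times> real) set" where
  "medial_cone = {(b1, b2, b3). b1 \<le> b2 + b3 \<and> b2 \<le> b1 + b3 \<and> b3 \<le> b1 + b2}"

lemma cones_borel: "corner_cone \<in> sets borel" "medial_cone \<in> sets borel"
proof -
  have "closed corner_cone" "closed medial_cone"
    unfolding corner_cone_def medial_cone_def case_prod_beta
    by (intro closed_Collect_conj closed_Collect_le continuous_intros)+
  then show "corner_cone \<in> sets borel" "medial_cone \<in> sets borel" by (simp_all add: borel_closed)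
qed

lemma corner_density_Nil: "cone_density corner_cone [] (\<lambda>b1 b2 b3. if b2 + b3 \<le> b1 then 1 else 0)"
  using cones_borel by (auto simp: cone_density_def corner_cone_def indicator_def)

lemma medial_density_Nil: "cone_density medial_cone [] (\<lambda>b1 b2 b3. if b1 \<le> b2 + b3 \<and> b2 \<le> b1 + b3 \<and> b3 \<le> b1 + b2 then 1 else 0)"
  using cones_borel by (auto simp: cone_density_def medial_cone_def indicator_def)

text \<open>The condition \<open>b2 + b3 \<le> b1\<close> is invariant in the direction of \<open>v\<^sub>4\<close>, so the integral is the length of the part
of the ray inside the octant.\<close>

lemma corner_density_v4:
  "cone_density corner_cone [(1/2, 1/2, 0)] (\<lambda>b1 b2 b3. if b2 + b3 \<le> b1 then 2 * b2 else 0)"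
proof (rule cone_density_step[OF corner_density_Nil])
  fix b1 b2 b3 :: real assume b: "0 \<le> b1" "0 \<le> b2" "0 \<le> b3"
  let ?G = "\<lambda>s. if b2 - s * (1/2) + (b3 - s * 0) \<le> b1 - s * (1/2) then 2 * (b2 - s * (1/2)) else 0"
  let ?F = "\<lambda>s. if b2 - s * (1/2) + (b3 - s * 0) \<le> b1 - s * (1/2) then 1 else 0 :: real"
  have G: "?G = (\<lambda>s. if b2 + b3 \<le> b1 then 2 * b2 - s else 0)" by (auto simp: fun_eq_iff)
  have F: "?F s = (if b2 + b3 \<le> b1 then 1 else 0)" for s by auto
  have "continuous_on {0..2 * min b1 b2} ?G"
    unfolding G by (cases "b2 + b3 \<le> b1") (auto intro!: continuous_intros)
  moreover have "(?G has_real_derivative - ?F s) (at s)" for s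
    unfolding G unfolding F by (cases "b2 + b3 \<le> b1") (auto intro!: derivative_eq_intros)
  moreover have "?G (2 * min b1 b2) = 0" using b by (auto simp: min_def)
  moreover have "(0 \<le> b1 - s * (1/2) \<and> 0 \<le> b2 - s * (1/2) \<and> 0 \<le> b3 - s * 0) \<longleftrightarrow> s \<le> 2 * min b1 b2" for s
    using b by (auto simp: min_def)
  ultimately show "\<exists>\<tau> S. 0 \<le> \<tau> \<and> finite S \<and>
        (\<forall>s\<ge>0. (0 \<le> b1 - s * (1/2) \<and> 0 \<le> b2 - s * (1/2) \<and> 0 \<le> b3 - s * 0) \<longleftrightarrow> s \<le> \<tau>) \<and>
        ?G \<tau> = 0 \<and> continuous_on {0..\<tau>} ?G \<and>
        (\<forall>s\<in>{0<..<\<tau>} - S. (?G has_real_derivative - ?F s) (at s))"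
    using b by (intro exI[of _ "2 * min b1 b2"] exI[of _ "{}"] conjI) auto
qed auto

lemma medial_density_v4:
  "cone_density medial_cone [(1/2, 1/2, 0)] (\<lambda>b1 b2 b3. if b1 \<le> b2 + b3 \<and> b2 \<le> b1 + b3 \<and> b3 \<le> b1 + b2 then b1 + b2 - b3 else 0)"
proof (rule cone_density_step[OF medial_density_Nil])
  fix b1 b2 b3 :: real assume b: "0 \<le> b1" "0 \<le> b2" "0 \<le> b3"
  let ?P = "\<lambda>s. b1 - s * (1/2) \<le> b2 - s * (1/2) + (b3 - s * 0) \<and> b2 - s * (1/2) \<le> b1 - s * (1/2) + (b3 - s * 0)
     \<and> b3 - s * 0 \<le> b1 - s * (1/2) + (b2 - s * (1/2))"
  let ?G = "\<lambda>s. if ?P s then b1 - s * (1/2) + (b2 - s * (1/2)) - (b3 - s * 0) else 0"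
  let ?F = "\<lambda>s. if ?P s then 1 else 0 :: real"
  define Q where "Q \<longleftrightarrow> b1 \<le> b2 + b3 \<and> b2 \<le> b1 + b3"
  have G: "?G = (\<lambda>s. if Q then max 0 (b1 + b2 - b3 - s) else 0)" by (auto simp: fun_eq_iff Q_def max_def field_simps)
  have F: "?F s = (if Q \<and> s \<le> b1 + b2 - b3 then 1 else 0)" for s by (auto simp: Q_def field_simps)
  have "continuous_on {0..2 * min b1 b2} ?G"
    unfolding G by (cases Q) (auto intro!: continuous_intros)
  moreover have "(?G has_real_derivative - ?F s) (at s)" if s: "s \<noteq> b1 + b2 - b3" for s
  proof (cases "Q \<and> s < b1 + b2 - b3")
    case True
    have "((\<lambda>s. b1 + b2 - b3 - s) has_real_derivative -1) (at s)" by (auto intro!: derivative_eq_intros)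
    then have D: "((\<lambda>s. if Q then max 0 (b1 + b2 - b3 - s) else 0) has_real_derivative -1) (at s)"
      by (rule has_field_derivative_transform_within_open[of _ _ _ "{..<b1 + b2 - b3}"]) (use True in auto)
    have F1: "?F s = 1" unfolding F using True by simp
    show ?thesis unfolding F1 unfolding G by (rule D)
  next
    case False
    have "((\<lambda>s. 0) has_real_derivative 0) (at s)" by simp
    then have D: "((\<lambda>s. if Q then max 0 (b1 + b2 - b3 - s) else 0) has_real_derivative 0) (at s)"
      by (rule has_field_derivative_transform_within_open[of _ _ _ "if Q then {b1 + b2 - b3<..} else UNIV"]) (use False s in auto)
    have F0: "?F s = 0" unfolding F using False s by auto
    show ?thesis unfolding F0 unfolding G minus_zero by (rule D)
  qed
  moreover have "?G (2 * min b1 b2) = 0" unfolding G using b by (auto simp: min_def Q_def)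
  moreover have "(0 \<le> b1 - s * (1/2) \<and> 0 \<le> b2 - s * (1/2) \<and> 0 \<le> b3 - s * 0) \<longleftrightarrow> s \<le> 2 * min b1 b2" for s
    using b by (auto simp: min_def)
  ultimately show "\<exists>\<tau> S. 0 \<le> \<tau> \<and> finite S \<and>
        (\<forall>s\<ge>0. (0 \<le> b1 - s * (1/2) \<and> 0 \<le> b2 - s * (1/2) \<and> 0 \<le> b3 - s * 0) \<longleftrightarrow> s \<le> \<tau>) \<and>
        ?G \<tau> = 0 \<and> continuous_on {0..\<tau>} ?G \<and>
        (\<forall>s\<in>{0<..<\<tau>} - S. (?G has_real_derivative - ?F s) (at s))"
    using b by (intro exI[of _ "2 * min b1 b2"] exI[of _ "{b1 + b2 - b3}"] conjI) auto
qed auto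

text \<open>Since \<open>q\<close> does not involve \<open>b1\<close>, integrating repeatedly along the first axis raises the exponent of the truncated
power and divides by it.\<close>

lemma corner_density_v1:
  assumes d: "cone_density C K (\<lambda>b1 b2 b3. if b2 + b3 \<le> b1 then q b2 b3 else 0)"
  shows "cone_density C (replicate (Suc n) (1,0,0) @ K) (\<lambda>b1 b2 b3. q b2 b3 * tpow (Suc n) (b1 - b2 - b3) / fact (Suc n))"
proof (induction n)
  case 0
  have "cone_density C ((1,0,0) # K) (\<lambda>b1 b2 b3. q b2 b3 * tpow 1 (b1 - b2 - b3))"
  proof (rule cone_density_axis1[OF d], goal_cases)
    case (1 b2 b3)
    show ?case by (intro continuous_intros continuous_on_tpow) simp_all
  next
    case (2 b2 b3)
    then show ?case by (simp add: tpow_nonpos)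
  next
    case (3 u b2 b3)
    have "((\<lambda>u. q b2 b3 * tpow 1 (u - b2 - b3)) has_real_derivative q b2 b3 * tpow 0 (u - b2 - b3)) (at u)"
    proof -
      have "((\<lambda>u. u - b2 - b3) has_real_derivative 1) (at u)" by (auto intro!: derivative_eq_intros)
      moreover have "u - b2 - b3 \<noteq> 0" using 3 by auto
      ultimately have "((\<lambda>u. tpow 1 (u - b2 - b3)) has_real_derivative tpow 0 (u - b2 - b3)) (at u)"
        using DERIV_tpow_1[of "\<lambda>u. u - b2 - b3" 1 u] by simp
      then show ?thesis by (rule DERIV_cmult)
    qed
    moreover have "q b2 b3 * tpow 0 (u - b2 - b3) = (if b2 + b3 \<le> u then q b2 b3 else 0)"
      using 3 by (auto simp: tpow_def)
    ultimately show ?case by simp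
  qed
  then show ?case by simp
next
  case (Suc n)
  have "cone_density C ((1,0,0) # replicate (Suc n) (1,0,0) @ K)
     (\<lambda>b1 b2 b3. q b2 b3 * tpow (Suc (Suc n)) (b1 - b2 - b3) / fact (Suc (Suc n)))"
  proof (rule cone_density_axis1[OF Suc.IH], goal_cases)
    case (1 b2 b3)
    show ?case by (intro continuous_intros continuous_on_tpow) simp_all
  next
    case (2 b2 b3)
    then show ?case by (simp add: tpow_nonpos)
  next
    case (3 u b2 b3)
    have "((\<lambda>u. u - b2 - b3) has_real_derivative 1) (at u)" by (auto intro!: derivative_eq_intros)
    from DERIV_tpow_ge2[OF this, of n]
    have "((\<lambda>u. (q b2 b3 / fact (Suc (Suc n))) * tpow (Suc (Suc n)) (u - b2 - b3)) has_real_derivative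
        (q b2 b3 / fact (Suc (Suc n))) * (real (Suc (Suc n)) * tpow (Suc n) (u - b2 - b3))) (at u)"
      by (intro DERIV_cmult) simp
    moreover have "(q b2 b3 / fact (Suc (Suc n))) * (real (Suc (Suc n)) * tpow (Suc n) (u - b2 - b3))
       = q b2 b3 * tpow (Suc n) (u - b2 - b3) / fact (Suc n)"
      by (simp del: of_nat_Suc add: field_simps)
    ultimately show ?case by (simp only: times_divide_eq_left)
  qed
  then show ?case by simp
qed

text \<open>The remaining steps add one vertex to the list of knots. A name \<open>corner_density_ijk\<close> or
\<open>medial_density_ijk\<close> counts the copies of \<open>v\<^sub>1\<close>, \<open>v\<^sub>2\<close>, \<open>v\<^sub>3\<close> in the enlarged list, and the suffix \<open>v4\<close> records
that it also contains \<open>v\<^sub>4\<close>. Each closed form was found by integrating the preceding one; for the proof it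
suffices to differentiate it and to see that it vanishes on the face where the new variable is 0.\<close>

lemma medial_density_100_v4:
  assumes "cone_density C K (\<lambda>b1 b2 b3. if b1 \<le> b2 + b3 \<and> b2 \<le> b1 + b3 \<and> b3 \<le> b1 + b2 then b1 + b2 - b3 else 0)"
  shows "cone_density C ((1,0,0) # K) (\<lambda>b1 b2 b3. 1/2 * tpow 2 (b1 + b2 - b3) - tpow 1 (b1 - b2 - b3) * (b1/2
      + 3/2*b2 - b3/2) - 2 * tpow 2 (b2 - b3) + tpow 1 (b2 - b1 - b3) * (b1/2 + 3/2*b2 - 3/2*b3))"
proof (rule cone_density_axis1[OF assms], goal_cases)
  case (1 b2 b3)
  show ?case by (intro continuous_intros continuous_on_tpow) simp_all
next
  case (2 b2 b3)
  then show ?case by (simp add: tpow_nonpos tpow_unfold(4) field_simps)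
next
  case (3 u b2 b3)
  have n: "u - b2 - b3 \<noteq> 0" "b2 - u - b3 \<noteq> 0" "u + b2 - b3 \<noteq> 0" using 3 by auto
  let ?D = "tpow 1 (u + b2 - b3) - tpow 0 (u - b2 - b3) * (u/2 + 3/2*b2 - b3/2) - tpow 1 (u - b2 - b3) / 2
     - tpow 0 (b2 - u - b3) * (u/2 + 3/2*b2 - 3/2*b3) + tpow 1 (b2 - u - b3) / 2"
  have "((\<lambda>u. 1/2 * tpow 2 (u + b2 - b3) - tpow 1 (u - b2 - b3) * (u/2 + 3/2*b2 - b3/2) - 2 * tpow 2 (b2 - b3)
      + tpow 1 (b2 - u - b3) * (u/2 + 3/2*b2 - 3/2*b3)) has_real_derivative ?D) (at u)"
    by ((rule derivative_eq_intros refl n | (simp; fail))+)? ((simp add: field_simps)?)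
  moreover have "?D = (if u \<le> b2 + b3 \<and> b2 \<le> u + b3 \<and> b3 \<le> u + b2 then u + b2 - b3 else 0)"
  proof -
    consider "b2 + b3 < u" | "u + b3 < b2" | "u + b2 < b3" | "u \<le> b2 + b3 \<and> b2 \<le> u + b3 \<and> b3 \<le> u + b2"
      by linarith
    then show ?thesis
    proof cases
      case 1
      then have "0 < u - b2 - b3" "b2 - u - b3 \<le> 0" "0 < u + b2 - b3" using 3 by auto
      then show ?thesis using 1 by (simp add: tpow_pos tpow_nonpos field_simps)
    next
      case 2
      then have "u - b2 - b3 \<le> 0" "0 < b2 - u - b3" "0 < u + b2 - b3" using 3 by auto
      then show ?thesis using 2 by (simp add: tpow_pos tpow_nonpos field_simps)
    next
      case 3
      then have "u - b2 - b3 \<le> 0" "b2 - u - b3 \<le> 0" "u + b2 - b3 \<le> 0" using \<open>0 \<le> b2\<close> \<open>0 \<le> b3\<close> \<open>0 < u\<close> by auto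
      then show ?thesis using 3 by (simp add: tpow_pos tpow_nonpos)
    next
      case 4
      then have "u - b2 - b3 \<le> 0" "b2 - u - b3 \<le> 0" "0 < u + b2 - b3" using n by auto
      then show ?thesis using 4 by (simp add: tpow_pos tpow_nonpos)
    qed
  qed
  ultimately show ?case by simp
qed

lemma corner_density_310_v4:
  assumes "cone_density C K (\<lambda>b1 b2 b3. 2 * b2 * tpow 3 (b1 - b2 - b3) / 6)"
  shows "cone_density C ((0,1,0) # K) (\<lambda>b1 b2 b3. 1/60 * tpow 5 (b1 - b3) + tpow 4 (b1 - b2 - b3) * (b3/60 - b1/60 - b2/15))"
proof (rule cone_density_axis2[OF assms], goal_cases)
  case (1 b1 b3)
  show ?case by (intro continuous_intros continuous_on_tpow) simp_all
next
  case (2 b1 b3)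
  then show ?case by (simp add: tpow_nonpos tpow_nonneg tpow_unfold(1) tpow_unfold(2) power2_eq_square power3_eq_cube power4_eq_xxxx power5_eq field_simps)
next
  case (3 u b1 b3)
  show ?case
    by ((rule derivative_eq_intros refl | (simp; fail))+)?
       ((simp add: tpow_unfold(1) tpow_unfold(2) power2_eq_square power3_eq_cube power4_eq_xxxx power5_eq field_simps)?)
qed

lemma corner_density_210_v4:
  assumes "cone_density C K (\<lambda>b1 b2 b3. 2 * b2 * tpow 2 (b1 - b2 - b3) / 2)"
  shows "cone_density C ((0,1,0) # K) (\<lambda>b1 b2 b3. 1/12 * tpow 4 (b1 - b3) + tpow 3 (b1 - b2 - b3) * (b3/12 - b1/12 - b2/4))"
proof (rule cone_density_axis2[OF assms], goal_cases)
  case (1 b1 b3)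
  show ?case by (intro continuous_intros continuous_on_tpow) simp_all
next
  case (2 b1 b3)
  then show ?case by (simp add: tpow_nonpos tpow_nonneg tpow_unfold(2) tpow_unfold(3) power2_eq_square power3_eq_cube power4_eq_xxxx power5_eq field_simps)
next
  case (3 u b1 b3)
  show ?case
    by ((rule derivative_eq_intros refl | (simp; fail))+)?
       ((simp add: tpow_unfold(2) tpow_unfold(3) power2_eq_square power3_eq_cube power4_eq_xxxx power5_eq field_simps)?)
qed

lemma corner_density_220_v4:
  assumes "cone_density C K (\<lambda>b1 b2 b3. 1/12 * tpow 4 (b1 - b3) + tpow 3 (b1 - b2 - b3) * (b3/12 - b1/12 - b2/4))"
  shows "cone_density C ((0,1,0) # K) (\<lambda>b1 b2 b3. tpow 4 (b1 - b3) * (b2/12 + b3/30 - b1/30)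
      + tpow 4 (b1 - b2 - b3) * (b1/30 + b2/20 - b3/30))"
proof (rule cone_density_axis2[OF assms], goal_cases)
  case (1 b1 b3)
  show ?case by (intro continuous_intros continuous_on_tpow) simp_all
next
  case (2 b1 b3)
  then show ?case by (simp add: tpow_nonpos tpow_nonneg tpow_unfold(2) power2_eq_square power3_eq_cube power4_eq_xxxx power5_eq field_simps)
next
  case (3 u b1 b3)
  show ?case
    by ((rule derivative_eq_intros refl | (simp; fail))+)?
       ((simp add: tpow_unfold(2) power2_eq_square power3_eq_cube power4_eq_xxxx power5_eq field_simps)?)
qed

lemma corner_density_310:
  assumes "cone_density C K (\<lambda>b1 b2 b3. tpow 3 (b1 - b2 - b3) / 6)"
  shows "cone_density C ((0,1,0) # K) (\<lambda>b1 b2 b3. 1/24 * tpow 4 (b1 - b3) - 1/24 * tpow 4 (b1 - b2 - b3))"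
proof (rule cone_density_axis2[OF assms], goal_cases)
  case (1 b1 b3)
  show ?case by (intro continuous_intros continuous_on_tpow) simp_all
next
  case (2 b1 b3)
  then show ?case by (simp add: tpow_nonpos tpow_nonneg tpow_unfold(2) power2_eq_square power3_eq_cube power4_eq_xxxx power5_eq field_simps)
next
  case (3 u b1 b3)
  show ?case
    by ((rule derivative_eq_intros refl | (simp; fail))+)?
       ((simp add: tpow_unfold(2) power2_eq_square power3_eq_cube power4_eq_xxxx power5_eq field_simps)?)
qed

lemma corner_density_311:
  assumes "cone_density C K (\<lambda>b1 b2 b3. 1/24 * tpow 4 (b1 - b3) - 1/24 * tpow 4 (b1 - b2 - b3))"
  shows "cone_density C ((0,0,1) # K) (\<lambda>b1 b2 b3. 1/120 * b1^5 - 1/120 * tpow 5 (b1 - b3) - 1/120 * tpow 5 (b1 - b2)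
      + 1/120 * tpow 5 (b1 - b2 - b3))"
proof (rule cone_density_axis3[OF assms], goal_cases)
  case (1 b1 b2)
  show ?case by (intro continuous_intros continuous_on_tpow) simp_all
next
  case (2 b1 b2)
  then show ?case by (cases "b1 \<le> b2") (simp add: tpow_nonpos tpow_nonneg tpow_unfold(1) power2_eq_square power3_eq_cube power4_eq_xxxx power5_eq field_simps)+
next
  case (3 u b1 b2)
  show ?case
    by ((rule derivative_eq_intros refl | (simp; fail))+)?
       ((simp add: tpow_unfold(1) power2_eq_square power3_eq_cube power4_eq_xxxx power5_eq field_simps)?)
qed

lemma corner_density_211_v4:
  assumes "cone_density C K (\<lambda>b1 b2 b3. 1/12 * tpow 4 (b1 - b3) + tpow 3 (b1 - b2 - b3) * (b3/12 - b1/12 - b2/4))"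
  shows "cone_density C ((0,0,1) # K) (\<lambda>b1 b2 b3. 1/60 * b1^5 - 1/60 * tpow 5 (b1 - b3)
      - tpow 4 (b1 - b2) * (b1/60 + b2/15) + tpow 4 (b1 - b2 - b3) * (b1/60 + b2/15 - b3/60))"
proof (rule cone_density_axis3[OF assms], goal_cases)
  case (1 b1 b2)
  show ?case by (intro continuous_intros continuous_on_tpow) simp_all
next
  case (2 b1 b2)
  then show ?case by (cases "b1 \<le> b2") (simp add: tpow_nonpos tpow_nonneg tpow_unfold(1) tpow_unfold(2) power2_eq_square power3_eq_cube power4_eq_xxxx power5_eq field_simps)+
next
  case (3 u b1 b2)
  show ?case
    by ((rule derivative_eq_intros refl | (simp; fail))+)?
       ((simp add: tpow_unfold(1) tpow_unfold(2) power2_eq_square power3_eq_cube power4_eq_xxxx power5_eq field_simps)?)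
qed

lemma medial_density_200_v4:
  assumes "cone_density C K (\<lambda>b1 b2 b3. 1/2 * tpow 2 (b1 + b2 - b3) - tpow 1 (b1 - b2 - b3) * (b1/2 + 3/2*b2 - b3/2)
      - 2 * tpow 2 (b2 - b3) + tpow 1 (b2 - b1 - b3) * (b1/2 + 3/2*b2 - 3/2*b3))"
  shows "cone_density C ((1,0,0) # K) (\<lambda>b1 b2 b3. 1/6 * tpow 3 (b1 + b2 - b3) - tpow 2 (b1 - b2 - b3) * (b1/6
      + 5/6*b2 - b3/6) - tpow 2 (b2 - b3) * (2*b1 - 2/3*b2 + 2/3*b3) - tpow 2 (b2 - b1 - b3) * (b1/6 + 5/6*b2 - 5/6*b3))"
proof (rule cone_density_axis1[OF assms], goal_cases)
  case (1 b2 b3)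
  show ?case by (intro continuous_intros continuous_on_tpow) simp_all
next
  case (2 b2 b3)
  then show ?case by (simp add: tpow_nonpos tpow_nonneg tpow_unfold(3) tpow_unfold(4) power2_eq_square power3_eq_cube power4_eq_xxxx power5_eq field_simps)
next
  case (3 u b2 b3)
  show ?case
    by ((rule derivative_eq_intros refl | (simp; fail))+)?
       ((simp add: tpow_unfold(3) tpow_unfold(4) power2_eq_square power3_eq_cube power4_eq_xxxx power5_eq field_simps)?)
qed

lemma medial_density_210_v4:
  assumes "cone_density C K (\<lambda>b1 b2 b3. 1/6 * tpow 3 (b1 + b2 - b3) - tpow 2 (b1 - b2 - b3) * (b1/6 + 5/6*b2 - b3/6)
      - tpow 2 (b2 - b3) * (2*b1 - 2/3*b2 + 2/3*b3) - tpow 2 (b2 - b1 - b3) * (b1/6 + 5/6*b2 - 5/6*b3))"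
  shows "cone_density C ((0,1,0) # K) (\<lambda>b1 b2 b3. 1/24 * tpow 4 (b1 + b2 - b3) - 1/6 * tpow 4 (b1 - b3)
      + tpow 3 (b1 - b2 - b3) * (b1/8 + 5/24*b2 - b3/8) - tpow 3 (b2 - b3) * (2/3*b1 - b2/6 + b3/6)
      - tpow 3 (b2 - b1 - b3) * (b1/8 + 5/24*b2 - 5/24*b3))"
proof (rule cone_density_axis2[OF assms], goal_cases)
  case (1 b1 b3)
  show ?case by (intro continuous_intros continuous_on_tpow) simp_all
next
  case (2 b1 b3)
  then show ?case by (simp add: tpow_nonpos tpow_nonneg tpow_unfold(2) tpow_unfold(3) power2_eq_square power3_eq_cube power4_eq_xxxx power5_eq field_simps)
next
  case (3 u b1 b3)
  show ?case
    by ((rule derivative_eq_intros refl | (simp; fail))+)?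
       ((simp add: tpow_unfold(2) tpow_unfold(3) power2_eq_square power3_eq_cube power4_eq_xxxx power5_eq field_simps)?)
qed

lemma medial_density_220_v4:
  assumes "cone_density C K (\<lambda>b1 b2 b3. 1/24 * tpow 4 (b1 + b2 - b3) - 1/6 * tpow 4 (b1 - b3)
      + tpow 3 (b1 - b2 - b3) * (b1/8 + 5/24*b2 - b3/8) - tpow 3 (b2 - b3) * (2/3*b1 - b2/6 + b3/6)
      - tpow 3 (b2 - b1 - b3) * (b1/8 + 5/24*b2 - 5/24*b3))"
  shows "cone_density C ((0,1,0) # K) (\<lambda>b1 b2 b3. 1/120 * tpow 5 (b1 + b2 - b3)
      + tpow 4 (b1 - b3) * (b1/30 - b2/6 - b3/30) - tpow 4 (b1 - b2 - b3) * (b1/24 + b2/24 - b3/24)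
      - tpow 4 (b2 - b3) * (b1/6 - b2/30 + b3/30) - tpow 4 (b2 - b1 - b3) * (b1/24 + b2/24 - b3/24))"
proof (rule cone_density_axis2[OF assms], goal_cases)
  case (1 b1 b3)
  show ?case by (intro continuous_intros continuous_on_tpow) simp_all
next
  case (2 b1 b3)
  then show ?case by (simp add: tpow_nonpos tpow_nonneg tpow_unfold(1) tpow_unfold(2) power2_eq_square power3_eq_cube power4_eq_xxxx power5_eq field_simps)
next
  case (3 u b1 b3)
  show ?case
    by ((rule derivative_eq_intros refl | (simp; fail))+)?
       ((simp add: tpow_unfold(1) tpow_unfold(2) power2_eq_square power3_eq_cube power4_eq_xxxx power5_eq field_simps)?)
qed

lemma medial_density_101_v4:
  assumes "cone_density C K (\<lambda>b1 b2 b3. 1/2 * tpow 2 (b1 + b2 - b3) - tpow 1 (b1 - b2 - b3) * (b1/2 + 3/2*b2 - b3/2)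
      - 2 * tpow 2 (b2 - b3) + tpow 1 (b2 - b1 - b3) * (b1/2 + 3/2*b2 - 3/2*b3))"
  shows "cone_density C ((0,0,1) # K) (\<lambda>b1 b2 b3. 2/3 * b1^3 - 1/6 * tpow 3 (b1 + b2 - b3) - tpow 2 (b1 - b2) * (2/3*b1
      + 4/3*b2) + tpow 2 (b1 - b2 - b3) * (b1/6 + 5/6*b2 - b3/6) + 2/3 * tpow 3 (b2 - b3)
      - tpow 2 (b2 - b1 - b3) * (b1/2 + b2/2 - b3/2))"
proof (rule cone_density_axis3[OF assms], goal_cases)
  case (1 b1 b2)
  show ?case by (intro continuous_intros continuous_on_tpow) simp_all
next
  case (2 b1 b2)
  then show ?case by (cases "b1 \<le> b2") (simp add: tpow_nonpos tpow_nonneg tpow_unfold(3) tpow_unfold(4) power2_eq_square power3_eq_cube power4_eq_xxxx power5_eq field_simps)+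
next
  case (3 u b1 b2)
  show ?case
    by ((rule derivative_eq_intros refl | (simp; fail))+)?
       ((simp add: tpow_unfold(3) tpow_unfold(4) power2_eq_square power3_eq_cube power4_eq_xxxx power5_eq field_simps)?)
qed

lemma medial_density_111_v4:
  assumes "cone_density C K (\<lambda>b1 b2 b3. 2/3 * b1^3 - 1/6 * tpow 3 (b1 + b2 - b3) - tpow 2 (b1 - b2) * (2/3*b1 + 4/3*b2)
      + tpow 2 (b1 - b2 - b3) * (b1/6 + 5/6*b2 - b3/6) + 2/3 * tpow 3 (b2 - b3) - tpow 2 (b2 - b1 - b3) * (b1/2 + b2/2 - b3/2))"
  shows "cone_density C ((0,1,0) # K) (\<lambda>b1 b2 b3. 2/3 * (b1^3 * b2) - 1/3 * b1^4 - 1/24 * tpow 4 (b1 + b2 - b3)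
      + tpow 3 (b1 - b2) * (b1/3 + b2/3) + 1/6 * tpow 4 (b1 - b3) - tpow 3 (b1 - b2 - b3) * (b1/8 + 5/24*b2 - b3/8)
      + 1/6 * tpow 4 (b2 - b3) - tpow 3 (b2 - b1 - b3) * (5/24*b1 + b2/8 - b3/8))"
proof (rule cone_density_axis2[OF assms], goal_cases)
  case (1 b1 b3)
  show ?case by (intro continuous_intros continuous_on_tpow) simp_all
next
  case (2 b1 b3)
  then show ?case by (simp add: tpow_nonpos tpow_nonneg tpow_unfold(2) tpow_unfold(3) power2_eq_square power3_eq_cube power4_eq_xxxx power5_eq field_simps)
next
  case (3 u b1 b3)
  show ?case
    by ((rule derivative_eq_intros refl | (simp; fail))+)?
       ((simp add: tpow_unfold(2) tpow_unfold(3) power2_eq_square power3_eq_cube power4_eq_xxxx power5_eq field_simps)?)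
qed

lemma medial_density_121_v4:
  assumes "cone_density C K (\<lambda>b1 b2 b3. 2/3 * (b1^3 * b2) - 1/3 * b1^4 - 1/24 * tpow 4 (b1 + b2 - b3)
      + tpow 3 (b1 - b2) * (b1/3 + b2/3) + 1/6 * tpow 4 (b1 - b3) - tpow 3 (b1 - b2 - b3) * (b1/8 + 5/24*b2 - b3/8)
      + 1/6 * tpow 4 (b2 - b3) - tpow 3 (b2 - b1 - b3) * (5/24*b1 + b2/8 - b3/8))"
  shows "cone_density C ((0,1,0) # K) (\<lambda>b1 b2 b3. 1/10 * b1^5 - 1/3 * (b1^4 * b2) + 1/3 * (b1^3 * b2^2)
      - 1/120 * tpow 5 (b1 + b2 - b3) - tpow 4 (b1 - b2) * (b1/10 + b2/15) + tpow 4 (b1 - b3) * (b2/6 + b3/30 - b1/30)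
      + tpow 4 (b1 - b2 - b3) * (b1/24 + b2/24 - b3/24) + 1/30 * tpow 5 (b2 - b3)
      - tpow 4 (b2 - b1 - b3) * (7/120*b1 + b2/40 - b3/40))"
proof (rule cone_density_axis2[OF assms], goal_cases)
  case (1 b1 b3)
  show ?case by (intro continuous_intros continuous_on_tpow) simp_all
next
  case (2 b1 b3)
  then show ?case by (simp add: tpow_nonpos tpow_nonneg tpow_unfold(1) tpow_unfold(2) power2_eq_square power3_eq_cube power4_eq_xxxx power5_eq field_simps)
next
  case (3 u b1 b3)
  show ?case
    by ((rule derivative_eq_intros refl | (simp; fail))+)?
       ((simp add: tpow_unfold(1) tpow_unfold(2) power2_eq_square power3_eq_cube power4_eq_xxxx power5_eq field_simps)?)
qed

lemma density_value:
  assumes "cone_density C K F"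
  shows "enn2real (cone_vol C K (b1, b2, b3)) = (if 0 \<le> b1 \<and> 0 \<le> b2 \<and> 0 \<le> b3 then F b1 b2 b3 else 0)"
  using assms by (auto simp: cone_density_def)

lemma spline_corner:
  assumes nc: "\<not> collinear {v 1, v 2, v 3}"
    and js: "length js = 5" "\<forall>i\<in>set js. i < 6"
    and m: "length m = 6" "mset (concat (map2 replicate m [0..<6])) = mset ([0, 3, 5] @ js)"
    and d: "cone_density corner_cone (map ((!) knot_coords) js) F"
  shows "simplex_spline v m x = (if x \<in> triangle_of v
     then 480 * F (barycentric v x 1) (barycentric v x 2) (barycentric v x 3) else 0)"
  using simplex_spline_corner[OF nc js m, of x] density_value[OF d]
  by (auto simp: mem_triangle_iff[OF nc] forall_3 bary3_def corner_cone_def)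

lemma spline_medial:
  assumes nc: "\<not> collinear {v 1, v 2, v 3}"
    and js: "length js = 5" "\<forall>i\<in>set js. i < 6"
    and m: "length m = 6" "mset (concat (map2 replicate m [0..<6])) = mset ([3, 4, 5] @ js)"
    and d: "cone_density medial_cone (map ((!) knot_coords) js) F"
  shows "simplex_spline v m x = (if x \<in> triangle_of v
     then 480 * F (barycentric v x 1) (barycentric v x 2) (barycentric v x 3) else 0)"
  using simplex_spline_medial[OF nc js m, of x] density_value[OF d]
  by (auto simp: mem_triangle_iff[OF nc] forall_3 bary3_def medial_cone_def)

section \<open>Closed forms of the eight seeds\<close>

text \<open>The closed forms of the scaled seeds as functions of the barycentric coordinates, for the sixth and the
seventh with the roles of the first two vertices exchanged, so that the corner at the first vertex
serves as base.\<close>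

definition F1 :: "real \<Rightarrow> real \<Rightarrow> real \<Rightarrow> real" where
  "F1 b1 b2 b3 = tpow 5 (b1 - b2 - b3)"
definition F2 :: "real \<Rightarrow> real \<Rightarrow> real \<Rightarrow> real" where
  "F2 b1 b2 b3 = 10 * b2 * tpow 4 (b1 - b2 - b3)"
definition F3 :: "real \<Rightarrow> real \<Rightarrow> real \<Rightarrow> real" where
  "F3 b1 b2 b3 = 4 * (b1 - b3) * tpow 4 (b1 - b3) - 4 * (b1 + 4 * b2 - b3) * tpow 4 (b1 - b2 - b3)"
definition F4 :: "real \<Rightarrow> real \<Rightarrow> real \<Rightarrow> real" where
  "F4 b1 b2 b3 = 4 * (5 * b2 + 2 * b3 - 2 * b1) * tpow 4 (b1 - b3) + 4 * (2 * b1 + 3 * b2 - 2 * b3) * tpow 4 (b1 - b2 - b3)"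
definition F5 :: "real \<Rightarrow> real \<Rightarrow> real \<Rightarrow> real" where
  "F5 b1 b2 b3 = 3 * (b1 + b2 - b3) * tpow 4 (b1 + b2 - b3)
     + 12 * (b1 - 5 * b2 - b3) * tpow 4 (b1 - b3) + 12 * (b2 - 5 * b1 - b3) * tpow 4 (b2 - b3)
     - 15 * (b1 + b2 - b3) * (tpow 4 (b1 - b2 - b3) + tpow 4 (b2 - b1 - b3))"
definition F6 :: "real \<Rightarrow> real \<Rightarrow> real \<Rightarrow> real" where
  "F6 b1 b2 b3 = 4 * b1 ^ 5 - 4 * (b1 - b3) * tpow 4 (b1 - b3) - 4 * (b1 - b2) * tpow 4 (b1 - b2)
     + 4 * (b1 - b2 - b3) * tpow 4 (b1 - b2 - b3)"
definition F7 :: "real \<Rightarrow> real \<Rightarrow> real \<Rightarrow> real" where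
  "F7 b1 b2 b3 = 4 * b1 ^ 5 - 4 * (b1 - b3) * tpow 4 (b1 - b3) - 4 * (b1 + 4 * b2) * tpow 4 (b1 - b2)
     + 4 * (b1 + 4 * b2 - b3) * tpow 4 (b1 - b2 - b3)"
definition F8 :: "real \<Rightarrow> real \<Rightarrow> real \<Rightarrow> real" where
  "F8 b1 b2 b3 = 36 * b1 ^ 5 - 120 * b1 ^ 4 * b2 + 120 * b1 ^ 3 * b2 ^ 2
     - 3 * (b1 + b2 - b3) * tpow 4 (b1 + b2 - b3)
     - 12 * (3 * b1 + 2 * b2) * tpow 4 (b1 - b2) - 12 * (b1 - 5 * b2 - b3) * tpow 4 (b1 - b3)
     + 12 * (b2 - b3) * tpow 4 (b2 - b3) + 15 * (b1 + b2 - b3) * tpow 4 (b1 - b2 - b3)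
     - 3 * (7 * b1 + 3 * b2 - 3 * b3) * tpow 4 (b2 - b1 - b3)"

lemmas F_defs = F1_def F2_def F3_def F4_def F5_def F6_def F7_def F8_def

lemma upt6: "[0..<6] = [0, 1, 2, 3, 4, 5 :: nat]" by (simp add: upt_rec eval_nat_numeral)

definition trunc_to :: "(3 \<Rightarrow> real^2) \<Rightarrow> (real \<Rightarrow> real \<Rightarrow> real \<Rightarrow> real) \<Rightarrow> 3 \<Rightarrow> 3 \<Rightarrow> 3 \<Rightarrow> real^2 \<Rightarrow> real" where
  "trunc_to v F i j k = (\<lambda>x. if x \<in> triangle_of v
     then F (barycentric v x i) (barycentric v x j) (barycentric v x k) else 0)"

lemma replicate_numerals:
  "replicate 2 x = [x, x]" "replicate 3 x = [x, x, x]" "replicate 4 x = [x, x, x, x]"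
  "replicate 5 x = [x, x, x, x, x]" "replicate 6 x = [x, x, x, x, x, x]"
  by (simp_all add: eval_nat_numeral)

text \<open>Exchanging the first two vertices exchanges the fifth and the sixth point and fixes the fourth.\<close>

lemma knots_swap:
  "knots (v \<circ> Transposition.transpose (1::3) 2) [b, a, c, d, 0, e] = knots v [a, b, c, d, e, 0]"
  by (simp add: knots_def ps_points_def midpoint_sym[of "v 2" "v 1"] Transposition.transpose_def)

lemma simplex_spline_swap:
  fixes v :: "3 \<Rightarrow> real^2"
  shows "simplex_spline (v \<circ> Transposition.transpose (1::3) 2) [b, a, c, d, 0, e] = simplex_spline v [a, b, c, d, e, 0]"
proof -
  have "Transposition.transpose (1::3) 2 permutes UNIV" by (simp add: permutes_swap_id)
  from triangle_perm[OF this, of v] show ?thesis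
    by (simp add: simplex_spline_def fun_eq_iff knots_swap)
qed

lemma seed_splines:
  assumes nc: "\<not> collinear {v 1, v 2, v 3}"
  shows "(\<lambda>x. 1/4 * simplex_spline v [6,0,0,1,0,1] x) = trunc_to v F1 1 2 3"
    and "(\<lambda>x. 1/4 * simplex_spline v [5,0,0,2,0,1] x) = trunc_to v F2 1 2 3"
    and "(\<lambda>x. 1/2 * simplex_spline v [4,1,0,2,0,1] x) = trunc_to v F3 1 2 3"
    and "(\<lambda>x. 1/2 * simplex_spline v [3,2,0,2,0,1] x) = trunc_to v F4 1 2 3"
    and "(\<lambda>x. 3/4 * simplex_spline v [2,2,0,2,1,1] x) = trunc_to v F5 1 2 3"
    and "(\<lambda>x. 1 * simplex_spline v [4,1,1,1,0,1] x) = trunc_to v F6 1 2 3"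
    and "(\<lambda>x. 1/2 * simplex_spline v [3,1,1,2,0,1] x) = trunc_to v F7 1 2 3"
    and "(\<lambda>x. 3/4 * simplex_spline v [1,2,1,2,1,1] x) = trunc_to v F8 1 2 3"
proof -
  have c0: "cone_density corner_cone [] (\<lambda>b1 b2 b3. if b2 + b3 \<le> b1 then (\<lambda>_ _. 1) b2 b3 else 0)"
    using corner_density_Nil by simp
  have c4: "cone_density corner_cone [(1/2, 1/2, 0)] (\<lambda>b1 b2 b3. if b2 + b3 \<le> b1 then (\<lambda>b2 _. 2 * b2) b2 b3 else 0)"
    using corner_density_v4 by simp
  note A = corner_density_v1[OF c0] and B = corner_density_v1[OF c4]
  have kc: "knot_coords ! 0 = (1,0,0)" "knot_coords ! 1 = (0,1,0)" "knot_coords ! 2 = (0,0,1)"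
    "knot_coords ! 3 = (1/2,1/2,0)" by (simp_all add: knot_coords_def)
  have d1: "cone_density corner_cone (map ((!) knot_coords) [0,0,0,0,0]) (\<lambda>b1 b2 b3. tpow 5 (b1 - b2 - b3) / 120)"
    using A[of 4] by (simp add: kc fact_numeral replicate_numerals)
  have d2: "cone_density corner_cone (map ((!) knot_coords) [0,0,0,0,3]) (\<lambda>b1 b2 b3. 2 * b2 * tpow 4 (b1 - b2 - b3) / 24)"
    using B[of 3] by (simp add: kc fact_numeral replicate_numerals)
  have B3: "cone_density corner_cone [(1,0,0),(1,0,0),(1,0,0),(1/2,1/2,0)] (\<lambda>b1 b2 b3. 2 * b2 * tpow 3 (b1 - b2 - b3) / 6)"
    using B[of 2] by (simp add: fact_numeral replicate_numerals)
  have B2: "cone_density corner_cone [(1,0,0),(1,0,0),(1/2,1/2,0)] (\<lambda>b1 b2 b3. 2 * b2 * tpow 2 (b1 - b2 - b3) / 2)"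
    using B[of 1] unfolding Suc_1 by (simp add: fact_numeral replicate_numerals)
  have A3: "cone_density corner_cone [(1,0,0),(1,0,0),(1,0,0)] (\<lambda>b1 b2 b3. tpow 3 (b1 - b2 - b3) / 6)"
    using A[of 2] by (simp add: fact_numeral replicate_numerals)
  note M = medial_density_100_v4[OF medial_density_v4]
  note val = spline_corner[OF nc] and valm = spline_medial[OF nc]
  show "(\<lambda>x. 1/4 * simplex_spline v [6,0,0,1,0,1] x) = trunc_to v F1 1 2 3"
    by (subst val[OF _ _ _ _ d1]) (auto simp: upt6 replicate_numerals trunc_to_def F1_def fun_eq_iff)
  show "(\<lambda>x. 1/4 * simplex_spline v [5,0,0,2,0,1] x) = trunc_to v F2 1 2 3"
    by (subst val[OF _ _ _ _ d2]) (auto simp: upt6 replicate_numerals trunc_to_def F2_def fun_eq_iff)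
  have k3: "map ((!) knot_coords) [1,0,0,0,3] = [(0,1,0),(1,0,0),(1,0,0),(1,0,0),(1/2,1/2,0)]"
    by (simp add: knot_coords_def)
  note d3 = corner_density_310_v4[OF B3, folded k3]
  show "(\<lambda>x. 1/2 * simplex_spline v [4,1,0,2,0,1] x) = trunc_to v F3 1 2 3"
    by (subst val[OF _ _ _ _ d3])
       (auto simp: upt6 replicate_numerals trunc_to_def F3_def fun_eq_iff tpow_unfold(1) algebra_simps)
  have k4: "map ((!) knot_coords) [1,1,0,0,3] = [(0,1,0),(0,1,0),(1,0,0),(1,0,0),(1/2,1/2,0)]"
    by (simp add: knot_coords_def)
  note d4 = corner_density_220_v4[OF corner_density_210_v4[OF B2], folded k4]
  show "(\<lambda>x. 1/2 * simplex_spline v [3,2,0,2,0,1] x) = trunc_to v F4 1 2 3"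
    by (subst val[OF _ _ _ _ d4])
       (auto simp: upt6 replicate_numerals trunc_to_def F4_def fun_eq_iff tpow_unfold(1) algebra_simps)
  have k5: "map ((!) knot_coords) [1,1,0,0,3] = [(0,1,0),(0,1,0),(1,0,0),(1,0,0),(1/2,1/2,0)]"
    by (simp add: knot_coords_def)
  note d5 = medial_density_220_v4[OF medial_density_210_v4[OF medial_density_200_v4[OF M]], folded k5]
  show "(\<lambda>x. 3/4 * simplex_spline v [2,2,0,2,1,1] x) = trunc_to v F5 1 2 3"
    by (subst valm[OF _ _ _ _ d5])
       (auto simp: upt6 replicate_numerals trunc_to_def F5_def fun_eq_iff tpow_unfold(1) algebra_simps)
  have k6: "map ((!) knot_coords) [2,1,0,0,0] = [(0,0,1),(0,1,0),(1,0,0),(1,0,0),(1,0,0)]"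
    by (simp add: knot_coords_def)
  note d6 = corner_density_311[OF corner_density_310[OF A3], folded k6]
  show "(\<lambda>x. 1 * simplex_spline v [4,1,1,1,0,1] x) = trunc_to v F6 1 2 3"
    by (subst val[OF _ _ _ _ d6])
       (auto simp: upt6 replicate_numerals trunc_to_def F6_def fun_eq_iff tpow_unfold(1) algebra_simps)
  have k7: "map ((!) knot_coords) [2,1,0,0,3] = [(0,0,1),(0,1,0),(1,0,0),(1,0,0),(1/2,1/2,0)]"
    by (simp add: knot_coords_def)
  note d7 = corner_density_211_v4[OF corner_density_210_v4[OF B2], folded k7]
  show "(\<lambda>x. 1/2 * simplex_spline v [3,1,1,2,0,1] x) = trunc_to v F7 1 2 3"
    by (subst val[OF _ _ _ _ d7])
       (auto simp: upt6 replicate_numerals trunc_to_def F7_def fun_eq_iff tpow_unfold(1) algebra_simps)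
  have k8: "map ((!) knot_coords) [1,1,2,0,3] = [(0,1,0),(0,1,0),(0,0,1),(1,0,0),(1/2,1/2,0)]"
    by (simp add: knot_coords_def)
  note d8 = medial_density_121_v4[OF medial_density_111_v4[OF medial_density_101_v4[OF M]], folded k8]
  show "(\<lambda>x. 3/4 * simplex_spline v [1,2,1,2,1,1] x) = trunc_to v F8 1 2 3"
    by (subst valm[OF _ _ _ _ d8])
       (auto simp: upt6 replicate_numerals trunc_to_def F8_def fun_eq_iff tpow_unfold(1) algebra_simps)
qed

section \<open>Polynomials and smoothness\<close>

definition monomials2 :: "nat \<Rightarrow> (real^2 \<Rightarrow> real) set" where
  "monomials2 d = {\<lambda>x. (x $ 1) ^ i * (x $ 2) ^ j | i j. i + j \<le> d}"

lemma monomials2I: "i + j \<le> d \<Longrightarrow> (\<lambda>x. (x $ 1) ^ i * (x $ 2) ^ j) \<in> monomials2 d"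
  unfolding monomials2_def by blast

lemma sum_fun_apply: "sum f A x = (\<Sum>i\<in>A. f i x)" for f :: "'i \<Rightarrow> 'a \<Rightarrow> real"
  by (induction A rule: infinite_finite_induct) auto

text \<open>Turns closure under linear combinations into a property of spans, and products into products of monomials.\<close>

lemma is_poly2_iff_span: "is_poly2 d p \<longleftrightarrow> p \<in> span (monomials2 d)"
proof
  assume "is_poly2 d p"
  then obtain a :: "nat \<Rightarrow> nat \<Rightarrow> real" where "\<And>x. p x = (\<Sum>i\<le>d. \<Sum>j\<le>d - i. a i j * (x $ 1) ^ i * (x $ 2) ^ j)"
    unfolding is_poly2_def by blast
  then have "p = (\<Sum>i\<le>d. \<Sum>j\<le>d - i. a i j *\<^sub>R (\<lambda>x. (x $ 1) ^ i * (x $ 2) ^ j))"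
    by (auto simp: fun_eq_iff sum_fun_apply scaleR_fun_def mult.assoc)
  also have "\<dots> \<in> span (monomials2 d)"
  proof (intro span_sum span_scale span_base)
    fix i j assume "i \<in> {..d}" "j \<in> {..d - i}"
    then show "(\<lambda>x. (x $ 1) ^ i * (x $ 2) ^ j) \<in> monomials2 d"
      by (intro monomials2I) simp
  qed
  finally show "p \<in> span (monomials2 d)" .
next
  have sub: "subspace (Collect (is_poly2 d))"
  proof (rule subspaceI)
    show "0 \<in> Collect (is_poly2 d)"
      unfolding is_poly2_def by (intro CollectI exI[of _ "\<lambda>_ _. 0"]) simp
  next
    fix p q assume "p \<in> Collect (is_poly2 d)" "q \<in> Collect (is_poly2 d)"
    then obtain a b :: "nat \<Rightarrow> nat \<Rightarrow> real" where
      "\<And>x. p x = (\<Sum>i\<le>d. \<Sum>j\<le>d - i. a i j * (x $ 1) ^ i * (x $ 2) ^ j)"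
      "\<And>x. q x = (\<Sum>i\<le>d. \<Sum>j\<le>d - i. b i j * (x $ 1) ^ i * (x $ 2) ^ j)"
      unfolding is_poly2_def by blast
    then show "p + q \<in> Collect (is_poly2 d)"
      unfolding is_poly2_def
      by (intro CollectI exI[of _ "\<lambda>i j. a i j + b i j"]) (simp add: sum.distrib distrib_right)
  next
    fix c and p assume "p \<in> Collect (is_poly2 d)"
    then obtain a :: "nat \<Rightarrow> nat \<Rightarrow> real" where
      "\<And>x. p x = (\<Sum>i\<le>d. \<Sum>j\<le>d - i. a i j * (x $ 1) ^ i * (x $ 2) ^ j)"
      unfolding is_poly2_def by blast
    then show "c *\<^sub>R p \<in> Collect (is_poly2 d)"
      unfolding is_poly2_def
      by (intro CollectI exI[of _ "\<lambda>i j. c * a i j"]) (simp add: scaleR_fun_def sum_distrib_left mult.assoc)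
  qed
  have "monomials2 d \<subseteq> Collect (is_poly2 d)"
  proof
    fix p assume "p \<in> monomials2 d"
    then obtain i j where ij: "p = (\<lambda>x. (x $ 1) ^ i * (x $ 2) ^ j)" "i + j \<le> d"
      by (auto simp: monomials2_def)
    have "(\<Sum>i'\<le>d. \<Sum>j'\<le>d - i'. (if i' = i \<and> j' = j then 1 else 0) * (x $ 1) ^ i' * (x $ 2) ^ j') = p x" for x
    proof -
      have "(\<Sum>i'\<le>d. \<Sum>j'\<le>d - i'. (if i' = i \<and> j' = j then 1 else 0) * (x $ 1) ^ i' * (x $ 2) ^ j')
        = (\<Sum>i'\<le>d. if i' = i then p x else 0)"
      proof (rule sum.cong[OF refl])
        fix i' show "(\<Sum>j'\<le>d - i'. (if i' = i \<and> j' = j then 1 else 0) * (x $ 1) ^ i' * (x $ 2) ^ j')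
           = (if i' = i then p x else 0)"
        proof (cases "i' = i")
          case True
          then have "(\<Sum>j'\<le>d - i'. (if i' = i \<and> j' = j then 1 else 0) * (x $ 1) ^ i' * (x $ 2) ^ j')
            = (\<Sum>j'\<le>d - i. if j' = j then p x else 0)"
            by (intro sum.cong) (auto simp: ij)
          then show ?thesis using True ij(2) by simp
        qed simp
      qed
      then show ?thesis using ij(2) by simp
    qed
    then show "p \<in> Collect (is_poly2 d)"
      unfolding is_poly2_def by (intro CollectI exI[of _ "\<lambda>i' j'. if i' = i \<and> j' = j then 1 else 0"]) simp
  qed
  then have "span (monomials2 d) \<subseteq> Collect (is_poly2 d)" using sub by (rule span_minimal)
  then show "p \<in> span (monomials2 d) \<Longrightarrow> is_poly2 d p" by blast
qed

lemma is_poly2_mono: "is_poly2 m p \<Longrightarrow> m \<le> n \<Longrightarrow> is_poly2 n p"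
  unfolding is_poly2_iff_span using span_mono[of "monomials2 m" "monomials2 n"]
  by (force simp: monomials2_def)

lemma is_poly2_add: "is_poly2 d p \<Longrightarrow> is_poly2 d q \<Longrightarrow> is_poly2 d (\<lambda>x. p x + q x)"
  unfolding is_poly2_iff_span using span_add[of p "monomials2 d" q] by (simp add: plus_fun_def)

lemma is_poly2_cmult: "is_poly2 d p \<Longrightarrow> is_poly2 d (\<lambda>x. c * p x)"
  unfolding is_poly2_iff_span using span_scale[of p "monomials2 d" c] by (simp add: scaleR_fun_def)

lemma is_poly2_const: "is_poly2 d (\<lambda>x. c)"
proof -
  have "is_poly2 d (\<lambda>x. c * 1)"
    by (rule is_poly2_cmult, unfold is_poly2_iff_span, rule span_base)
       (auto simp: monomials2_def intro!: exI[of _ 0])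
  then show ?thesis by simp
qed

lemma is_poly2_coord: "is_poly2 1 (\<lambda>x. x $ i)"
proof -
  have "(\<lambda>x::real^2. x $ 1) \<in> monomials2 1" "(\<lambda>x::real^2. x $ 2) \<in> monomials2 1"
    using monomials2I[of 1 0 1] monomials2I[of 0 1 1] by simp_all
  then have "is_poly2 1 (\<lambda>x. x $ 1) \<and> is_poly2 1 (\<lambda>x. x $ 2)"
    unfolding is_poly2_iff_span by (blast intro: span_base)
  then show ?thesis using forall_2[of "\<lambda>i. is_poly2 1 (\<lambda>x. x $ i)"] by simp
qed

lemma is_poly2_mult:
  assumes "is_poly2 m p" "is_poly2 n q"
  shows "is_poly2 (m + n) (\<lambda>x. p x * q x)"
proof -
  let ?S = "span (monomials2 (m + n))"
  have mono: "(\<lambda>x. f x * g x) \<in> ?S" if f: "f \<in> monomials2 m" and g: "g \<in> monomials2 n" for f g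
  proof -
    obtain i j where f': "f = (\<lambda>x. (x $ 1) ^ i * (x $ 2) ^ j)" "i + j \<le> m" using f by (auto simp: monomials2_def)
    obtain k l where g': "g = (\<lambda>x. (x $ 1) ^ k * (x $ 2) ^ l)" "k + l \<le> n" using g by (auto simp: monomials2_def)
    have "(\<lambda>x. f x * g x) = (\<lambda>x. (x $ 1) ^ (i + k) * (x $ 2) ^ (j + l))"
      by (simp add: f' g' power_add mult_ac)
    moreover have "(i + k) + (j + l) \<le> m + n" using f' g' by simp
    ultimately have "(\<lambda>x. f x * g x) \<in> monomials2 (m + n)" unfolding monomials2_def by blast
    then show ?thesis by (rule span_base)
  qed
  have sub1: "subspace {q. (\<lambda>x. f x * q x) \<in> ?S}" for f
  proof (rule subspaceI)
    show "0 \<in> {q. (\<lambda>x. f x * q x) \<in> ?S}" using span_zero[of "monomials2 (m + n)"] by (simp add: zero_fun_def)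
    show "a + b \<in> {q. (\<lambda>x. f x * q x) \<in> ?S}" if "a \<in> {q. (\<lambda>x. f x * q x) \<in> ?S}" "b \<in> {q. (\<lambda>x. f x * q x) \<in> ?S}" for a b
      using span_add[of _ "monomials2 (m + n)"] that by (fastforce simp: distrib_left plus_fun_def)
    show "c *\<^sub>R a \<in> {q. (\<lambda>x. f x * q x) \<in> ?S}" if "a \<in> {q. (\<lambda>x. f x * q x) \<in> ?S}" for a c
      using span_scale[of "\<lambda>x. f x * a x" "monomials2 (m + n)" c] that by (simp add: scaleR_fun_def mult_ac)
  qed
  have s1: "(\<lambda>x. f x * q x) \<in> ?S" if f: "f \<in> monomials2 m" and q: "q \<in> span (monomials2 n)" for f q
    using span_minimal[OF _ sub1[of f], of "monomials2 n"] mono[OF f] q by blast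
  have s2: "(\<lambda>x. q x * p x) \<in> ?S" if q: "q \<in> span (monomials2 n)" and p: "p \<in> span (monomials2 m)" for q p
  proof -
    have "monomials2 m \<subseteq> {p. (\<lambda>x. q x * p x) \<in> ?S}" using s1[OF _ q] by (auto simp: mult.commute)
    then show ?thesis using span_minimal[OF _ sub1[of q]] p by blast
  qed
  show ?thesis using s2[of q p] assms unfolding is_poly2_iff_span by (simp add: mult.commute)
qed

lemma is_poly2_power: "is_poly2 m p \<Longrightarrow> is_poly2 (m * k) (\<lambda>x. p x ^ k)"
  by (induction k) (use is_poly2_mult[of m p] in \<open>auto simp: is_poly2_const\<close>)

lemma is_poly2_affine: "is_poly2 1 (\<lambda>x. A \<bullet> x + c)"
proof -
  have "is_poly2 1 (\<lambda>x. (A $ 1 * x $ 1 + A $ 2 * x $ 2) + c)"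
    by (intro is_poly2_add is_poly2_cmult is_poly2_coord is_poly2_const)
  then show ?thesis by (simp add: inner_vec_def sum_2)
qed

lemma is_poly2_sum: "finite I \<Longrightarrow> (\<And>i. i \<in> I \<Longrightarrow> is_poly2 d (f i)) \<Longrightarrow> is_poly2 d (\<lambda>x. \<Sum>i\<in>I. f i x)"
  by (induction I rule: finite_induct) (auto simp: is_poly2_const is_poly2_add)

lemma Ck_on_cong: "(\<And>x. x \<in> S \<Longrightarrow> f x = g x) \<Longrightarrow> Ck_on k S f \<Longrightarrow> Ck_on k S g"
proof (cases k)
  case (Suc k')
  assume fg: "\<And>x. x \<in> S \<Longrightarrow> f x = g x" and "Ck_on k S f"
  then obtain f' where f': "\<forall>x\<in>S. (f has_derivative f' x) (at x within S)" "\<forall>b\<in>Basis. Ck_on k' S (\<lambda>x. f' x b)"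
    using Suc by auto
  have "(g has_derivative f' x) (at x within S)" if "x \<in> S" for x
    using has_derivative_transform[OF that] fg f'(1) that by metis
  with f'(2) Suc show ?thesis by auto
qed (auto cong: continuous_on_cong)

lemma Ck_on_SucD: "Ck_on (Suc k) S f \<Longrightarrow> Ck_on k S f"
proof (induction k arbitrary: f)
  case 0
  then obtain f' where "\<And>x. x \<in> S \<Longrightarrow> (f has_derivative f' x) (at x within S)" by auto
  then have "continuous_on S f" by (rule has_derivative_continuous_on)
  then show ?case by simp
next
  case (Suc k)
  then obtain f' where "\<forall>x\<in>S. (f has_derivative f' x) (at x within S)"
    "\<forall>b\<in>Basis. Ck_on (Suc k) S (\<lambda>x. f' x b)" unfolding Ck_on.simps(2)[of "Suc k"] by blast
  with Suc.IH show ?case unfolding Ck_on.simps(2)[of k] by blast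
qed

lemma Ck_on_const: "Ck_on k S (\<lambda>x. c)"
proof (induction k arbitrary: c)
  case (Suc k)
  then show ?case by (auto intro!: exI[of _ "\<lambda>x b. 0"])
qed auto

lemma Ck_on_add: "Ck_on k S f \<Longrightarrow> Ck_on k S g \<Longrightarrow> Ck_on k S (\<lambda>x. f x + g x)"
proof (induction k arbitrary: f g)
  case (Suc k)
  then obtain f' g' where "\<forall>x\<in>S. (f has_derivative f' x) (at x within S)" "\<forall>b\<in>Basis. Ck_on k S (\<lambda>x. f' x b)"
    "\<forall>x\<in>S. (g has_derivative g' x) (at x within S)" "\<forall>b\<in>Basis. Ck_on k S (\<lambda>x. g' x b)" by auto
  then show ?case using Suc.IH
    by (auto intro!: exI[of _ "\<lambda>x b. f' x b + g' x b"] has_derivative_add)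
qed (auto intro!: continuous_intros)

lemma Ck_on_mult: "Ck_on k S f \<Longrightarrow> Ck_on k S g \<Longrightarrow> Ck_on k S (\<lambda>x. f x * g x)"
proof (induction k arbitrary: f g)
  case (Suc k)
  then obtain f' g' where d: "\<forall>x\<in>S. (f has_derivative f' x) (at x within S)" "\<forall>b\<in>Basis. Ck_on k S (\<lambda>x. f' x b)"
    "\<forall>x\<in>S. (g has_derivative g' x) (at x within S)" "\<forall>b\<in>Basis. Ck_on k S (\<lambda>x. g' x b)" by auto
  have "Ck_on k S f" "Ck_on k S g" using Suc.prems Ck_on_SucD by blast+
  then have "Ck_on k S (\<lambda>x. f x * g' x b + f' x b * g x)" if "b \<in> Basis" for b
    using d that by (intro Ck_on_add Suc.IH) auto
  moreover have "((\<lambda>x. f x * g x) has_derivative (\<lambda>b. f x * g' x b + f' x b * g x)) (at x within S)" if "x \<in> S" for x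
    using d that by (intro has_derivative_mult) auto
  ultimately show ?case
    unfolding Ck_on.simps by (intro exI[of _ "\<lambda>x b. f x * g' x b + f' x b * g x"]) blast
qed (auto intro!: continuous_intros)

lemma Ck_on_affine: "Ck_on k S (\<lambda>x. A \<bullet> x + c)"
proof (cases k)
  case (Suc k')
  have "((\<lambda>x. A \<bullet> x + c) has_derivative (\<lambda>b. A \<bullet> b)) (at x within S)" for x
    by (auto intro!: derivative_eq_intros)
  then show ?thesis using Suc Ck_on_const by (auto intro!: exI[of _ "\<lambda>x b. A \<bullet> b"])
qed (auto intro!: continuous_intros)

text \<open>Differentiation lowers the exponent of a truncated power, which is continuous as long as the exponent is positive.\<close>

lemma Ck_on_tpow: "Ck_on k S (\<lambda>x. tpow (Suc k) (A \<bullet> x + c))"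
proof (induction k)
  case 0
  show ?case by (auto intro!: continuous_on_tpow continuous_intros)
next
  case (Suc k)
  have "((\<lambda>x. A \<bullet> x + c) has_derivative (\<lambda>b. A \<bullet> b)) (at x within S)" for x
    by (auto intro!: derivative_eq_intros)
  from has_derivative_compose[OF this has_real_derivative_tpow_ge2[unfolded has_field_derivative_def]]
  have "((\<lambda>x. tpow (Suc (Suc k)) (A \<bullet> x + c)) has_derivative
      (\<lambda>b. real (Suc (Suc k)) * tpow (Suc k) (A \<bullet> x + c) * (A \<bullet> b))) (at x within S)" for x .
  moreover have "Ck_on k S (\<lambda>x. real (Suc (Suc k)) * tpow (Suc k) (A \<bullet> x + c) * (A \<bullet> b))" for b
    by (rule Ck_on_mult[OF Ck_on_mult[OF Ck_on_const Suc.IH] Ck_on_const])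
  ultimately show ?case
    unfolding Ck_on.simps(2)[of k]
    by (intro exI[of _ "\<lambda>x b. real (Suc (Suc k)) * tpow (Suc k) (A \<bullet> x + c) * (A \<bullet> b)"]) blast
qed

lemma Ck_on_power: "Ck_on k S f \<Longrightarrow> Ck_on k S (\<lambda>x. f x ^ n)"
  by (induction n) (auto intro: Ck_on_const Ck_on_mult)

lemma Ck_on_sum: "(\<And>i. i \<in> I \<Longrightarrow> Ck_on k S (f i)) \<Longrightarrow> Ck_on k S (\<lambda>x. \<Sum>i\<in>I. f i x)"
  by (induction I rule: infinite_finite_induct) (auto intro: Ck_on_const Ck_on_add)

lemma Ck_on_is_poly2:
  assumes "is_poly2 d p" shows "Ck_on k S p"
proof -
  obtain a :: "nat \<Rightarrow> nat \<Rightarrow> real" where p: "\<And>x. p x = (\<Sum>i\<le>d. \<Sum>j\<le>d - i. a i j * (x $ 1) ^ i * (x $ 2) ^ j)"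
    using assms unfolding is_poly2_def by blast
  have c: "Ck_on k S (\<lambda>x. x $ i)" for i :: 2
    using Ck_on_affine[of k S "axis i 1" 0] by (simp add: inner_axis')
  show ?thesis unfolding p[abs_def]
    by (intro Ck_on_sum Ck_on_mult Ck_on_power c Ck_on_const)
qed

section \<open>The six lines of the split\<close>

text \<open>The three midlines of the triangle followed by its three medians, as linear forms in the barycentric coordinates.\<close>

definition line_form :: "nat \<Rightarrow> (3 \<Rightarrow> real) \<Rightarrow> real" where
  "line_form n b = [b 1 - b 2 - b 3, b 2 - b 1 - b 3, b 3 - b 1 - b 2, b 1 - b 2, b 1 - b 3, b 2 - b 3] ! n"

lemma line_form_simps [simp]:
  "line_form 0 b = b 1 - b 2 - b 3" "line_form (Suc 0) b = b 2 - b 1 - b 3" "line_form 2 b = b 3 - b 1 - b 2"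
  "line_form 3 b = b 1 - b 2" "line_form 4 b = b 1 - b 3" "line_form 5 b = b 2 - b 3"
  by (simp_all add: line_form_def)

lemma less_6_cases:
  assumes "n < (6::nat)"
  obtains "n = 0" | "n = Suc 0" | "n = 2" | "n = 3" | "n = 4" | "n = 5"
  using assms by linarith

definition on_triangle :: "(3 \<Rightarrow> real^2) \<Rightarrow> ((3 \<Rightarrow> real) \<Rightarrow> real) \<Rightarrow> real^2 \<Rightarrow> real" where
  "on_triangle v G = (\<lambda>x. if x \<in> triangle_of v then G (barycentric v x) else 0)"

lemma bary_convex_comb:
  assumes nc: "\<not> collinear {v 1, v 2, v 3}"
  shows "barycentric v ((1 - u) *\<^sub>R p + u *\<^sub>R q) i = (1 - u) * barycentric v p i + u * barycentric v q i"
proof -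
  obtain A c where A: "\<And>x i. barycentric v x i = A i \<bullet> x + c i" using bary_affine[OF nc] by blast
  show ?thesis unfolding A by (simp add: inner_add_right algebra_simps)
qed

lemma line_form_affine:
  assumes nc: "\<not> collinear {v 1, v 2, v 3}" and n: "n < 6"
  obtains A c where "\<And>x. line_form n (barycentric v x) = A \<bullet> x + c"
proof -
  obtain A c where A: "\<And>x i. barycentric v x i = A i \<bullet> x + c i" using bary_affine[OF nc] by blast
  have "\<exists>A c. \<forall>x. line_form n (barycentric v x) = A \<bullet> x + c"
    using n
  proof (cases rule: less_6_cases)
    case 1
    have "\<forall>x. line_form n (barycentric v x) = (A 1 - A 2 - A 3) \<bullet> x + (c 1 - c 2 - c 3)"
      unfolding 1 by (simp add: A inner_diff_left)
    then show ?thesis by blast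
  next
    case 2
    have "\<forall>x. line_form n (barycentric v x) = (A 2 - A 1 - A 3) \<bullet> x + (c 2 - c 1 - c 3)"
      unfolding 2 by (simp add: A inner_diff_left)
    then show ?thesis by blast
  next
    case 3
    have "\<forall>x. line_form n (barycentric v x) = (A 3 - A 1 - A 2) \<bullet> x + (c 3 - c 1 - c 2)"
      unfolding 3 by (simp add: A inner_diff_left)
    then show ?thesis by blast
  next
    case 4
    have "\<forall>x. line_form n (barycentric v x) = (A 1 - A 2) \<bullet> x + (c 1 - c 2)"
      unfolding 4 by (simp add: A inner_diff_left)
    then show ?thesis by blast
  next
    case 5
    have "\<forall>x. line_form n (barycentric v x) = (A 1 - A 3) \<bullet> x + (c 1 - c 3)"
      unfolding 5 by (simp add: A inner_diff_left)
    then show ?thesis by blast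
  next
    case 6
    have "\<forall>x. line_form n (barycentric v x) = (A 2 - A 3) \<bullet> x + (c 2 - c 3)"
      unfolding 6 by (simp add: A inner_diff_left)
    then show ?thesis by blast
  qed
  then show ?thesis using that by blast
qed

lemma segment_in_ps_segments:
  assumes "p \<in> set (ps_points v)" "q \<in> set (ps_points v)" "x = (1 - u) *\<^sub>R p + u *\<^sub>R q" "0 \<le> u" "u \<le> 1"
  shows "x \<in> ps_segments v"
  using assms unfolding ps_segments_def in_segment(1)[abs_def] closed_segment_def by blast

lemma line_in_ps_segments:
  assumes nc: "\<not> collinear {v 1, v 2, v 3}" and n: "n < 6"
    and x: "x \<in> triangle_of v" and z: "line_form n (barycentric v x) = 0"
  shows "x \<in> ps_segments v"
proof -
  define b where "b = barycentric v x"
  have b0: "0 \<le> b 1" "0 \<le> b 2" "0 \<le> b 3" using x mem_triangle_iff[OF nc] by (simp_all add: b_def)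
  have bs: "b 1 + b 2 + b 3 = 1" using bary_sum[OF nc] by (simp add: b_def)
  have bx: "x = b 1 *\<^sub>R v 1 + b 2 *\<^sub>R v 2 + b 3 *\<^sub>R v 3" using bary_comb[OF nc] by (simp add: b_def)
  note z = z[folded b_def]
  let ?m = "\<lambda>i j. midpoint (v i) (v j)"
  from n show ?thesis
  proof (cases rule: less_6_cases)
    case 1
    then have e: "b 1 = 1/2" "b 2 = 1/2 - b 3" using z bs by auto
    show ?thesis
      by (rule segment_in_ps_segments[where p = "?m 1 2" and q = "?m 1 3" and u = "2 * b 3"])
         (use b0 in \<open>simp_all add: ps_points_def bx e vec2_eq_iff midpoint_def field_simps\<close>)
  next
    case 2
    then have e: "b 2 = 1/2" "b 1 = 1/2 - b 3" using z bs by auto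
    show ?thesis
      by (rule segment_in_ps_segments[where p = "?m 1 2" and q = "?m 2 3" and u = "2 * b 3"])
         (use b0 in \<open>simp_all add: ps_points_def bx e vec2_eq_iff midpoint_def field_simps\<close>)
  next
    case 3
    then have e: "b 3 = 1/2" "b 1 = 1/2 - b 2" using z bs by auto
    show ?thesis
      by (rule segment_in_ps_segments[where p = "?m 1 3" and q = "?m 2 3" and u = "2 * b 2"])
         (use b0 in \<open>simp_all add: ps_points_def bx e vec2_eq_iff midpoint_def field_simps\<close>)
  next
    case 4
    then have e: "b 1 = b 2" "b 3 = 1 - 2 * b 2" using z bs by auto
    show ?thesis
      by (rule segment_in_ps_segments[where p = "v 3" and q = "?m 1 2" and u = "2 * b 2"])
         (use b0 e(2) in \<open>simp_all add: ps_points_def bx e vec2_eq_iff midpoint_def field_simps\<close>)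
  next
    case 5
    then have e: "b 1 = b 3" "b 2 = 1 - 2 * b 3" using z bs by auto
    show ?thesis
      by (rule segment_in_ps_segments[where p = "v 2" and q = "?m 1 3" and u = "2 * b 3"])
         (use b0 e(2) in \<open>simp_all add: ps_points_def bx e vec2_eq_iff midpoint_def field_simps\<close>)
  next
    case 6
    then have e: "b 2 = b 3" "b 1 = 1 - 2 * b 3" using z bs by auto
    show ?thesis
      by (rule segment_in_ps_segments[where p = "v 1" and q = "?m 2 3" and u = "2 * b 3"])
         (use b0 e(2) in \<open>simp_all add: ps_points_def bx e vec2_eq_iff midpoint_def field_simps\<close>)
  qed
qed

text \<open>Every segment between two of the six points lies on one of the six lines or on a side of the triangle; all
pairs are checked through the coordinates of their endpoints.\<close>

lemma ps_segments_on_lines: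
  assumes nc: "\<not> collinear {v 1, v 2, v 3}" and x: "x \<in> ps_segments v"
  shows "(\<exists>n<6. line_form n (barycentric v x) = 0) \<or> (\<exists>i. barycentric v x i = 0)"
proof -
  obtain p q where pq: "p \<in> set (ps_points v)" "q \<in> set (ps_points v)" "x \<in> closed_segment p q"
    using x by (auto simp: ps_segments_def)
  obtain i j where ij: "i < 6" "j < 6" "p = ps_points v ! i" "q = ps_points v ! j"
  proof -
    have "length (ps_points v) = 6" by (simp add: ps_points_def)
    then show ?thesis using pq(1,2) that unfolding in_set_conv_nth by auto
  qed
  obtain u where u: "x = (1 - u) *\<^sub>R p + u *\<^sub>R q" using pq(3) by (auto simp: closed_segment_def)
  have "bary3 v x = (1 - u) *\<^sub>R bary3 v p + u *\<^sub>R bary3 v q"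
    unfolding u bary3_def bary_convex_comb[OF nc] by simp
  then have B: "bary3 v x = (1 - u) *\<^sub>R knot_coords ! i + u *\<^sub>R knot_coords ! j"
    unfolding ij bary3_ps_points[OF nc ij(1)] bary3_ps_points[OF nc ij(2)] .
  define b1 b2 b3 where "b1 = barycentric v x 1" and "b2 = barycentric v x 2" and "b3 = barycentric v x 3"
  have d: "b1 = b2 + b3 \<or> b2 = b1 + b3 \<or> b3 = b1 + b2 \<or> b1 = b2 \<or> b1 = b3 \<or> b2 = b3 \<or> b1 = 0 \<or> b2 = 0 \<or> b3 = 0"
    using ij(1)
  proof (cases rule: less_6_cases)
    case 1
    show ?thesis using ij(2)
      by (cases rule: less_6_cases) (use B 1 in \<open>simp_all add: bary3_def b1_def b2_def b3_def knot_coords_def field_simps\<close>)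
  next
    case 2
    show ?thesis using ij(2)
      by (cases rule: less_6_cases) (use B 2 in \<open>simp_all add: bary3_def b1_def b2_def b3_def knot_coords_def field_simps\<close>)
  next
    case 3
    show ?thesis using ij(2)
      by (cases rule: less_6_cases) (use B 3 in \<open>simp_all add: bary3_def b1_def b2_def b3_def knot_coords_def field_simps\<close>)
  next
    case 4
    show ?thesis using ij(2)
      by (cases rule: less_6_cases) (use B 4 in \<open>simp_all add: bary3_def b1_def b2_def b3_def knot_coords_def field_simps\<close>)
  next
    case 5
    show ?thesis using ij(2)
      by (cases rule: less_6_cases) (use B 5 in \<open>simp_all add: bary3_def b1_def b2_def b3_def knot_coords_def field_simps\<close>)
  next
    case 6
    show ?thesis using ij(2)
      by (cases rule: less_6_cases) (use B 6 in \<open>simp_all add: bary3_def b1_def b2_def b3_def knot_coords_def field_simps\<close>)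
  qed
  have *: ?thesis if "n < 6" "line_form n (barycentric v x) = 0" for n using that by blast
  have **: ?thesis if "barycentric v x i = 0" for i using that by blast
  note b = b1_def b2_def b3_def
  show ?thesis
    using d
    by (elim disjE)
       (rule *[of 0], simp, simp add: b, rule *[of "Suc 0"], simp, simp add: b, rule *[of 2], simp, simp add: b,
        rule *[of 3], simp, simp add: b, rule *[of 4], simp, simp add: b, rule *[of 5], simp, simp add: b,
        rule **[of 1], simp add: b, rule **[of 2], simp add: b, rule **[of 3], simp add: b)
qed

text \<open>A component of the complement of the segments is connected and avoids the line, so the form has constant
sign on it; closures preserve the weak inequality. Hence truncated powers are polynomial on each cell.\<close>

lemma line_form_sign_on_cell:
  assumes nc: "\<not> collinear {v 1, v 2, v 3}" and n: "n < 6" and \<Delta>: "\<Delta> \<in> ps12_split v"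
  shows "(\<forall>x\<in>\<Delta>. 0 \<le> line_form n (barycentric v x)) \<or> (\<forall>x\<in>\<Delta>. line_form n (barycentric v x) \<le> 0)"
proof -
  obtain C where C: "C \<in> components (triangle_of v - ps_segments v)" "\<Delta> = closure C"
    using \<Delta> by (auto simp: ps12_split_def)
  obtain A c where A: "\<And>x. line_form n (barycentric v x) = A \<bullet> x + c" using line_form_affine[OF nc n] by blast
  have sub: "C \<subseteq> triangle_of v - ps_segments v" and con: "connected C"
    using C(1) in_components_subset in_components_connected by blast+
  have nz: "A \<bullet> x + c \<noteq> 0" if "x \<in> C" for x
    using line_in_ps_segments[OF nc n] sub that A by fastforce
  have cont: "continuous_on S (\<lambda>x. A \<bullet> x + c)" for S by (intro continuous_intros)
  have "connected ((\<lambda>x. A \<bullet> x + c) ` C)" using con cont by (rule connected_continuous_image[rotated])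
  then have "(\<forall>x\<in>C. 0 \<le> A \<bullet> x + c) \<or> (\<forall>x\<in>C. A \<bullet> x + c \<le> 0)"
    using nz unfolding connected_iff_interval by (smt (verit) imageE imageI)
  then show ?thesis
  proof
    assume "\<forall>x\<in>C. 0 \<le> A \<bullet> x + c"
    then have "C \<subseteq> {x. 0 \<le> A \<bullet> x + c}" by blast
    moreover have "closed {x. 0 \<le> A \<bullet> x + c}" by (intro closed_Collect_le continuous_intros)
    ultimately have "closure C \<subseteq> {x. 0 \<le> A \<bullet> x + c}" by (rule closure_minimal)
    then show ?thesis unfolding A C(2) by blast
  next
    assume "\<forall>x\<in>C. A \<bullet> x + c \<le> 0"
    then have "C \<subseteq> {x. A \<bullet> x + c \<le> 0}" by blast
    moreover have "closed {x. A \<bullet> x + c \<le> 0}" by (intro closed_Collect_le continuous_intros)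
    ultimately have "closure C \<subseteq> {x. A \<bullet> x + c \<le> 0}" by (rule closure_minimal)
    then show ?thesis unfolding A C(2) by blast
  qed
qed

lemma cell_subset_triangle:
  assumes "\<Delta> \<in> ps12_split v" shows "\<Delta> \<subseteq> triangle_of v"
proof -
  obtain C where C: "C \<in> components (triangle_of v - ps_segments v)" "\<Delta> = closure C"
    using assms by (auto simp: ps12_split_def)
  have "C \<subseteq> triangle_of v" using in_components_subset[OF C(1)] by blast
  moreover have "closed (triangle_of v)"
    unfolding triangle_of_def by (intro compact_imp_closed compact_convex_hull finite_imp_compact) simp
  ultimately show ?thesis unfolding C(2) by (rule closure_minimal)
qed

lemma subspace_spline_space: "subspace (spline_space r d v)"
proof (rule subspaceI)
  show "0 \<in> spline_space r d v"
    by (auto simp: spline_space_def zero_fun_def Ck_on_const intro!: exI[of _ "\<lambda>_. 0"] is_poly2_const)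
next
  fix f g assume f: "f \<in> spline_space r d v" and g: "g \<in> spline_space r d v"
  have "\<exists>p. is_poly2 d p \<and> (\<forall>x\<in>\<Delta>. (f + g) x = p x)" if "\<Delta> \<in> ps12_split v" for \<Delta>
  proof -
    obtain p q where pq: "is_poly2 d p" "\<forall>x\<in>\<Delta>. f x = p x" "is_poly2 d q" "\<forall>x\<in>\<Delta>. g x = q x"
      using f g \<open>\<Delta> \<in> _\<close> unfolding spline_space_def by blast
    then show ?thesis by (intro exI[of _ "\<lambda>x. p x + q x"]) (simp add: is_poly2_add)
  qed
  moreover have "Ck_on r (triangle_of v) (f + g)"
    using Ck_on_add[of r "triangle_of v" f g] f g by (simp add: spline_space_def plus_fun_def)
  ultimately show "f + g \<in> spline_space r d v" using f g by (simp add: spline_space_def)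
next
  fix c and f assume f: "f \<in> spline_space r d v"
  have "\<exists>p. is_poly2 d p \<and> (\<forall>x\<in>\<Delta>. (c *\<^sub>R f) x = p x)" if "\<Delta> \<in> ps12_split v" for \<Delta>
  proof -
    obtain p where p: "is_poly2 d p" "\<forall>x\<in>\<Delta>. f x = p x"
      using f \<open>\<Delta> \<in> _\<close> unfolding spline_space_def by blast
    then show ?thesis by (intro exI[of _ "\<lambda>x. c * p x"]) (simp add: is_poly2_cmult scaleR_fun_def)
  qed
  moreover have "Ck_on r (triangle_of v) (c *\<^sub>R f)"
    using Ck_on_mult[OF Ck_on_const, of r "triangle_of v" f c] f by (simp add: spline_space_def scaleR_fun_def)
  ultimately show "c *\<^sub>R f \<in> spline_space r d v" using f by (simp add: spline_space_def scaleR_fun_def)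
qed

lemma is_poly2_bary:
  assumes nc: "\<not> collinear {v 1, v 2, v 3}"
  shows "is_poly2 1 (\<lambda>x. barycentric v x i)"
proof -
  obtain A c where "\<And>x i. barycentric v x i = A i \<bullet> x + c i" using bary_affine[OF nc] by blast
  then show ?thesis using is_poly2_affine by (simp only:)
qed

definition gen_mono :: "nat \<Rightarrow> nat \<Rightarrow> (3 \<Rightarrow> real) \<Rightarrow> real" where
  "gen_mono i j b = b 1 ^ i * b 2 ^ j"

definition gen_trunc :: "nat \<Rightarrow> 3 \<Rightarrow> (3 \<Rightarrow> real) \<Rightarrow> real" where
  "gen_trunc n k b = b k * tpow 4 (line_form n b)"

lemma gen_mono_in_space:
  assumes nc: "\<not> collinear {v 1, v 2, v 3}" and ij: "i + j \<le> d"
  shows "on_triangle v (gen_mono i j) \<in> spline_space r d v"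
proof -
  have "is_poly2 (1 * i + 1 * j) (\<lambda>x. barycentric v x 1 ^ i * barycentric v x 2 ^ j)"
    by (intro is_poly2_mult is_poly2_power is_poly2_bary nc)
  then have p: "is_poly2 d (\<lambda>x. gen_mono i j (barycentric v x))"
    unfolding gen_mono_def by (rule is_poly2_mono) (use ij in simp)
  have "Ck_on r (triangle_of v) (on_triangle v (gen_mono i j))"
    by (rule Ck_on_cong[OF _ Ck_on_is_poly2[OF p]]) (simp add: on_triangle_def)
  moreover have "\<forall>\<Delta>\<in>ps12_split v. \<forall>x\<in>\<Delta>. on_triangle v (gen_mono i j) x = gen_mono i j (barycentric v x)"
    using cell_subset_triangle by (auto simp: on_triangle_def)
  ultimately show ?thesis using p unfolding spline_space_def by (auto simp: on_triangle_def)
qed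

lemma gen_trunc_in_space:
  assumes nc: "\<not> collinear {v 1, v 2, v 3}" and n: "n < 6"
  shows "on_triangle v (gen_trunc n k) \<in> spline_space 3 5 v"
proof -
  obtain A c where A: "\<And>x. line_form n (barycentric v x) = A \<bullet> x + c" using line_form_affine[OF nc n] by blast
  have "Ck_on 3 (triangle_of v) (\<lambda>x. tpow (Suc 3) (A \<bullet> x + c))" by (rule Ck_on_tpow)
  then have "Ck_on 3 (triangle_of v) (\<lambda>x. barycentric v x k * tpow (Suc 3) (A \<bullet> x + c))"
    by (intro Ck_on_mult Ck_on_is_poly2[OF is_poly2_bary[OF nc]])
  then have "Ck_on 3 (triangle_of v) (on_triangle v (gen_trunc n k))"
    by (rule Ck_on_cong[rotated]) (simp add: on_triangle_def gen_trunc_def A)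
  moreover have "\<exists>p. is_poly2 5 p \<and> (\<forall>x\<in>\<Delta>. on_triangle v (gen_trunc n k) x = p x)" if \<Delta>: "\<Delta> \<in> ps12_split v" for \<Delta>
  proof -
    have T: "x \<in> \<Delta> \<Longrightarrow> x \<in> triangle_of v" for x using cell_subset_triangle[OF \<Delta>] by blast
    have "is_poly2 (1 + 1 * 4) (\<lambda>x. barycentric v x k * (A \<bullet> x + c) ^ 4)"
      by (intro is_poly2_mult is_poly2_power is_poly2_affine is_poly2_bary nc)
    then have p: "is_poly2 5 (\<lambda>x. barycentric v x k * (A \<bullet> x + c) ^ 4)" by simp
    from line_form_sign_on_cell[OF nc n \<Delta>] show ?thesis
    proof
      assume "\<forall>x\<in>\<Delta>. 0 \<le> line_form n (barycentric v x)"
      then have "\<forall>x\<in>\<Delta>. on_triangle v (gen_trunc n k) x = barycentric v x k * (A \<bullet> x + c) ^ 4"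
        using T by (auto simp: on_triangle_def gen_trunc_def A tpow_nonneg)
      then show ?thesis using p by blast
    next
      assume "\<forall>x\<in>\<Delta>. line_form n (barycentric v x) \<le> 0"
      then have "\<forall>x\<in>\<Delta>. on_triangle v (gen_trunc n k) x = 0"
        using T by (auto simp: on_triangle_def gen_trunc_def A tpow_nonpos)
      then show ?thesis using is_poly2_const by blast
    qed
  qed
  ultimately show ?thesis unfolding spline_space_def by (auto simp: on_triangle_def)
qed

section \<open>Jumps of smooth piecewise polynomials across a line\<close>

text \<open>Smoothness within the triangle restricts to smoothness within a segment, by the chain rule.\<close>

lemma Ck_on_line:
  fixes f :: "real^2 \<Rightarrow> real" and S :: "real set"
  assumes "Ck_on k T f" and "\<And>t. t \<in> S \<Longrightarrow> x0 + t *\<^sub>R d \<in> T"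
  shows "Ck_on k S (\<lambda>t. f (x0 + t *\<^sub>R d))"
  using assms
proof (induction k arbitrary: f)
  case 0
  have "continuous_on S (\<lambda>t. x0 + t *\<^sub>R d)" by (intro continuous_intros)
  then show ?case using 0 by (auto intro: continuous_on_compose2)
next
  case (Suc k)
  obtain f' where "\<forall>x\<in>T. (f has_derivative f' x) (at x within T)" "\<forall>b\<in>Basis. Ck_on k T (\<lambda>x. f' x b)"
    using Suc.prems(1) by auto
  then have f': "\<And>x. x \<in> T \<Longrightarrow> (f has_derivative f' x) (at x within T)"
    "\<And>b. b \<in> Basis \<Longrightarrow> Ck_on k T (\<lambda>x. f' x b)" by auto
  let ?h = "\<lambda>t. x0 + t *\<^sub>R d"
  have "((\<lambda>t. f (?h t)) has_derivative (\<lambda>s. f' (?h t) (s *\<^sub>R d))) (at t within S)" if t: "t \<in> S" for t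
  proof -
    have "(?h has_derivative (\<lambda>s. s *\<^sub>R d)) (at t within S)"
      by (auto intro!: derivative_eq_intros)
    moreover have "(f has_derivative f' (?h t)) (at (?h t) within ?h ` S)"
      by (rule has_derivative_subset[OF f'(1)[OF Suc.prems(2)[OF t]]]) (use Suc.prems(2) in auto)
    ultimately show ?thesis by (rule has_derivative_in_compose)
  qed
  moreover have "Ck_on k S (\<lambda>t. f' (?h t) (1 *\<^sub>R d))"
  proof (rule Ck_on_cong)
    show "(\<Sum>b\<in>Basis. (d \<bullet> b) * f' (?h t) b) = f' (?h t) (1 *\<^sub>R d)" if t: "t \<in> S" for t
    proof -
      have lin: "linear (f' (?h t))" using f'(1)[OF Suc.prems(2)[OF t]] has_derivative_linear by blast
      have "f' (?h t) d = f' (?h t) (\<Sum>b\<in>Basis. (d \<bullet> b) *\<^sub>R b)" by (simp add: euclidean_representation)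
      also have "\<dots> = (\<Sum>b\<in>Basis. (d \<bullet> b) * f' (?h t) b)"
        by (simp add: linear_sum[OF lin] linear_cmul[OF lin])
      finally show ?thesis by simp
    qed
    show "Ck_on k S (\<lambda>t. \<Sum>b\<in>Basis. (d \<bullet> b) * f' (?h t) b)"
      by (intro Ck_on_sum Ck_on_mult Ck_on_const Suc.IH f'(2) Suc.prems(2))
  qed
  ultimately show ?case
    unfolding Ck_on.simps(2)[of k] by (intro exI[of _ "\<lambda>t s. f' (?h t) (s *\<^sub>R d)"]) simp
qed

lemma derivative_on_halfopen:
  fixes g :: "real \<Rightarrow> real"
  assumes "(g has_derivative g') (at t within S)" "{a..b} \<subseteq> S" "a < b" "t \<in> {a..b}"
    and "\<And>s. s \<in> {a..b} \<Longrightarrow> g s = poly r s"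
  shows "g' 1 = poly (pderiv r) t"
proof -
  have lin: "linear g'" using assms(1) has_derivative_linear by blast
  have "g' s = s *\<^sub>R g' 1" for s using linear_cmul[OF lin, of s 1] by simp
  then have gv: "g' = (\<lambda>s. s *\<^sub>R g' 1)" by (rule ext)
  have "(g has_derivative g') (at t within {a..b})" using has_derivative_subset[OF assms(1,2)] .
  then have "(g has_vector_derivative g' 1) (at t within {a..b})"
    unfolding has_vector_derivative_def using gv by simp
  moreover have "(g has_vector_derivative poly (pderiv r) t) (at t within {a..b})"
  proof -
    have "(poly r has_vector_derivative poly (pderiv r) t) (at t within {a..b})"
      using poly_DERIV[of r t] by (simp add: has_real_derivative_iff_has_vector_derivative has_vector_derivative_at_within)
    then show ?thesis
      by (rule has_vector_derivative_transform[OF assms(4), rotated]) (use assms(5) in auto)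
  qed
  ultimately show ?thesis
    using vector_derivative_unique_within_closed_interval[of a b t g "g' 1" "poly (pderiv r) t"] assms(3,4)
    by auto
qed

text \<open>At the junction both polynomials have the derivatives of \<open>g\<close> up to order \<open>k\<close>, that is, the same
coefficients up to \<open>k\<close>. The induction differentiates both sides.\<close>

lemma Ck_on_glue_coeffs:
  fixes g :: "real \<Rightarrow> real"
  assumes "Ck_on k {-\<epsilon><..<\<epsilon>} g" "0 < \<epsilon>"
    and "\<And>t. 0 \<le> t \<Longrightarrow> t < \<epsilon> \<Longrightarrow> g t = poly p t"
    and "\<And>t. -\<epsilon> < t \<Longrightarrow> t \<le> 0 \<Longrightarrow> g t = poly q t"
    and "i \<le> k"
  shows "coeff p i = coeff q i"
  using assms
proof (induction k arbitrary: g p q i)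
  case 0
  have "poly p 0 = poly q 0" using 0(2) 0(3)[of 0] 0(4)[of 0] by simp
  then show ?case using 0(5) by (simp add: poly_0_coeff_0)
next
  case (Suc k)
  have c0: "coeff p 0 = coeff q 0"
    using Suc.prems(2) Suc.prems(3)[of 0] Suc.prems(4)[of 0] by (simp add: poly_0_coeff_0)
  show ?case
  proof (cases i)
    case 0
    then show ?thesis using c0 by simp
  next
    case (Suc j)
    let ?S = "{-\<epsilon><..<\<epsilon>}"
    obtain g' where "\<forall>t\<in>?S. (g has_derivative g' t) (at t within ?S)" and g'1: "Ck_on k ?S (\<lambda>t. g' t 1)"
      using Suc.prems(1) by auto
    then have g': "\<And>t. t \<in> ?S \<Longrightarrow> (g has_derivative g' t) (at t within ?S)" by blast
    have "g' t 1 = poly (pderiv p) t" if t: "0 \<le> t" "t < \<epsilon>" for t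
    proof (rule derivative_on_halfopen)
      show "(g has_derivative g' t) (at t within ?S)" using t by (intro g') auto
      show "{0..(t + \<epsilon>) / 2} \<subseteq> ?S" using t by auto
    qed (use t Suc.prems(3) in auto)
    moreover have "g' t 1 = poly (pderiv q) t" if t: "-\<epsilon> < t" "t \<le> 0" for t
    proof (rule derivative_on_halfopen)
      show "(g has_derivative g' t) (at t within ?S)" using t by (intro g') auto
      show "{(t - \<epsilon>) / 2..0} \<subseteq> ?S" using t by auto
    qed (use t Suc.prems(4) in auto)
    ultimately have "coeff (pderiv p) j = coeff (pderiv q) j"
      using Suc.IH[OF g'1 Suc.prems(2)] Suc Suc.prems(5) by simp
    then show ?thesis using Suc by (simp add: coeff_pderiv)
  qed
qed

lemma is_poly2_compose_affine:
  fixes x0 d1 d2 :: "real^2"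
  assumes "is_poly2 d p"
  shows "is_poly2 d (\<lambda>y. p (x0 + y $ 1 *\<^sub>R d1 + y $ 2 *\<^sub>R d2))"
proof -
  obtain a :: "nat \<Rightarrow> nat \<Rightarrow> real" where p: "\<And>x. p x = (\<Sum>i\<le>d. \<Sum>j\<le>d - i. a i j * (x $ 1) ^ i * (x $ 2) ^ j)"
    using assms unfolding is_poly2_def by blast
  have co: "is_poly2 1 (\<lambda>y. (x0 + y $ 1 *\<^sub>R d1 + y $ 2 *\<^sub>R d2) $ k)" for k
  proof -
    have "is_poly2 1 (\<lambda>y. x0 $ k + (d1 $ k * y $ 1 + d2 $ k * y $ 2))"
      by (intro is_poly2_add is_poly2_const is_poly2_cmult is_poly2_coord)
    then show ?thesis by (simp only: vector_add_component vector_scaleR_component mult.commute add.assoc real_scaleR_def)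
  qed
  have "is_poly2 d (\<lambda>y. a i j * (x0 + y $ 1 *\<^sub>R d1 + y $ 2 *\<^sub>R d2) $ 1 ^ i * (x0 + y $ 1 *\<^sub>R d1 + y $ 2 *\<^sub>R d2) $ 2 ^ j)"
    if "i \<le> d" "j \<le> d - i" for i j
  proof -
    have "is_poly2 (1 * i + 1 * j) (\<lambda>y. (a i j * (x0 + y $ 1 *\<^sub>R d1 + y $ 2 *\<^sub>R d2) $ 1 ^ i) * (x0 + y $ 1 *\<^sub>R d1 + y $ 2 *\<^sub>R d2) $ 2 ^ j)"
      by (intro is_poly2_mult is_poly2_cmult is_poly2_power co)
    then show ?thesis by (rule is_poly2_mono) (use that in simp)
  qed
  then show ?thesis unfolding p by (intro is_poly2_sum) auto
qed

text \<open>In the chart \<open>X t w\<close>, where \<open>t = 0\<close> is the common edge, comparing derivatives in \<open>t\<close> for all \<open>w\<close> in an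
interval shows that \<open>p - q\<close> is divisible by \<open>t ^ 4\<close>. As its degree is at most 5, the quotient is linear.\<close>

lemma jump_across_line:
  fixes x0 d1 d2 :: "real^2" and f p q :: "real^2 \<Rightarrow> real"
  defines "X \<equiv> (\<lambda>t w. x0 + t *\<^sub>R d1 + w *\<^sub>R d2)"
  assumes f: "Ck_on 3 T f" and p: "is_poly2 5 p" and q: "is_poly2 5 q"
    and fp: "\<And>x. x \<in> closure U \<Longrightarrow> f x = p x" and fq: "\<And>x. x \<in> closure W \<Longrightarrow> f x = q x"
    and UT: "closure U \<subseteq> T" and WT: "closure W \<subseteq> T"
    and \<epsilon>: "0 < \<epsilon>" and w01: "w0 < w1"
    and U: "\<And>t w. w0 < w \<Longrightarrow> w < w1 \<Longrightarrow> 0 < t \<Longrightarrow> t < \<epsilon> \<Longrightarrow> X t w \<in> U"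
    and W: "\<And>t w. w0 < w \<Longrightarrow> w < w1 \<Longrightarrow> 0 < t \<Longrightarrow> t < \<epsilon> \<Longrightarrow> X (- t) w \<in> W"
  shows "\<exists>c0 c1 c2. \<forall>t w. p (X t w) - q (X t w) = t ^ 4 * (c0 + c1 * t + c2 * w)"
proof -
  have ex: "\<exists>a :: nat \<Rightarrow> nat \<Rightarrow> real. \<forall>t w. r (X t w) = (\<Sum>i\<le>5. \<Sum>j\<le>5 - i. a i j * t ^ i * w ^ j)"
    if r: "is_poly2 5 r" for r
  proof -
    obtain a :: "nat \<Rightarrow> nat \<Rightarrow> real" where a: "\<And>y :: real^2. r (x0 + y $ 1 *\<^sub>R d1 + y $ 2 *\<^sub>R d2)
        = (\<Sum>i\<le>5. \<Sum>j\<le>5 - i. a i j * (y $ 1) ^ i * (y $ 2) ^ j)"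
      using is_poly2_compose_affine[OF r, of x0 d1 d2] unfolding is_poly2_def by blast
    have "r (X t w) = (\<Sum>i\<le>5. \<Sum>j\<le>5 - i. a i j * t ^ i * w ^ j)" for t w
      using a[of "vector [t, w]"] by (simp add: X_def)
    then show ?thesis by blast
  qed
  obtain a where a: "\<And>t w. p (X t w) = (\<Sum>i\<le>5. \<Sum>j\<le>5 - i. a i j * t ^ i * w ^ j)" using ex[OF p] by blast
  obtain b where b: "\<And>t w. q (X t w) = (\<Sum>i\<le>5. \<Sum>j\<le>5 - i. b i j * t ^ i * w ^ j)" using ex[OF q] by blast
  define R where "R = (\<lambda>a w. \<Sum>i\<le>5. monom (\<Sum>j\<le>5 - i. a i j * w ^ j) i :: real poly)"
  have polyR: "poly (R a w) t = (\<Sum>i\<le>5. \<Sum>j\<le>5 - i. a i j * t ^ i * w ^ j)" for a w t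
    by (simp add: R_def poly_sum poly_monom sum_distrib_right sum_distrib_left mult_ac)
  have coeffR: "coeff (R a w) i = (\<Sum>j\<le>5 - i. a i j * w ^ j)" if "i \<le> 5" for a w i
    using that by (simp add: R_def coeff_sum)
  have eq: "(\<Sum>j\<le>5 - i. a i j * w ^ j) = (\<Sum>j\<le>5 - i. b i j * w ^ j)" if w: "w0 < w" "w < w1" and i: "i \<le> 3" for w i
  proof -
    have Xc: "continuous_on S (\<lambda>t. X t w)" for S unfolding X_def by (intro continuous_intros)
    have Xm: "continuous_on S (\<lambda>t. X (- t) w)" for S unfolding X_def by (intro continuous_intros)
    have cl: "closure {0<..<\<epsilon>} = {0..\<epsilon>}" using \<epsilon> by simp
    have Ucl: "X t w \<in> closure U" if "0 \<le> t" "t < \<epsilon>" for t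
    proof -
      have "(\<lambda>t. X t w) ` {0<..<\<epsilon>} \<subseteq> closure U"
        using U[OF w] closure_subset[of U] by force
      then have "(\<lambda>t. X t w) ` closure {0<..<\<epsilon>} \<subseteq> closure U"
        by (rule image_closure_subset[OF Xc closed_closure])
      moreover have "t \<in> closure {0<..<\<epsilon>}" unfolding cl using that by simp
      ultimately show ?thesis by (rule subsetD[OF _ imageI])
    qed
    have Wcl: "X (- t) w \<in> closure W" if "0 \<le> t" "t < \<epsilon>" for t
    proof -
      have "(\<lambda>t. X (- t) w) ` {0<..<\<epsilon>} \<subseteq> closure W"
        using W[OF w] closure_subset[of W] by force
      then have "(\<lambda>t. X (- t) w) ` closure {0<..<\<epsilon>} \<subseteq> closure W"
        by (rule image_closure_subset[OF Xm closed_closure])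
      moreover have "t \<in> closure {0<..<\<epsilon>}" unfolding cl using that by simp
      ultimately show ?thesis by (rule subsetD[OF _ imageI])
    qed
    have Wcl': "X t w \<in> closure W" if "- \<epsilon> < t" "t \<le> 0" for t
      using Wcl[of "- t"] that by simp
    have "Ck_on 3 {-\<epsilon><..<\<epsilon>} (\<lambda>t. f ((x0 + w *\<^sub>R d2) + t *\<^sub>R d1))"
    proof (rule Ck_on_line[OF f])
      fix t assume t: "t \<in> {-\<epsilon><..<\<epsilon>}"
      have "X t w \<in> T"
        by (cases "0 \<le> t") (use t Ucl[of t] Wcl'[of t] UT WT in auto)
      then show "(x0 + w *\<^sub>R d2) + t *\<^sub>R d1 \<in> T" by (simp add: X_def algebra_simps)
    qed
    then have C: "Ck_on 3 {-\<epsilon><..<\<epsilon>} (\<lambda>t. f (X t w))" by (simp add: X_def algebra_simps)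
    have "coeff (R a w) i = coeff (R b w) i"
    proof (rule Ck_on_glue_coeffs[OF C \<epsilon> _ _ i])
      show "f (X t w) = poly (R a w) t" if "0 \<le> t" "t < \<epsilon>" for t
        using fp[OF Ucl[OF that]] a polyR by simp
      show "f (X t w) = poly (R b w) t" if "- \<epsilon> < t" "t \<le> 0" for t
        using fq[OF Wcl'[OF that]] b polyR by simp
    qed
    then show ?thesis using coeffR[of i] i by simp
  qed
  have ab: "a i j = b i j" if i: "i \<le> 3" and j: "j \<le> 5 - i" for i j
  proof -
    have "infinite {w0<..<w1}" using w01 by simp
    then have "infinite {w. (\<Sum>j\<le>5 - i. (a i j - b i j) * w ^ j) = 0}"
      by (rule infinite_super[rotated]) (use eq[OF _ _ i] in \<open>auto simp: left_diff_distrib sum_subtractf\<close>)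
    then have "\<forall>j\<le>5 - i. a i j - b i j = 0"
      using polyfun_roots_finite[of "\<lambda>j. a i j - b i j" _ "5 - i"] by blast
    then show ?thesis using j by simp
  qed
  have "p (X t w) - q (X t w) = t ^ 4 * ((a 4 0 - b 4 0) + (a 5 0 - b 5 0) * t + (a 4 1 - b 4 1) * w)" for t w
  proof -
    have "p (X t w) - q (X t w) = (\<Sum>i\<le>5. \<Sum>j\<le>5 - i. (a i j - b i j) * t ^ i * w ^ j)"
      unfolding a b by (simp add: sum_subtractf left_diff_distrib)
    also have "\<dots> = (\<Sum>i\<in>{4, 5}. \<Sum>j\<le>5 - i. (a i j - b i j) * t ^ i * w ^ j)"
    proof (rule sum.mono_neutral_right)
      show "\<forall>i\<in>{..5} - {4, 5}. (\<Sum>j\<le>5 - i. (a i j - b i j) * t ^ i * w ^ j) = 0"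
      proof
        fix i assume "i \<in> {..5} - {4, 5 :: nat}"
        then have "i \<le> 3" by auto
        then show "(\<Sum>j\<le>5 - i. (a i j - b i j) * t ^ i * w ^ j) = 0" using ab by (intro sum.neutral) simp
      qed
    qed auto
    also have "\<dots> = t ^ 4 * ((a 4 0 - b 4 0) + (a 5 0 - b 5 0) * t + (a 4 1 - b 4 1) * w)"
    proof -
      have "{..Suc 0} = {0, 1::nat}" by auto
      moreover have "t ^ 5 = t ^ 4 * t" by (simp add: eval_nat_numeral)
      ultimately show ?thesis by (simp add: algebra_simps)
    qed
    finally show ?thesis .
  qed
  then show ?thesis by blast
qed

section \<open>The cells of the split\<close>

lemma bary_surj:
  assumes nc: "\<not> collinear {v 1, v 2, v 3}" and "b 1 + b 2 + b 3 = (1::real)"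
  obtains x where "barycentric v x = b"
  using bary_unique[OF nc assms(2) refl] that by blast

lemma distinct3_UNIV:
  assumes "a \<noteq> b" "b \<noteq> c" "a \<noteq> (c::3)"
  shows "UNIV = {a, b, c}"
  by (rule card_subset_eq[symmetric]) (use assms in auto)

lemma distinct3_sum:
  fixes f :: "3 \<Rightarrow> 'a::comm_monoid_add"
  assumes "a \<noteq> b" "b \<noteq> c" "a \<noteq> (c::3)"
  shows "f 1 + f 2 + f 3 = f a + f b + f c"
proof -
  have "sum f UNIV = f a + f b + f c"
    unfolding distinct3_UNIV[OF assms] using assms by (simp add: add.assoc)
  then show ?thesis by (simp add: sum_3)
qed

text \<open>The order \<open>a\<close>, \<open>b\<close>, \<open>c\<close> of the coordinates selects one of the six sectors cut out by the medians; \<open>\<sigma> = 1\<close> is the cell of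
that sector at the vertex \<open>a\<close>, and \<open>\<sigma> = -1\<close> the one inside the medial triangle.\<close>

definition open_cell :: "(3 \<Rightarrow> real^2) \<Rightarrow> 3 \<Rightarrow> 3 \<Rightarrow> 3 \<Rightarrow> real \<Rightarrow> (real^2) set" where
  "open_cell v a b c \<sigma> = (let \<beta> = barycentric v in
     {x. 0 < \<beta> x c \<and> 0 < \<beta> x b - \<beta> x c \<and> 0 < \<beta> x a - \<beta> x b \<and> 0 < \<sigma> * (\<beta> x a - \<beta> x b - \<beta> x c)})"

lemma open_cell_iff: "x \<in> open_cell v a b c \<sigma> \<longleftrightarrow> 0 < barycentric v x c \<and> 0 < barycentric v x b - barycentric v x c
     \<and> 0 < barycentric v x a - barycentric v x b \<and> 0 < \<sigma> * (barycentric v x a - barycentric v x b - barycentric v x c)"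
  by (simp add: open_cell_def Let_def)

lemma convex_open_cell:
  assumes nc: "\<not> collinear {v 1, v 2, v 3}"
  shows "convex (open_cell v a b c \<sigma>)"
proof -
  obtain A k where A: "\<And>x i. barycentric v x i = A i \<bullet> x + k i" using bary_affine[OF nc] by blast
  have h: "convex {x. 0 < B \<bullet> x + d}" for B :: "real^2" and d
  proof -
    have "{x. 0 < B \<bullet> x + d} = {x. - d < B \<bullet> x}" by auto
    then show ?thesis by (simp add: convex_halfspace_gt)
  qed
  have "open_cell v a b c \<sigma> = {x. 0 < A c \<bullet> x + k c} \<inter> {x. 0 < (A b - A c) \<bullet> x + (k b - k c)}
     \<inter> {x. 0 < (A a - A b) \<bullet> x + (k a - k b)} \<inter> {x. 0 < (\<sigma> *\<^sub>R (A a - A b - A c)) \<bullet> x + \<sigma> * (k a - k b - k c)}"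
    by (auto simp: open_cell_iff A inner_diff_left algebra_simps)
  then show ?thesis by (simp only: convex_Int h)
qed

lemma open_cell_avoids_segments:
  assumes nc: "\<not> collinear {v 1, v 2, v 3}" and d: "a \<noteq> b" "b \<noteq> c" "a \<noteq> (c::3)"
  shows "open_cell v a b c \<sigma> \<subseteq> triangle_of v - ps_segments v"
proof
  fix x assume x: "x \<in> open_cell v a b c \<sigma>"
  define \<beta> where "\<beta> = barycentric v x"
  have o: "0 < \<beta> c" "\<beta> c < \<beta> b" "\<beta> b < \<beta> a" "\<beta> a \<noteq> \<beta> b + \<beta> c"
    using x unfolding open_cell_iff \<beta>_def by (auto simp: zero_less_mult_iff)
  have pos: "0 < \<beta> i" for i using distinct3_UNIV[OF d] o by (metis UNIV_I empty_iff insert_iff less_trans)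
  have ne: "\<beta> i \<noteq> \<beta> j" if "i \<noteq> j" for i j
    using distinct3_UNIV[OF d] o that by (smt (verit) UNIV_I empty_iff insert_iff)
  have nh: "\<beta> i \<noteq> \<beta> j + \<beta> k" if "i \<noteq> j" "j \<noteq> k" "i \<noteq> k" for i j k
  proof -
    have "i \<in> {a, b, c}" "j \<in> {a, b, c}" "k \<in> {a, b, c}" using distinct3_UNIV[OF d] by auto
    then show ?thesis using o that by (elim insertE emptyE) auto
  qed
  have "x \<in> triangle_of v" using pos mem_triangle_iff[OF nc] by (simp add: \<beta>_def less_imp_le)
  moreover have "x \<notin> ps_segments v"
  proof
    assume "x \<in> ps_segments v"
    then consider n where "n < 6" "line_form n \<beta> = 0" | i where "\<beta> i = 0"
      using ps_segments_on_lines[OF nc] unfolding \<beta>_def by blast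
    then show False
    proof cases
      case 1
      from 1(1) show False
        by (cases rule: less_6_cases)
           (use 1(2) nh[of 1 2 3] nh[of 2 1 3] nh[of 3 1 2] ne[of 1 2] ne[of 1 3] ne[of 2 3] in auto)
    next
      case 2
      then show False using pos[of i] by simp
    qed
  qed
  ultimately show "x \<in> triangle_of v - ps_segments v" by blast
qed

text \<open>The open cell is connected and avoids all segments, so it lies in a single component of the complement.\<close>

lemma open_cell_poly:
  assumes nc: "\<not> collinear {v 1, v 2, v 3}" and d: "a \<noteq> b" "b \<noteq> c" "a \<noteq> (c::3)"
    and f: "f \<in> spline_space r n v"
  shows "\<exists>p. is_poly2 n p \<and> (\<forall>x\<in>closure (open_cell v a b c \<sigma>). f x = p x)"
proof (cases "open_cell v a b c \<sigma> = {}")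
  case True
  then show ?thesis using is_poly2_const by (intro exI[of _ "\<lambda>_. 0"]) simp
next
  case False
  have sub: "open_cell v a b c \<sigma> \<subseteq> triangle_of v - ps_segments v"
    by (rule open_cell_avoids_segments[OF nc d])
  have "connected (open_cell v a b c \<sigma>)" using convex_open_cell[OF nc] convex_connected by blast
  then obtain C where C: "C \<in> components (triangle_of v - ps_segments v)" "open_cell v a b c \<sigma> \<subseteq> C"
    using exists_component_superset[OF sub] False sub by blast
  then have "closure C \<in> ps12_split v" by (simp add: ps12_split_def)
  then obtain p where "is_poly2 n p" "\<forall>x\<in>closure C. f x = p x"
    using f unfolding spline_space_def by blast
  then show ?thesis using closure_mono[OF C(2)] by blast
qed

lemma closed_cell_subset:
  assumes nc: "\<not> collinear {v 1, v 2, v 3}" and d: "a \<noteq> b" "b \<noteq> c" "a \<noteq> (c::3)"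
  shows "closure (open_cell v a b c \<sigma>) \<subseteq> triangle_of v"
proof (rule closure_minimal)
  show "open_cell v a b c \<sigma> \<subseteq> triangle_of v" using open_cell_avoids_segments[OF nc d] by blast
  show "closed (triangle_of v)"
    unfolding triangle_of_def by (intro compact_imp_closed compact_convex_hull finite_imp_compact) simp
qed

text \<open>Moving slightly towards an interior point of the cell makes all weak inequalities strict; the assumption on
\<open>\<sigma>\<close> guarantees such a point.\<close>

lemma in_closed_cell:
  assumes nc: "\<not> collinear {v 1, v 2, v 3}" and d: "a \<noteq> b" "b \<noteq> c" "a \<noteq> (c::3)"
    and \<sigma>: "\<sigma> = 1 \<or> \<sigma> = -1"
    and x: "0 \<le> barycentric v x c" "0 \<le> barycentric v x b - barycentric v x c"
      "0 \<le> barycentric v x a - barycentric v x b"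
      "0 \<le> \<sigma> * (barycentric v x a - barycentric v x b - barycentric v x c)"
  shows "x \<in> closure (open_cell v a b c \<sigma>)"
proof -
  define e where "e = (\<lambda>i. if i = c then (if \<sigma> = 1 then 1/10 else 2/10)
     else if i = b then (if \<sigma> = 1 then 2/10 else 7/20) else (if \<sigma> = 1 then 7/10 else 9/20 :: real))"
  have "e 1 + e 2 + e 3 = 1" unfolding distinct3_sum[OF d] using d by (auto simp: e_def)
  then obtain y where y: "barycentric v y = e" using bary_surj[OF nc] by blast
  let ?h = "\<lambda>u. (1 - u) *\<^sub>R x + u *\<^sub>R y"
  have pos: "0 < (1 - u) * p + u * q" if "0 < u" "u < 1" "0 \<le> p" "0 < q" for u p q :: real
    using that by (intro add_nonneg_pos) auto
  have "?h u \<in> open_cell v a b c \<sigma>" if u: "0 < u" "u < 1" for u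
  proof -
    have "0 < (1 - u) * barycentric v x c + u * e c" using d \<sigma> by (intro pos[OF u x(1)]) (auto simp: e_def)
    moreover have "0 < (1 - u) * (barycentric v x b - barycentric v x c) + u * (e b - e c)"
      using d \<sigma> by (intro pos[OF u x(2)]) (auto simp: e_def)
    moreover have "0 < (1 - u) * (barycentric v x a - barycentric v x b) + u * (e a - e b)"
      using d \<sigma> by (intro pos[OF u x(3)]) (auto simp: e_def)
    moreover have "0 < (1 - u) * (\<sigma> * (barycentric v x a - barycentric v x b - barycentric v x c)) + u * (\<sigma> * (e a - e b - e c))"
      using d \<sigma> by (intro pos[OF u x(4)]) (auto simp: e_def)
    ultimately show ?thesis
      unfolding open_cell_iff bary_convex_comb[OF nc] y by (simp add: algebra_simps)
  qed
  then have "?h ` {0<..<1} \<subseteq> closure (open_cell v a b c \<sigma>)"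
    using closure_subset by fastforce
  moreover have "continuous_on (closure {0<..<1}) ?h" by (intro continuous_intros)
  ultimately have "?h ` closure {0<..<1} \<subseteq> closure (open_cell v a b c \<sigma>)"
    using image_closure_subset closed_closure by blast
  moreover have "0 \<in> closure {0<..<1::real}" by simp
  ultimately have "?h 0 \<in> closure (open_cell v a b c \<sigma>)" by (rule subsetD[OF _ imageI])
  then show ?thesis by simp
qed

text \<open>The chart of \<open>jump_across_line\<close> prescribed through barycentric coordinates: \<open>e0\<close> is a point, \<open>e1\<close> and \<open>e2\<close> are
directions, whose coordinates sum to 0.\<close>

lemma jump_barycentric:
  fixes e0 e1 e2 :: "3 \<Rightarrow> real"
  assumes nc: "\<not> collinear {v 1, v 2, v 3}"
    and f: "f \<in> spline_space 3 5 v" and p: "is_poly2 5 p" and q: "is_poly2 5 q"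
    and fp: "\<And>x. x \<in> closure U \<Longrightarrow> f x = p x" and fq: "\<And>x. x \<in> closure W \<Longrightarrow> f x = q x"
    and UT: "closure U \<subseteq> triangle_of v" and WT: "closure W \<subseteq> triangle_of v"
    and e: "e0 1 + e0 2 + e0 3 = 1" "e1 1 + e1 2 + e1 3 = 0" "e2 1 + e2 2 + e2 3 = 0"
    and w01: "w0 < w1"
    and U: "\<And>x t w. barycentric v x = (\<lambda>i. e0 i + t * e1 i + w * e2 i) \<Longrightarrow> w0 < w \<Longrightarrow> w < w1 \<Longrightarrow> 0 < t \<Longrightarrow> t < 1/100 \<Longrightarrow> x \<in> U"
    and W: "\<And>x t w. barycentric v x = (\<lambda>i. e0 i - t * e1 i + w * e2 i) \<Longrightarrow> w0 < w \<Longrightarrow> w < w1 \<Longrightarrow> 0 < t \<Longrightarrow> t < 1/100 \<Longrightarrow> x \<in> W"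
  shows "\<exists>c0 c1 c2. \<forall>x t w. barycentric v x = (\<lambda>i. e0 i + t * e1 i + w * e2 i) \<longrightarrow> p x - q x = t ^ 4 * (c0 + c1 * t + c2 * w)"
proof -
  define x0 d1 d2 where "x0 = e0 1 *\<^sub>R v 1 + e0 2 *\<^sub>R v 2 + e0 3 *\<^sub>R v 3"
    and "d1 = e1 1 *\<^sub>R v 1 + e1 2 *\<^sub>R v 2 + e1 3 *\<^sub>R v 3" and "d2 = e2 1 *\<^sub>R v 1 + e2 2 *\<^sub>R v 2 + e2 3 *\<^sub>R v 3"
  have X: "x0 + t *\<^sub>R d1 + w *\<^sub>R d2 = (e0 1 + t * e1 1 + w * e2 1) *\<^sub>R v 1 + (e0 2 + t * e1 2 + w * e2 2) *\<^sub>R v 2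
     + (e0 3 + t * e1 3 + w * e2 3) *\<^sub>R v 3" for t w
    by (simp add: x0_def d1_def d2_def algebra_simps)
  have bX: "barycentric v (x0 + t *\<^sub>R d1 + w *\<^sub>R d2) = (\<lambda>i. e0 i + t * e1 i + w * e2 i)" for t w
  proof (rule bary_unique[OF nc])
    have "(e0 1 + t * e1 1 + w * e2 1) + (e0 2 + t * e1 2 + w * e2 2) + (e0 3 + t * e1 3 + w * e2 3)
      = (e0 1 + e0 2 + e0 3) + t * (e1 1 + e1 2 + e1 3) + w * (e2 1 + e2 2 + e2 3)"
      by (simp add: algebra_simps)
    then show "(e0 1 + t * e1 1 + w * e2 1) + (e0 2 + t * e1 2 + w * e2 2) + (e0 3 + t * e1 3 + w * e2 3) = 1"
      unfolding e by simp
  qed (simp add: X)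
  have xX: "x = x0 + t *\<^sub>R d1 + w *\<^sub>R d2" if "barycentric v x = (\<lambda>i. e0 i + t * e1 i + w * e2 i)" for x t w
    using bary_comb[OF nc, of x] unfolding X that by simp
  have "Ck_on 3 (triangle_of v) f" using f by (simp add: spline_space_def)
  then have "\<exists>c0 c1 c2. \<forall>t w. p (x0 + t *\<^sub>R d1 + w *\<^sub>R d2) - q (x0 + t *\<^sub>R d1 + w *\<^sub>R d2) = t ^ 4 * (c0 + c1 * t + c2 * w)"
  proof (rule jump_across_line[OF _ p q fp fq UT WT _ w01])
    show "x0 + t *\<^sub>R d1 + w *\<^sub>R d2 \<in> U" if "w0 < w" "w < w1" "0 < t" "t < 1/100" for t w
      by (rule U[OF bX that])
    show "x0 + (- t) *\<^sub>R d1 + w *\<^sub>R d2 \<in> W" if "w0 < w" "w < w1" "0 < t" "t < 1/100" for t w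
      by (rule W[OF _ that]) (use bX[of "- t" w] in simp)
    show "0 < (1/100 :: real)" by simp
  qed
  then obtain c0 c1 c2 where H: "\<And>t w. p (x0 + t *\<^sub>R d1 + w *\<^sub>R d2) - q (x0 + t *\<^sub>R d1 + w *\<^sub>R d2)
     = t ^ 4 * (c0 + c1 * t + c2 * w)" by blast
  have "p x - q x = t ^ 4 * (c0 + c1 * t + c2 * w)" if "barycentric v x = (\<lambda>i. e0 i + t * e1 i + w * e2 i)" for x t w
    using H[of t w] unfolding xX[OF that, symmetric] .
  then show ?thesis by blast
qed

section \<open>Smoothing cofactors and conformality\<close>

definition lin3 :: "(3 \<Rightarrow> real) \<Rightarrow> (3 \<Rightarrow> real) \<Rightarrow> real" where
  "lin3 k b = k 1 * b 1 + k 2 * b 2 + k 3 * b 3"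

lemma lin3_distinct:
  assumes "a \<noteq> b" "b \<noteq> c" "a \<noteq> (c::3)"
  shows "lin3 k \<beta> = k a * \<beta> a + k b * \<beta> b + k c * \<beta> c"
  unfolding lin3_def using distinct3_sum[OF assms, of "\<lambda>i. k i * \<beta> i"] by simp

lemma lin3_exists:
  assumes "a \<noteq> b" "b \<noteq> c" "a \<noteq> (c::3)"
  shows "\<exists>k. \<forall>\<beta>. lin3 k \<beta> = x * \<beta> a + y * \<beta> b + z * \<beta> c"
proof (intro exI allI)
  show "lin3 (\<lambda>i. if i = a then x else if i = b then y else z) \<beta> = x * \<beta> a + y * \<beta> b + z * \<beta> c" for \<beta>
    unfolding lin3_distinct[OF assms] using assms by simp
qed

lemma bary_sum_distinct:
  assumes nc: "\<not> collinear {v 1, v 2, v 3}" and d: "a \<noteq> b" "b \<noteq> c" "a \<noteq> (c::3)"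
  shows "barycentric v x a + barycentric v x b + barycentric v x c = 1"
  using bary_sum[OF nc, of x] distinct3_sum[OF d, of "barycentric v x"] by simp

lemma fun3_distinct_eqI:
  assumes "a \<noteq> b" "b \<noteq> c" "a \<noteq> (c::3)" "f a = g a" "f b = g b" "f c = g c"
  shows "f = g"
proof
  fix i
  have "i \<in> {a, b, c}" using distinct3_UNIV[OF assms(1-3)] by auto
  then show "f i = g i" using assms(4-6) by auto
qed

text \<open>The chart parameters are recovered from the barycentric coordinates by linear forms \<open>T\<close> (across the edge) and \<open>M\<close>
(along it), which rewrites the jump as \<open>T ^ 4\<close> times a linear form. A constant is a
linear form here because the coordinates sum to 1.\<close>

lemma edge_jump:
  fixes x0 xt xw y0 yt yw z0 zt zw :: real
  assumes nc: "\<not> collinear {v 1, v 2, v 3}" and d: "a \<noteq> b" "b \<noteq> c" "a \<noteq> (c::3)"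
    and f: "f \<in> spline_space 3 5 v" and p: "is_poly2 5 p" and q: "is_poly2 5 q"
    and fp: "\<And>x. x \<in> closure U \<Longrightarrow> f x = p x" and fq: "\<And>x. x \<in> closure W \<Longrightarrow> f x = q x"
    and UT: "closure U \<subseteq> triangle_of v" and WT: "closure W \<subseteq> triangle_of v"
    and s: "x0 + y0 + z0 = 1" "xt + yt + zt = 0" "xw + yw + zw = 0"
    and w01: "w0 < w1"
    and U: "\<And>x t w. barycentric v x a = x0 + t * xt + w * xw \<Longrightarrow> barycentric v x b = y0 + t * yt + w * yw
        \<Longrightarrow> barycentric v x c = z0 + t * zt + w * zw \<Longrightarrow> w0 < w \<Longrightarrow> w < w1 \<Longrightarrow> 0 < t \<Longrightarrow> t < 1/100 \<Longrightarrow> x \<in> U"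
    and W: "\<And>x t w. barycentric v x a = x0 - t * xt + w * xw \<Longrightarrow> barycentric v x b = y0 - t * yt + w * yw
        \<Longrightarrow> barycentric v x c = z0 - t * zt + w * zw \<Longrightarrow> w0 < w \<Longrightarrow> w < w1 \<Longrightarrow> 0 < t \<Longrightarrow> t < 1/100 \<Longrightarrow> x \<in> W"
    and inv: "\<And>A B C. A + B + C = 1 \<Longrightarrow> A = x0 + T A B C * xt + M A B C * xw \<and> B = y0 + T A B C * yt + M A B C * yw
       \<and> C = z0 + T A B C * zt + M A B C * zw"
    and lin: "\<And>A B C. T A B C = t1 * A + t2 * B + t3 * C" "\<And>A B C. M A B C = m1 * A + m2 * B + m3 * C"
  shows "\<exists>k. \<forall>x. p x - q x = T (barycentric v x a) (barycentric v x b) (barycentric v x c) ^ 4 * lin3 k (barycentric v x)"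
proof -
  define e where "e = (\<lambda>x y z i. if i = a then x else if i = b then y else (z::real))"
  have e: "e x y z a = x" "e x y z b = y" "e x y z c = z" for x y z using d by (auto simp: e_def)
  have eq: "barycentric v x = (\<lambda>i. e x0 y0 z0 i + t * e xt yt zt i + w * e xw yw zw i)
     \<longleftrightarrow> barycentric v x a = x0 + t * xt + w * xw \<and> barycentric v x b = y0 + t * yt + w * yw \<and> barycentric v x c = z0 + t * zt + w * zw"
    for x t w
  proof
    assume "barycentric v x a = x0 + t * xt + w * xw \<and> barycentric v x b = y0 + t * yt + w * yw \<and> barycentric v x c = z0 + t * zt + w * zw"
    then show "barycentric v x = (\<lambda>i. e x0 y0 z0 i + t * e xt yt zt i + w * e xw yw zw i)"
      by (intro fun3_distinct_eqI[OF d]) (simp_all add: e)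
  qed (simp add: e)
  have "\<exists>c0 c1 c2. \<forall>x t w. barycentric v x = (\<lambda>i. e x0 y0 z0 i + t * e xt yt zt i + w * e xw yw zw i)
     \<longrightarrow> p x - q x = t ^ 4 * (c0 + c1 * t + c2 * w)"
  proof (rule jump_barycentric[OF nc f p q fp fq UT WT _ _ _ w01])
    show "e x0 y0 z0 1 + e x0 y0 z0 2 + e x0 y0 z0 3 = 1" "e xt yt zt 1 + e xt yt zt 2 + e xt yt zt 3 = 0"
      "e xw yw zw 1 + e xw yw zw 2 + e xw yw zw 3 = 0"
      unfolding distinct3_sum[OF d] e by (fact s)+
  next
    fix x t w assume h: "barycentric v x = (\<lambda>i. e x0 y0 z0 i + t * e xt yt zt i + w * e xw yw zw i)"
      "w0 < w" "w < w1" "0 < t" "t < 1/100"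
    show "x \<in> U" by (rule U[OF _ _ _ h(2-5)]) (simp_all add: h(1) e)
  next
    fix x t w assume h: "barycentric v x = (\<lambda>i. e x0 y0 z0 i - t * e xt yt zt i + w * e xw yw zw i)"
      "w0 < w" "w < w1" "0 < t" "t < 1/100"
    show "x \<in> W" by (rule W[OF _ _ _ h(2-5)]) (simp_all add: h(1) e)
  qed
  then obtain c0 c1 c2 where C: "\<And>x t w. barycentric v x = (\<lambda>i. e x0 y0 z0 i + t * e xt yt zt i + w * e xw yw zw i)
     \<Longrightarrow> p x - q x = t ^ 4 * (c0 + c1 * t + c2 * w)" by blast
  obtain k where k: "\<And>\<beta>. lin3 k \<beta> = (c0 + c1 * t1 + c2 * m1) * \<beta> a + (c0 + c1 * t2 + c2 * m2) * \<beta> b + (c0 + c1 * t3 + c2 * m3) * \<beta> c"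
    using lin3_exists[OF d, of "c0 + c1 * t1 + c2 * m1" "c0 + c1 * t2 + c2 * m2" "c0 + c1 * t3 + c2 * m3"] by blast
  have "p x - q x = T (barycentric v x a) (barycentric v x b) (barycentric v x c) ^ 4 * lin3 k (barycentric v x)" for x
  proof -
    define A B C' where "A = barycentric v x a" and "B = barycentric v x b" and "C' = barycentric v x c"
    have s1: "A + B + C' = 1" using bary_sum_distinct[OF nc d] by (simp add: A_def B_def C'_def)
    have "p x - q x = T A B C' ^ 4 * (c0 + c1 * T A B C' + c2 * M A B C')"
      by (rule C) (unfold eq, use inv[OF s1] in \<open>simp add: A_def B_def C'_def\<close>)
    also have "c0 + c1 * T A B C' + c2 * M A B C' = c0 * (A + B + C') + c1 * T A B C' + c2 * M A B C'" using s1 by simp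
    also have "\<dots> = lin3 k (barycentric v x)"
      unfolding k lin A_def B_def C'_def by (simp add: algebra_simps)
    finally show ?thesis by (simp add: A_def B_def C'_def)
  qed
  then show ?thesis by blast
qed

text \<open>The fourth powers of two different lines are coprime and the cofactors have degree 1, so both vanish. Six
evaluations determine the six coefficients.\<close>

lemma crossing_conformality:
  assumes nc: "\<not> collinear {v 1, v 2, v 3}" and d: "a \<noteq> b" "b \<noteq> c" "a \<noteq> (c::3)"
    and H: "\<And>x. (barycentric v x a - barycentric v x b - barycentric v x c) ^ 4 * lin3 k (barycentric v x)
       = (barycentric v x b - barycentric v x c) ^ 4 * lin3 l (barycentric v x)"
  shows "lin3 k \<beta> = 0" "lin3 l \<beta> = 0"
proof -
  have E: "(A - B - C) ^ 4 * (k a * A + k b * B + k c * C) = (B - C) ^ 4 * (l a * A + l b * B + l c * C)" if s: "A + B + C = 1" for A B C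
  proof -
    define e where "e = (\<lambda>i. if i = a then A else if i = b then B else C)"
    have e: "e a = A" "e b = B" "e c = C" using d by (auto simp: e_def)
    have "e 1 + e 2 + e 3 = 1" unfolding distinct3_sum[OF d] e by (fact s)
    then obtain x where "barycentric v x = e" using bary_surj[OF nc] by blast
    then show ?thesis using H[of x] unfolding lin3_distinct[OF d] by (simp add: e)
  qed
  have "k a = 0" using E[of 1 0 0] by simp
  moreover have "k b + k c = k a" using E[of "-1" 1 1] by simp
  moreover have "l a + l b = 0" using E[of "1/2" "1/2" 0] by simp
  moreover have "l a + l c = 0" using E[of "1/2" 0 "1/2"] by simp
  moreover have "k b = l b" using E[of 0 1 0] by simp
  moreover have "2 * k b - k c = 81 * (2 * l b - l c)" using E[of 0 2 "-1"] by simp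
  ultimately have "k a = 0" "k b = 0" "k c = 0" "l a = 0" "l b = 0" "l c = 0" by - algebra+
  then show "lin3 k \<beta> = 0" "lin3 l \<beta> = 0" unfolding lin3_distinct[OF d] by simp_all
qed

text \<open>Going around the centroid, the jumps across the three medians add up to zero. In local coordinates at the
centroid the fourth powers of three concurrent lines are independent quartics, and their six products with the two
coordinates are independent in the 6-dimensional space of binary quintics, so only the trivial
relation is left. Concretely, nine evaluations determine the nine coefficients.\<close>

lemma centroid_conformality:
  assumes nc: "\<not> collinear {v 1, v 2, v 3}"
    and H: "\<And>x. (barycentric v x 1 - barycentric v x 2) ^ 4 * lin3 k (barycentric v x)
       + (barycentric v x 1 - barycentric v x 3) ^ 4 * lin3 l (barycentric v x)
       + (barycentric v x 2 - barycentric v x 3) ^ 4 * lin3 m (barycentric v x) = 0"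
  shows "lin3 k \<beta> = 0" "lin3 l \<beta> = 0" "lin3 m \<beta> = 0"
proof -
  have E: "(A - B) ^ 4 * (k 1 * A + k 2 * B + k 3 * C) + (A - C) ^ 4 * (l 1 * A + l 2 * B + l 3 * C)
     + (B - C) ^ 4 * (m 1 * A + m 2 * B + m 3 * C) = 0" if s: "A + B + C = 1" for A B C
  proof -
    define e :: "3 \<Rightarrow> real" where "e = (\<lambda>i. if i = 1 then A else if i = 2 then B else C)"
    have e: "e 1 = A" "e 2 = B" "e 3 = C" by (auto simp: e_def)
    have "e 1 + e 2 + e 3 = 1" unfolding e by (fact s)
    then obtain x where "barycentric v x = e" using bary_surj[OF nc] by blast
    then show ?thesis using H[of x] unfolding lin3_def by (simp add: e)
  qed
  have "l 3 + m 3 = 0" using E[of 0 0 1] by simp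
  moreover have "k 2 + m 2 = 0" using E[of 0 1 0] by simp
  moreover have "32 * k 2 + (-16) * k 3 + 2 * l 2 + (-1) * l 3 + 162 * m 2 + (-81) * m 3 = 0" using E[of 0 2 "-1"] by simp
  moreover have "(-1) * k 2 + 2 * k 3 + (-16) * l 2 + 32 * l 3 + (-81) * m 2 + 162 * m 3 = 0" using E[of 0 "-1" 2] by simp
  moreover have "k 1 + l 1 = 0" using E[of 1 0 0] by simp
  moreover have "16 * l 1 + 16 * l 2 + (-16) * l 3 + 16 * m 1 + 16 * m 2 + (-16) * m 3 = 0" using E[of 1 1 "-1"] by simp
  moreover have "k 1 + 2 * k 2 + (-2) * k 3 + 81 * l 1 + 162 * l 2 + (-162) * l 3 + 256 * m 1 + 512 * m 2 + (-512) * m 3 = 0" using E[of 1 2 "-2"] by simp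
  moreover have "16 * k 1 + (-16) * k 2 + 16 * k 3 + 16 * m 1 + (-16) * m 2 + 16 * m 3 = 0" using E[of 1 "-1" 1] by simp
  moreover have "32 * k 1 + (-16) * k 3 + 162 * l 1 + (-81) * l 3 + 2 * m 1 + (-1) * m 3 = 0" using E[of 2 0 "-1"] by simp
  ultimately have "k 1 = 0" "k 2 = 0" "k 3 = 0" "l 1 = 0" "l 2 = 0" "l 3 = 0" "m 1 = 0" "m 2 = 0" "m 3 = 0"
    by - algebra+
  then show "lin3 k \<beta> = 0" "lin3 l \<beta> = 0" "lin3 m \<beta> = 0" unfolding lin3_def by simp_all
qed

section \<open>Generators of the spline space\<close>

definition cell_poly :: "(3 \<Rightarrow> real^2) \<Rightarrow> (real^2 \<Rightarrow> real) \<Rightarrow> 3 \<Rightarrow> 3 \<Rightarrow> 3 \<Rightarrow> real \<Rightarrow> real^2 \<Rightarrow> real" where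
  "cell_poly v f a b c \<sigma> = (SOME p. is_poly2 5 p \<and> (\<forall>x\<in>closure (open_cell v a b c \<sigma>). f x = p x))"

context
  fixes v :: "3 \<Rightarrow> real^2" and f :: "real^2 \<Rightarrow> real"
  assumes nc: "\<not> collinear {v 1, v 2, v 3}" and f: "f \<in> spline_space 3 5 v"
begin

lemma cell_poly:
  assumes d: "a \<noteq> b" "b \<noteq> c" "a \<noteq> (c::3)"
  shows "is_poly2 5 (cell_poly v f a b c \<sigma>)"
    and "\<And>x. x \<in> closure (open_cell v a b c \<sigma>) \<Longrightarrow> f x = cell_poly v f a b c \<sigma> x"
  using someI_ex[OF open_cell_poly[OF nc d f, of \<sigma>]] unfolding cell_poly_def by blast+

text \<open>In this and the next three lemmas the chart is centred on the line containing the common edge, \<open>t\<close> crosses it and \<open>w\<close> moves along it; the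
interval for \<open>w\<close> and the bound 1/100 for \<open>t\<close> keep the chart inside the two cells. Each of the four kinds of interior edges occurs
once: half a midline, and the part of a median near a vertex, between midline and centroid, and between centroid and
side.\<close>

lemma jump_midline:
  assumes d: "a \<noteq> b" "b \<noteq> c" "a \<noteq> (c::3)"
  shows "\<exists>k. \<forall>x. cell_poly v f a b c 1 x - cell_poly v f a b c (-1) x
    = (barycentric v x a - barycentric v x b - barycentric v x c) ^ 4 * lin3 k (barycentric v x)"
  by (rule edge_jump[OF nc d f cell_poly(1)[OF d] cell_poly(1)[OF d] cell_poly(2)[OF d] cell_poly(2)[OF d]
        closed_cell_subset[OF nc d] closed_cell_subset[OF nc d], where T = "\<lambda>A B C. A - B - C" and M = "\<lambda>A B C. B - C"
        and ?x0.0 = "1/2" and xt = "1/2" and xw = 0 and ?y0.0 = "1/4" and yt = "-1/4" and yw = "1/2"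
        and ?z0.0 = "1/4" and zt = "-1/4" and zw = "-1/2" and ?w0.0 = "1/20" and ?w1.0 = "3/20"
        and ?t1.0 = 1 and ?t2.0 = "-1" and ?t3.0 = "-1" and ?m1.0 = 0 and ?m2.0 = 1 and ?m3.0 = "-1"])
     (simp_all add: open_cell_iff field_simps, (linarith+)?)

lemma jump_median_outer:
  assumes d: "a \<noteq> b" "b \<noteq> c" "a \<noteq> (c::3)"
  shows "\<exists>k. \<forall>x. cell_poly v f a b c 1 x - cell_poly v f a c b 1 x
    = (barycentric v x b - barycentric v x c) ^ 4 * lin3 k (barycentric v x)"
  by (rule edge_jump[OF nc d f cell_poly(1)[OF d] cell_poly(1)[OF d(3) d(2)[symmetric] d(1)] cell_poly(2)[OF d]
        cell_poly(2)[OF d(3) d(2)[symmetric] d(1)]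
        closed_cell_subset[OF nc d] closed_cell_subset[OF nc d(3) d(2)[symmetric] d(1)],
        where T = "\<lambda>A B C. B - C" and M = "\<lambda>A B C. A"
        and ?x0.0 = 0 and xt = 0 and xw = 1 and ?y0.0 = "1/2" and yt = "1/2" and yw = "-1/2"
        and ?z0.0 = "1/2" and zt = "-1/2" and zw = "-1/2" and ?w0.0 = "3/5" and ?w1.0 = "7/10"
        and ?t1.0 = 0 and ?t2.0 = 1 and ?t3.0 = "-1" and ?m1.0 = 1 and ?m2.0 = 0 and ?m3.0 = 0])
     (simp_all add: open_cell_iff field_simps, (linarith+)?)

lemma jump_median_inner:
  assumes d: "a \<noteq> b" "b \<noteq> c" "a \<noteq> (c::3)"
  shows "\<exists>k. \<forall>x. cell_poly v f a b c (-1) x - cell_poly v f a c b (-1) x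
    = (barycentric v x b - barycentric v x c) ^ 4 * lin3 k (barycentric v x)"
  by (rule edge_jump[OF nc d f cell_poly(1)[OF d] cell_poly(1)[OF d(3) d(2)[symmetric] d(1)] cell_poly(2)[OF d]
        cell_poly(2)[OF d(3) d(2)[symmetric] d(1)]
        closed_cell_subset[OF nc d] closed_cell_subset[OF nc d(3) d(2)[symmetric] d(1)],
        where T = "\<lambda>A B C. B - C" and M = "\<lambda>A B C. A"
        and ?x0.0 = 0 and xt = 0 and xw = 1 and ?y0.0 = "1/2" and yt = "1/2" and yw = "-1/2"
        and ?z0.0 = "1/2" and zt = "-1/2" and zw = "-1/2" and ?w0.0 = "2/5" and ?w1.0 = "9/20"
        and ?t1.0 = 0 and ?t2.0 = 1 and ?t3.0 = "-1" and ?m1.0 = 1 and ?m2.0 = 0 and ?m3.0 = 0])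
     (simp_all add: open_cell_iff field_simps, (linarith+)?)

lemma jump_median_base:
  assumes d: "a \<noteq> b" "b \<noteq> c" "a \<noteq> (c::3)"
  shows "\<exists>k. \<forall>x. cell_poly v f a b c (-1) x - cell_poly v f b a c (-1) x
    = (barycentric v x a - barycentric v x b) ^ 4 * lin3 k (barycentric v x)"
  by (rule edge_jump[OF nc d f cell_poly(1)[OF d] cell_poly(1)[OF d(1)[symmetric] d(3) d(2)] cell_poly(2)[OF d]
        cell_poly(2)[OF d(1)[symmetric] d(3) d(2)]
        closed_cell_subset[OF nc d] closed_cell_subset[OF nc d(1)[symmetric] d(3) d(2)],
        where T = "\<lambda>A B C. A - B" and M = "\<lambda>A B C. C"
        and ?x0.0 = "1/2" and xt = "1/2" and xw = "-1/2" and ?y0.0 = "1/2" and yt = "-1/2" and yw = "-1/2"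
        and ?z0.0 = 0 and zt = 0 and zw = 1 and ?w0.0 = "1/10" and ?w1.0 = "1/5"
        and ?t1.0 = 1 and ?t2.0 = "-1" and ?t3.0 = 0 and ?m1.0 = 0 and ?m2.0 = 0 and ?m3.0 = 1])
     (simp_all add: open_cell_iff field_simps, (linarith+)?)

lemma lin3_diff: "lin3 (\<lambda>i. k i - l i) \<beta> = lin3 k \<beta> - lin3 l \<beta>"
  by (simp add: lin3_def algebra_simps)

text \<open>The four cells around the crossing of a midline with the median from \<open>a\<close> give two expressions for the same
difference, to which \<open>crossing_conformality\<close> applies.\<close>

lemma jump_midline_symmetric:
  assumes d: "a \<noteq> b" "b \<noteq> c" "a \<noteq> (c::3)"
  shows "\<exists>k. \<forall>x. cell_poly v f a b c 1 x = cell_poly v f a b c (-1) x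
      + (barycentric v x a - barycentric v x b - barycentric v x c) ^ 4 * lin3 k (barycentric v x) \<and>
    cell_poly v f a c b 1 x = cell_poly v f a c b (-1) x
      + (barycentric v x a - barycentric v x b - barycentric v x c) ^ 4 * lin3 k (barycentric v x)"
proof -
  have d': "a \<noteq> c" "c \<noteq> b" "a \<noteq> b" using d by auto
  let ?P = "cell_poly v f" and ?h = "\<lambda>x. barycentric v x a - barycentric v x b - barycentric v x c"
  obtain k where k: "\<And>x. ?P a b c 1 x - ?P a b c (-1) x = ?h x ^ 4 * lin3 k (barycentric v x)"
    using jump_midline[OF d] by blast
  obtain k' where k': "\<And>x. ?P a c b 1 x - ?P a c b (-1) x = ?h x ^ 4 * lin3 k' (barycentric v x)"
    using jump_midline[OF d'] by (auto simp: algebra_simps)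
  obtain l where l: "\<And>x. ?P a b c 1 x - ?P a c b 1 x = (barycentric v x b - barycentric v x c) ^ 4 * lin3 l (barycentric v x)"
    using jump_median_outer[OF d] by blast
  obtain l' where l': "\<And>x. ?P a b c (-1) x - ?P a c b (-1) x = (barycentric v x b - barycentric v x c) ^ 4 * lin3 l' (barycentric v x)"
    using jump_median_inner[OF d] by blast
  have "?h x ^ 4 * lin3 (\<lambda>i. k i - k' i) (barycentric v x)
     = (barycentric v x b - barycentric v x c) ^ 4 * lin3 (\<lambda>i. l i - l' i) (barycentric v x)" for x
    using k[of x] k'[of x] l[of x] l'[of x] unfolding lin3_diff right_diff_distrib by linarith
  from crossing_conformality(1)[OF nc d this] have "lin3 k \<beta> = lin3 k' \<beta>" for \<beta>
    unfolding lin3_diff by simp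
  then show ?thesis using k k' by (intro exI[of _ k] allI) (smt (verit))
qed

text \<open>Start with the polynomial on the medial cell in the sector \<open>b3 \<ge> b2 \<ge> b1\<close>, where all six truncated powers vanish. Every
other cell is reached by crossing lines from their negative to their positive side. The two ways around the centroid
agree by \<open>centroid_conformality\<close>, so the cofactor of a median does not depend on which of its parts is crossed.\<close>

lemma cofactors_exist:
  "\<exists>(H :: 3 \<Rightarrow> 3 \<Rightarrow> real) (M :: 3 \<Rightarrow> 3 \<Rightarrow> real). \<forall>x\<in>triangle_of v. let b = barycentric v x in
     f x = cell_poly v f 3 2 1 (-1) x
       + tpow 4 (b 1 - b 2 - b 3) * lin3 (H 1) b + tpow 4 (b 2 - b 1 - b 3) * lin3 (H 2) b + tpow 4 (b 3 - b 1 - b 2) * lin3 (H 3) b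
       + tpow 4 (b 1 - b 2) * lin3 (M 3) b + tpow 4 (b 1 - b 3) * lin3 (M 2) b + tpow 4 (b 2 - b 3) * lin3 (M 1) b"
proof -
  let ?P = "cell_poly v f" and ?b = "barycentric v"
  have ne: "(1::3) \<noteq> 2" "(2::3) \<noteq> 3" "(1::3) \<noteq> 3" "(2::3) \<noteq> 1" "(3::3) \<noteq> 2" "(3::3) \<noteq> 1" by simp_all
  obtain H1 where H1: "\<And>x. ?P 1 2 3 1 x = ?P 1 2 3 (-1) x + (?b x 1 - ?b x 2 - ?b x 3) ^ 4 * lin3 H1 (?b x)"
      "\<And>x. ?P 1 3 2 1 x = ?P 1 3 2 (-1) x + (?b x 1 - ?b x 2 - ?b x 3) ^ 4 * lin3 H1 (?b x)"
    using jump_midline_symmetric[OF ne(1,2,3)] by blast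
  obtain H2 where H2: "\<And>x. ?P 2 1 3 1 x = ?P 2 1 3 (-1) x + (?b x 2 - ?b x 1 - ?b x 3) ^ 4 * lin3 H2 (?b x)"
      "\<And>x. ?P 2 3 1 1 x = ?P 2 3 1 (-1) x + (?b x 2 - ?b x 1 - ?b x 3) ^ 4 * lin3 H2 (?b x)"
    using jump_midline_symmetric[OF ne(4,3,2)] by blast
  obtain H3 where H3: "\<And>x. ?P 3 1 2 1 x = ?P 3 1 2 (-1) x + (?b x 3 - ?b x 1 - ?b x 2) ^ 4 * lin3 H3 (?b x)"
      "\<And>x. ?P 3 2 1 1 x = ?P 3 2 1 (-1) x + (?b x 3 - ?b x 1 - ?b x 2) ^ 4 * lin3 H3 (?b x)"
    using jump_midline_symmetric[OF ne(6,1,5)] by blast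
  obtain k1 where k1: "\<And>x. ?P 3 1 2 (-1) x - ?P 3 2 1 (-1) x = (?b x 1 - ?b x 2) ^ 4 * lin3 k1 (?b x)"
    using jump_median_inner[OF ne(6,1,5)] by blast
  obtain k2 where k2: "\<And>x. ?P 1 3 2 (-1) x - ?P 3 1 2 (-1) x = (?b x 1 - ?b x 3) ^ 4 * lin3 k2 (?b x)"
    using jump_median_base[OF ne(3,5,1)] by blast
  obtain k3 where k3: "\<And>x. ?P 1 2 3 (-1) x - ?P 1 3 2 (-1) x = (?b x 2 - ?b x 3) ^ 4 * lin3 k3 (?b x)"
    using jump_median_inner[OF ne(1,2,3)] by blast
  obtain l3 where l3: "\<And>x. ?P 2 3 1 (-1) x - ?P 3 2 1 (-1) x = (?b x 2 - ?b x 3) ^ 4 * lin3 l3 (?b x)"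
    using jump_median_base[OF ne(2,6,4)] by blast
  obtain l2 where l2: "\<And>x. ?P 2 1 3 (-1) x - ?P 2 3 1 (-1) x = (?b x 1 - ?b x 3) ^ 4 * lin3 l2 (?b x)"
    using jump_median_inner[OF ne(4,3,2)] by blast
  obtain l1 where l1: "\<And>x. ?P 1 2 3 (-1) x - ?P 2 1 3 (-1) x = (?b x 1 - ?b x 2) ^ 4 * lin3 l1 (?b x)"
    using jump_median_base[OF ne(1,2,3)] by blast
  have "(?b x 1 - ?b x 2) ^ 4 * lin3 (\<lambda>i. k1 i - l1 i) (?b x) + (?b x 1 - ?b x 3) ^ 4 * lin3 (\<lambda>i. k2 i - l2 i) (?b x)
      + (?b x 2 - ?b x 3) ^ 4 * lin3 (\<lambda>i. k3 i - l3 i) (?b x) = 0" for x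
    using k1[of x] k2[of x] k3[of x] l1[of x] l2[of x] l3[of x] unfolding lin3_diff right_diff_distrib by linarith
  note centroid_conformality(2,3)[OF nc this]
  then have l2k: "lin3 l2 \<beta> = lin3 k2 \<beta>" and l3k: "lin3 l3 \<beta> = lin3 k3 \<beta>" for \<beta>
    unfolding lin3_diff by simp_all
  define H M where "H = (\<lambda>i::3. if i = 1 then H1 else if i = 2 then H2 else H3)"
    and "M = (\<lambda>i::3. if i = 3 then k1 else if i = 2 then k2 else k3)"
  have HM: "H 1 = H1" "H 2 = H2" "H 3 = H3" "M 3 = k1" "M 2 = k2" "M 1 = k3" by (simp_all add: H_def M_def)
  show ?thesis
  proof (rule exI[of _ H], rule exI[of _ M], rule ballI, unfold Let_def HM)
    fix x assume x: "x \<in> triangle_of v"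
    define b1 b2 b3 where "b1 = ?b x 1" and "b2 = ?b x 2" and "b3 = ?b x 3"
    note b = this
    have nn: "0 \<le> b1" "0 \<le> b2" "0 \<le> b3" using x mem_triangle_iff[OF nc] by (simp_all add: b)
    let ?R = "?P 3 2 1 (-1) x + tpow 4 (b1 - b2 - b3) * lin3 H1 (?b x) + tpow 4 (b2 - b1 - b3) * lin3 H2 (?b x)
       + tpow 4 (b3 - b1 - b2) * lin3 H3 (?b x) + tpow 4 (b1 - b2) * lin3 k1 (?b x) + tpow 4 (b1 - b3) * lin3 k2 (?b x)
       + tpow 4 (b2 - b3) * lin3 k3 (?b x)"
    note rel = k1[of x, folded b] k2[of x, folded b] k3[of x, folded b] l3[of x, folded b, unfolded l3k] l2[of x, folded b, unfolded l2k]
      H1[of x, folded b] H2[of x, folded b] H3[of x, folded b]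
    have cell: "f x = ?P i j k (-1) x + tpow 4 (?b x i - ?b x j - ?b x k) * lin3 H (?b x)"
      if d: "i \<noteq> j" "j \<noteq> k" "i \<noteq> k"
        and H: "?P i j k 1 x = ?P i j k (-1) x + (?b x i - ?b x j - ?b x k) ^ 4 * lin3 H (?b x)"
        and le: "0 \<le> ?b x k" "0 \<le> ?b x j - ?b x k" "0 \<le> ?b x i - ?b x j" for i j k H
    proof (cases "0 \<le> ?b x i - ?b x j - ?b x k")
      case True
      then have "f x = ?P i j k 1 x"
        using cell_poly(2)[OF d in_closed_cell[OF nc d _ le, of 1]] by simp
      then show ?thesis unfolding H using True by (simp add: tpow_nonneg)
    next
      case False
      then have "f x = ?P i j k (-1) x"
        using cell_poly(2)[OF d in_closed_cell[OF nc d _ le, of "-1"]] by simp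
      then show ?thesis using False by (simp add: tpow_nonpos)
    qed
    consider "b3 \<le> b2 \<and> b2 \<le> b1" | "b2 \<le> b3 \<and> b3 \<le> b1" | "b3 \<le> b1 \<and> b1 \<le> b2" | "b1 \<le> b3 \<and> b3 \<le> b2" | "b2 \<le> b1 \<and> b1 \<le> b3" | "b1 \<le> b2 \<and> b2 \<le> b3"
      by linarith
    then have "f x = ?R"
    proof cases
      case 1
      have "?P 1 2 3 1 x = ?P 1 2 3 (-1) x + (?b x 1 - ?b x 2 - ?b x 3) ^ 4 * lin3 H1 (?b x)"
        using H1(1)[of x] by (simp add: algebra_simps)
      from cell[OF ne(1,2,3) this] have "f x = ?P 1 2 3 (-1) x + tpow 4 (b1 - b2 - b3) * lin3 H1 (?b x)"
        using 1 nn by (simp add: b algebra_simps)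
      moreover have "tpow 4 (b2 - b1 - b3) = 0" "tpow 4 (b3 - b1 - b2) = 0" "tpow 4 (b1 - b2) = (b1 - b2) ^ 4"
          "tpow 4 (b1 - b3) = (b1 - b3) ^ 4" "tpow 4 (b2 - b3) = (b2 - b3) ^ 4"
        using 1 nn by (auto intro!: tpow_nonneg tpow_nonpos)
      ultimately show ?thesis using rel by simp
    next
      case 2
      have "?P 1 3 2 1 x = ?P 1 3 2 (-1) x + (?b x 1 - ?b x 3 - ?b x 2) ^ 4 * lin3 H1 (?b x)"
        using H1(2)[of x] by (simp add: algebra_simps)
      from cell[OF ne(3,5,1) this] have "f x = ?P 1 3 2 (-1) x + tpow 4 (b1 - b2 - b3) * lin3 H1 (?b x)"
        using 2 nn by (simp add: b algebra_simps)
      moreover have "tpow 4 (b2 - b1 - b3) = 0" "tpow 4 (b3 - b1 - b2) = 0" "tpow 4 (b1 - b2) = (b1 - b2) ^ 4"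
          "tpow 4 (b1 - b3) = (b1 - b3) ^ 4" "tpow 4 (b2 - b3) = 0"
        using 2 nn by (auto intro!: tpow_nonneg tpow_nonpos)
      ultimately show ?thesis using rel by simp
    next
      case 3
      have "?P 2 1 3 1 x = ?P 2 1 3 (-1) x + (?b x 2 - ?b x 1 - ?b x 3) ^ 4 * lin3 H2 (?b x)"
        using H2(1)[of x] by (simp add: algebra_simps)
      from cell[OF ne(4,3,2) this] have "f x = ?P 2 1 3 (-1) x + tpow 4 (b2 - b1 - b3) * lin3 H2 (?b x)"
        using 3 nn by (simp add: b algebra_simps)
      moreover have "tpow 4 (b1 - b2 - b3) = 0" "tpow 4 (b3 - b1 - b2) = 0" "tpow 4 (b1 - b2) = 0"
          "tpow 4 (b1 - b3) = (b1 - b3) ^ 4" "tpow 4 (b2 - b3) = (b2 - b3) ^ 4"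
        using 3 nn by (auto intro!: tpow_nonneg tpow_nonpos)
      ultimately show ?thesis using rel by simp
    next
      case 4
      have "?P 2 3 1 1 x = ?P 2 3 1 (-1) x + (?b x 2 - ?b x 3 - ?b x 1) ^ 4 * lin3 H2 (?b x)"
        using H2(2)[of x] by (simp add: algebra_simps)
      from cell[OF ne(2,6,4) this] have "f x = ?P 2 3 1 (-1) x + tpow 4 (b2 - b1 - b3) * lin3 H2 (?b x)"
        using 4 nn by (simp add: b algebra_simps)
      moreover have "tpow 4 (b1 - b2 - b3) = 0" "tpow 4 (b3 - b1 - b2) = 0" "tpow 4 (b1 - b2) = 0" "tpow 4 (b1 - b3) = 0"
          "tpow 4 (b2 - b3) = (b2 - b3) ^ 4"
        using 4 nn by (auto intro!: tpow_nonneg tpow_nonpos)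
      ultimately show ?thesis using rel by simp
    next
      case 5
      have "?P 3 1 2 1 x = ?P 3 1 2 (-1) x + (?b x 3 - ?b x 1 - ?b x 2) ^ 4 * lin3 H3 (?b x)"
        using H3(1)[of x] by (simp add: algebra_simps)
      from cell[OF ne(6,1,5) this] have "f x = ?P 3 1 2 (-1) x + tpow 4 (b3 - b1 - b2) * lin3 H3 (?b x)"
        using 5 nn by (simp add: b algebra_simps)
      moreover have "tpow 4 (b1 - b2 - b3) = 0" "tpow 4 (b2 - b1 - b3) = 0" "tpow 4 (b1 - b2) = (b1 - b2) ^ 4"
          "tpow 4 (b1 - b3) = 0" "tpow 4 (b2 - b3) = 0"
        using 5 nn by (auto intro!: tpow_nonneg tpow_nonpos)
      ultimately show ?thesis using rel by simp
    next
      case 6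
      have "?P 3 2 1 1 x = ?P 3 2 1 (-1) x + (?b x 3 - ?b x 2 - ?b x 1) ^ 4 * lin3 H3 (?b x)"
        using H3(2)[of x] by (simp add: algebra_simps)
      from cell[OF ne(5,4,6) this] have "f x = ?P 3 2 1 (-1) x + tpow 4 (b3 - b1 - b2) * lin3 H3 (?b x)"
        using 6 nn by (simp add: b algebra_simps)
      moreover have "tpow 4 (b1 - b2 - b3) = 0" "tpow 4 (b2 - b1 - b3) = 0" "tpow 4 (b1 - b2) = 0" "tpow 4 (b1 - b3) = 0" "tpow 4 (b2 - b3) = 0"
        using 6 nn by (auto intro!: tpow_nonneg tpow_nonpos)
      ultimately show ?thesis using rel by simp
    qed
    then show "f x = ?P 3 2 1 (-1) x
       + tpow 4 (?b x 1 - ?b x 2 - ?b x 3) * lin3 H1 (?b x) + tpow 4 (?b x 2 - ?b x 1 - ?b x 3) * lin3 H2 (?b x)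
       + tpow 4 (?b x 3 - ?b x 1 - ?b x 2) * lin3 H3 (?b x)
       + tpow 4 (?b x 1 - ?b x 2) * lin3 k1 (?b x) + tpow 4 (?b x 1 - ?b x 3) * lin3 k2 (?b x) + tpow 4 (?b x 2 - ?b x 3) * lin3 k3 (?b x)"
      unfolding b .
  qed
qed

end

text \<open>The 21 monomials and, for each of the six lines, three truncated powers times a coordinate. Monomials in
two of the coordinates suffice since the coordinates sum to 1.\<close>

definition gens :: "(3 \<Rightarrow> real^2) \<Rightarrow> (real^2 \<Rightarrow> real) set" where
  "gens v = {on_triangle v (gen_mono i j) | i j. i + j \<le> 5} \<union> {on_triangle v (gen_trunc n k) | n k. n < 6}"

lemma trunc_times_linear_span:
  assumes "n < 6"
  shows "on_triangle v (\<lambda>b. tpow 4 (line_form n b) * lin3 k b) \<in> span (gens v)"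
proof -
  have "on_triangle v (\<lambda>b. tpow 4 (line_form n b) * lin3 k b)
      = k 1 *\<^sub>R on_triangle v (gen_trunc n 1) + k 2 *\<^sub>R on_triangle v (gen_trunc n 2) + k 3 *\<^sub>R on_triangle v (gen_trunc n 3)"
    by (auto simp: fun_eq_iff on_triangle_def gen_trunc_def lin3_def scaleR_fun_def algebra_simps)
  also have "\<dots> \<in> span (gens v)"
    using assms by (intro span_add span_scale span_base) (auto simp: gens_def)
  finally show ?thesis .
qed

lemma poly_span:
  assumes nc: "\<not> collinear {v 1, v 2, v 3}" and p: "is_poly2 5 p"
  shows "(\<lambda>x. if x \<in> triangle_of v then p x else 0) \<in> span (gens v)"
proof -
  obtain a :: "nat \<Rightarrow> nat \<Rightarrow> real" where a: "\<And>y :: real^2. p (v 3 + y $ 1 *\<^sub>R (v 1 - v 3) + y $ 2 *\<^sub>R (v 2 - v 3))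
      = (\<Sum>i\<le>5. \<Sum>j\<le>5 - i. a i j * (y $ 1) ^ i * (y $ 2) ^ j)"
    using is_poly2_compose_affine[OF p, of "v 3" "v 1 - v 3" "v 2 - v 3"] unfolding is_poly2_def by blast
  have "p x = (\<Sum>i\<le>5. \<Sum>j\<le>5 - i. a i j * (barycentric v x 1) ^ i * (barycentric v x 2) ^ j)" for x
  proof -
    have e: "barycentric v x 3 = 1 - barycentric v x 1 - barycentric v x 2" using bary_sum[OF nc, of x] by linarith
    have "x = v 3 + barycentric v x 1 *\<^sub>R (v 1 - v 3) + barycentric v x 2 *\<^sub>R (v 2 - v 3)"
      using bary_comb[OF nc, of x] unfolding e by (simp add: algebra_simps)
    then show ?thesis using a[of "vector [barycentric v x 1, barycentric v x 2]"] by simp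
  qed
  then have "(\<lambda>x. if x \<in> triangle_of v then p x else 0)
     = (\<Sum>i\<le>5. \<Sum>j\<le>5 - i. a i j *\<^sub>R on_triangle v (gen_mono i j))"
    by (auto simp: fun_eq_iff sum_fun_apply on_triangle_def gen_mono_def scaleR_fun_def mult.assoc)
  also have "\<dots> \<in> span (gens v)"
  proof (intro span_sum span_scale span_base)
    fix i j :: nat assume "i \<in> {..5}" "j \<in> {..5 - i}"
    then have "i + j \<le> 5" by simp
    then show "on_triangle v (gen_mono i j) \<in> gens v" unfolding gens_def by blast
  qed
  finally show ?thesis .
qed

lemma spline_space_eq_span:
  assumes nc: "\<not> collinear {v 1, v 2, v 3}"
  shows "spline_space 3 5 v = span (gens v)"
proof
  have "gens v \<subseteq> spline_space 3 5 v"
    using gen_mono_in_space[OF nc] gen_trunc_in_space[OF nc] by (auto simp: gens_def)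
  then show "span (gens v) \<subseteq> spline_space 3 5 v" using subspace_spline_space by (rule span_minimal)
  show "spline_space 3 5 v \<subseteq> span (gens v)"
  proof
    fix f assume f: "f \<in> spline_space 3 5 v"
    obtain H M :: "3 \<Rightarrow> 3 \<Rightarrow> real" where HM: "\<forall>x\<in>triangle_of v. let b = barycentric v x in
     f x = cell_poly v f 3 2 1 (-1) x
       + tpow 4 (b 1 - b 2 - b 3) * lin3 (H 1) b + tpow 4 (b 2 - b 1 - b 3) * lin3 (H 2) b + tpow 4 (b 3 - b 1 - b 2) * lin3 (H 3) b
       + tpow 4 (b 1 - b 2) * lin3 (M 3) b + tpow 4 (b 1 - b 3) * lin3 (M 2) b + tpow 4 (b 2 - b 3) * lin3 (M 1) b"
      using cofactors_exist[OF nc f] by blast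
    let ?g = "\<lambda>n k. on_triangle v (\<lambda>b. tpow 4 (line_form n b) * lin3 k b)"
    have "f x = 0" if "x \<notin> triangle_of v" for x using f that by (simp add: spline_space_def)
    then have "f = (\<lambda>x. if x \<in> triangle_of v then cell_poly v f 3 2 1 (-1) x else 0)
       + ?g 0 (H 1) + ?g (Suc 0) (H 2) + ?g 2 (H 3) + ?g 3 (M 3) + ?g 4 (M 2) + ?g 5 (M 1)"
      using HM by (auto simp: fun_eq_iff on_triangle_def Let_def)
    also have "\<dots> \<in> span (gens v)"
    proof -
      have "is_poly2 5 (cell_poly v f 3 2 1 (-1))" by (rule cell_poly(1)[OF nc f]) simp_all
      then show ?thesis by (intro span_add trunc_times_linear_span poly_span nc) simp_all
    qed
    finally show "f \<in> span (gens v)" .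
  qed
qed

section \<open>The Marsden identity\<close>

text \<open>The dual polynomials, each numbered and arranged as the closed form to which it belongs.\<close>

definition P1 :: "real \<Rightarrow> real \<Rightarrow> real \<Rightarrow> real" where "P1 a b c = a ^ 5"
definition P2 :: "real \<Rightarrow> real \<Rightarrow> real \<Rightarrow> real" where "P2 a b c = a ^ 4 * ((a + b) / 2)"
definition P3 :: "real \<Rightarrow> real \<Rightarrow> real \<Rightarrow> real" where "P3 a b c = a ^ 3 * ((a + b) / 2) ^ 2"
definition P4 :: "real \<Rightarrow> real \<Rightarrow> real \<Rightarrow> real" where "P4 a b c = a ^ 2 * b * ((a + b) / 2) ^ 2"
definition P5 :: "real \<Rightarrow> real \<Rightarrow> real \<Rightarrow> real" where "P5 a b c = a * b * ((a + b) / 2) ^ 2 * ((a + b + c) / 3)"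
definition P6 :: "real \<Rightarrow> real \<Rightarrow> real \<Rightarrow> real" where "P6 a b c = a ^ 3 * ((a + b) / 2) * ((a + c) / 2)"
definition P7 :: "real \<Rightarrow> real \<Rightarrow> real \<Rightarrow> real" where "P7 a b c = a ^ 2 * b * ((a + b) / 2) * ((a + c) / 2)"
definition P8 :: "real \<Rightarrow> real \<Rightarrow> real \<Rightarrow> real" where "P8 a b c = a * b * ((a + b) / 2) * ((b + c) / 2) * ((a + b + c) / 3)"

lemmas P_defs = P1_def P2_def P3_def P4_def P5_def P6_def P7_def P8_def

lemma tpow_flip: "tpow 4 (- x) = x ^ 4 - tpow 4 x"
  by (cases "x = 0") (auto simp: tpow_def unit_step_def)

lemma P_cleared:
  "P1 a b c = (12 * a ^ 5) / 12"
  "P2 a b c = (6 * a ^ 4 * (a + b)) / 12"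
  "P3 a b c = (3 * a ^ 3 * (a + b) ^ 2) / 12"
  "P4 a b c = (3 * a ^ 2 * b * (a + b) ^ 2) / 12"
  "P5 a b c = (a * b * (a + b) ^ 2 * (a + b + c)) / 12"
  "P6 a b c = (3 * a ^ 3 * (a + b) * (a + c)) / 12"
  "P7 a b c = (3 * a ^ 2 * b * (a + b) * (a + c)) / 12"
  "P8 a b c = (a * b * (a + b) * (b + c) * (a + b + c)) / 12"
  by (simp_all add: P_defs power2_eq_square)

text \<open>With \<open>tpow_flip\<close> only one orientation of each line remains, so that the identity becomes polynomial in
\<open>b\<close>, \<open>c\<close> and six independent symbols for the truncated powers. The half orbits of the first, fifth and sixth family
account for their symmetry.\<close>

lemma marsden_reals:
  "(c1 * b1 + c2 * b2 + c3 * b3) ^ 5 = F1 b1 b2 b3 * P1 c1 c2 c3 + F1 b2 b1 b3 * P1 c2 c1 c3 + F1 b3 b1 b2 * P1 c3 c1 c2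
      + F2 b1 b2 b3 * P2 c1 c2 c3 + F2 b1 b3 b2 * P2 c1 c3 c2 + F2 b2 b1 b3 * P2 c2 c1 c3 + F2 b2 b3 b1 * P2 c2 c3 c1
      + F2 b3 b1 b2 * P2 c3 c1 c2 + F2 b3 b2 b1 * P2 c3 c2 c1 + F3 b1 b2 b3 * P3 c1 c2 c3 + F3 b1 b3 b2 * P3 c1 c3 c2
      + F3 b2 b1 b3 * P3 c2 c1 c3 + F3 b2 b3 b1 * P3 c2 c3 c1 + F3 b3 b1 b2 * P3 c3 c1 c2 + F3 b3 b2 b1 * P3 c3 c2 c1
      + F4 b1 b2 b3 * P4 c1 c2 c3 + F4 b1 b3 b2 * P4 c1 c3 c2 + F4 b2 b1 b3 * P4 c2 c1 c3 + F4 b2 b3 b1 * P4 c2 c3 c1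
      + F4 b3 b1 b2 * P4 c3 c1 c2 + F4 b3 b2 b1 * P4 c3 c2 c1 + F5 b1 b2 b3 * P5 c1 c2 c3 + F5 b1 b3 b2 * P5 c1 c3 c2
      + F5 b2 b3 b1 * P5 c2 c3 c1 + F6 b1 b2 b3 * P6 c1 c2 c3 + F6 b2 b1 b3 * P6 c2 c1 c3 + F6 b3 b1 b2 * P6 c3 c1 c2
      + F7 b1 b2 b3 * P7 c1 c2 c3 + F7 b1 b3 b2 * P7 c1 c3 c2 + F7 b2 b1 b3 * P7 c2 c1 c3 + F7 b2 b3 b1 * P7 c2 c3 c1
      + F7 b3 b1 b2 * P7 c3 c1 c2 + F7 b3 b2 b1 * P7 c3 c2 c1 + F8 b1 b2 b3 * P8 c1 c2 c3 + F8 b1 b3 b2 * P8 c1 c3 c2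
      + F8 b2 b1 b3 * P8 c2 c1 c3 + F8 b2 b3 b1 * P8 c2 c3 c1 + F8 b3 b1 b2 * P8 c3 c1 c2 + F8 b3 b2 b1 * P8 c3 c2 c1"
proof -
  have fl: "tpow 4 (b2 - b1) = (b1 - b2) ^ 4 - tpow 4 (b1 - b2)" "tpow 4 (b3 - b1) = (b1 - b3) ^ 4 - tpow 4 (b1 - b3)"
      "tpow 4 (b3 - b2) = (b2 - b3) ^ 4 - tpow 4 (b2 - b3)"  "tpow 4 (b1 + b2 - b3) = (b3 - b1 - b2) ^ 4 - tpow 4 (b3 - b1 - b2)"
      "tpow 4 (b1 + b3 - b2) = (b2 - b1 - b3) ^ 4 - tpow 4 (b2 - b1 - b3)" "tpow 4 (b1 - b3 - b2) = tpow 4 (b1 - b2 - b3)"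
      "tpow 4 (b2 + b1 - b3) = (b3 - b1 - b2) ^ 4 - tpow 4 (b3 - b1 - b2)" "tpow 4 (b2 + b3 - b1) = (b1 - b2 - b3) ^ 4
      - tpow 4 (b1 - b2 - b3)" "tpow 4 (b2 - b3 - b1) = tpow 4 (b2 - b1 - b3)" "tpow 4 (b3 + b1 - b2) = (b2 - b1 - b3) ^ 4
      - tpow 4 (b2 - b1 - b3)" "tpow 4 (b3 + b2 - b1) = (b1 - b2 - b3) ^ 4 - tpow 4 (b1 - b2 - b3)"
      "tpow 4 (b3 - b2 - b1) = tpow 4 (b3 - b1 - b2)"
    using tpow_flip[of "b1 - b2"] tpow_flip[of "b1 - b3"] tpow_flip[of "b2 - b3"]
      tpow_flip[of "b1 - b2 - b3"] tpow_flip[of "b2 - b1 - b3"] tpow_flip[of "b3 - b1 - b2"]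
    by (simp_all add: algebra_simps)
  have "12 * (c1 * b1 + c2 * b2 + c3 * b3) ^ 5 = F1 b1 b2 b3 * (12 * c1 ^ 5) + F1 b2 b1 b3 * (12 * c2 ^ 5)
      + F1 b3 b1 b2 * (12 * c3 ^ 5) + F2 b1 b2 b3 * (6 * c1 ^ 4 * (c1 + c2)) + F2 b1 b3 b2 * (6 * c1 ^ 4 * (c1 + c3))
      + F2 b2 b1 b3 * (6 * c2 ^ 4 * (c2 + c1)) + F2 b2 b3 b1 * (6 * c2 ^ 4 * (c2 + c3)) + F2 b3 b1 b2 * (6 * c3 ^ 4 * (c3 + c1))
      + F2 b3 b2 b1 * (6 * c3 ^ 4 * (c3 + c2)) + F3 b1 b2 b3 * (3 * c1 ^ 3 * (c1 + c2) ^ 2)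
      + F3 b1 b3 b2 * (3 * c1 ^ 3 * (c1 + c3) ^ 2) + F3 b2 b1 b3 * (3 * c2 ^ 3 * (c2 + c1) ^ 2)
      + F3 b2 b3 b1 * (3 * c2 ^ 3 * (c2 + c3) ^ 2) + F3 b3 b1 b2 * (3 * c3 ^ 3 * (c3 + c1) ^ 2)
      + F3 b3 b2 b1 * (3 * c3 ^ 3 * (c3 + c2) ^ 2) + F4 b1 b2 b3 * (3 * c1 ^ 2 * c2 * (c1 + c2) ^ 2)
      + F4 b1 b3 b2 * (3 * c1 ^ 2 * c3 * (c1 + c3) ^ 2) + F4 b2 b1 b3 * (3 * c2 ^ 2 * c1 * (c2 + c1) ^ 2)
      + F4 b2 b3 b1 * (3 * c2 ^ 2 * c3 * (c2 + c3) ^ 2) + F4 b3 b1 b2 * (3 * c3 ^ 2 * c1 * (c3 + c1) ^ 2)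
      + F4 b3 b2 b1 * (3 * c3 ^ 2 * c2 * (c3 + c2) ^ 2) + F5 b1 b2 b3 * (c1 * c2 * (c1 + c2) ^ 2 * (c1 + c2 + c3))
      + F5 b1 b3 b2 * (c1 * c3 * (c1 + c3) ^ 2 * (c1 + c3 + c2)) + F5 b2 b3 b1 * (c2 * c3 * (c2 + c3) ^ 2 * (c2 + c3 + c1))
      + F6 b1 b2 b3 * (3 * c1 ^ 3 * (c1 + c2) * (c1 + c3)) + F6 b2 b1 b3 * (3 * c2 ^ 3 * (c2 + c1) * (c2 + c3))
      + F6 b3 b1 b2 * (3 * c3 ^ 3 * (c3 + c1) * (c3 + c2)) + F7 b1 b2 b3 * (3 * c1 ^ 2 * c2 * (c1 + c2) * (c1 + c3))
      + F7 b1 b3 b2 * (3 * c1 ^ 2 * c3 * (c1 + c3) * (c1 + c2)) + F7 b2 b1 b3 * (3 * c2 ^ 2 * c1 * (c2 + c1) * (c2 + c3))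
      + F7 b2 b3 b1 * (3 * c2 ^ 2 * c3 * (c2 + c3) * (c2 + c1)) + F7 b3 b1 b2 * (3 * c3 ^ 2 * c1 * (c3 + c1) * (c3 + c2))
      + F7 b3 b2 b1 * (3 * c3 ^ 2 * c2 * (c3 + c2) * (c3 + c1)) + F8 b1 b2 b3 * (c1 * c2 * (c1 + c2) * (c2 + c3) * (c1 + c2 + c3))
      + F8 b1 b3 b2 * (c1 * c3 * (c1 + c3) * (c3 + c2) * (c1 + c3 + c2))
      + F8 b2 b1 b3 * (c2 * c1 * (c2 + c1) * (c1 + c3) * (c2 + c1 + c3))
      + F8 b2 b3 b1 * (c2 * c3 * (c2 + c3) * (c3 + c1) * (c2 + c3 + c1))
      + F8 b3 b1 b2 * (c3 * c1 * (c3 + c1) * (c1 + c2) * (c3 + c1 + c2))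
      + F8 b3 b2 b1 * (c3 * c2 * (c3 + c2) * (c2 + c1) * (c3 + c2 + c1))"
    unfolding F_defs tpow_unfold(1) fl by algebra
  then show ?thesis
    unfolding P_cleared times_divide_eq_right add_divide_distrib[symmetric] by simp
qed

section \<open>Independence of the generators\<close>

text \<open>A family with only the trivial linear relation is injective, so its image is independent and has as many elements as the index set.\<close>

lemma independent_family:
  fixes g :: "'i \<Rightarrow> 'a::real_vector"
  assumes I: "finite I" and zero: "\<And>a. (\<Sum>t\<in>I. a t *\<^sub>R g t) = 0 \<Longrightarrow> \<forall>t\<in>I. a t = 0"
  shows "independent (g ` I)" "card (g ` I) = card I"
proof -
  have inj: "inj_on g I"
  proof (rule inj_onI, rule ccontr)
    fix s t assume st: "s \<in> I" "t \<in> I" "g s = g t" "s \<noteq> t"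
    define a where "a = (\<lambda>l. (if l = s then 1 else 0) - (if l = t then 1 else (0::real)))"
    have "(\<Sum>l\<in>I. a l *\<^sub>R g l) = (\<Sum>l\<in>I. if l = s then g l else 0) - (\<Sum>l\<in>I. if l = t then g l else 0)"
      unfolding a_def scaleR_diff_left sum_subtractf by (simp add: if_distrib[of "\<lambda>c. c *\<^sub>R _"] cong: if_cong)
    also have "\<dots> = 0" using I st by simp
    finally have "a s = 0" using zero st(1) by blast
    then show False using st(4) by (simp add: a_def)
  qed
  then show "card (g ` I) = card I" by (rule card_image)
  show "independent (g ` I)"
  proof
    assume "dependent (g ` I)"
    then obtain u where u: "\<exists>v\<in>g ` I. u v \<noteq> 0" "(\<Sum>v\<in>g ` I. u v *\<^sub>R v) = 0"
      using dependent_finite[OF finite_imageI[OF I]] by blast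
    have "(\<Sum>t\<in>I. (u \<circ> g) t *\<^sub>R g t) = 0" using u(2) by (simp add: sum.reindex[OF inj])
    then have "\<forall>t\<in>I. (u \<circ> g) t = 0" by (rule zero)
    then show False using u(1) by auto
  qed
qed

lemma polyfun_zero_on_interval:
  fixes c :: "nat \<Rightarrow> real"
  assumes "\<And>s. l < s \<Longrightarrow> s < u \<Longrightarrow> (\<Sum>i\<le>n. c i * s ^ i) = 0" "l < u" "i \<le> n"
  shows "c i = 0"
proof -
  have "infinite {l<..<u}" using assms(2) by simp
  then have "infinite {s. (\<Sum>i\<le>n. c i * s ^ i) = 0}"
    by (rule infinite_super[rotated]) (use assms(1) in auto)
  then show ?thesis using polyfun_roots_finite[of c i n] assms(3) by blast
qed

definition generator :: "(3 \<Rightarrow> real^2) \<Rightarrow> (nat \<times> nat) + (nat \<times> 3) \<Rightarrow> real^2 \<Rightarrow> real" where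
  "generator v t = on_triangle v (case t of Inl (i, j) \<Rightarrow> gen_mono i j | Inr (n, k) \<Rightarrow> gen_trunc n k)"

definition generator_indices :: "((nat \<times> nat) + (nat \<times> 3)) set" where
  "generator_indices = Inl ` (SIGMA i:{..5}. {..5 - i}) \<union> Inr ` ({..<6} \<times> UNIV)"

lemma gens_eq_image: "gens v = generator v ` generator_indices"
proof -
  have "i + j \<le> 5 \<longleftrightarrow> (i, j) \<in> (SIGMA i:{..5}. {..5 - i})" for i j :: nat by auto
  then show ?thesis
    unfolding gens_def generator_indices_def image_Un image_image generator_def
    by (auto simp: image_iff; blast)
qed

lemma card_generator_indices: "finite generator_indices" "card generator_indices = 39"
proof -
  have "card (SIGMA i:{..5::nat}. {..5 - i}) = 21"
    by (simp add: card_SigmaI atMost_Suc eval_nat_numeral)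
  moreover have "card ({..<6::nat} \<times> (UNIV :: 3 set)) = 18" by (simp add: card_cartesian_product)
  ultimately show "card generator_indices = 39"
    unfolding generator_indices_def by (subst card_Un_disjoint) (auto simp: card_image)
  show "finite generator_indices" by (auto simp: generator_indices_def)
qed

text \<open>Near a point of the cell where all six forms are negative only the polynomial part is visible, so it vanishes. The other cells are
then visited in an order in which each shows exactly one new truncated power, and three points in general position
show that its linear factor vanishes.\<close>

lemma generators_unique:
  fixes a :: "nat \<Rightarrow> nat \<Rightarrow> real" and K :: "nat \<Rightarrow> 3 \<Rightarrow> real"
  assumes H: "\<And>b1 b2 b3. 0 \<le> b1 \<Longrightarrow> 0 \<le> b2 \<Longrightarrow> 0 \<le> b3 \<Longrightarrow> b1 + b2 + b3 = 1 \<Longrightarrow>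
      (\<Sum>i\<le>5. \<Sum>j\<le>5 - i. a i j * b1 ^ i * b2 ^ j)
       + tpow 4 (b1 - b2 - b3) * (K 0 1 * b1 + K 0 2 * b2 + K 0 3 * b3)
       + tpow 4 (b2 - b1 - b3) * (K 1 1 * b1 + K 1 2 * b2 + K 1 3 * b3)
       + tpow 4 (b3 - b1 - b2) * (K 2 1 * b1 + K 2 2 * b2 + K 2 3 * b3)
       + tpow 4 (b1 - b2) * (K 3 1 * b1 + K 3 2 * b2 + K 3 3 * b3)
       + tpow 4 (b1 - b3) * (K 4 1 * b1 + K 4 2 * b2 + K 4 3 * b3)
       + tpow 4 (b2 - b3) * (K 5 1 * b1 + K 5 2 * b2 + K 5 3 * b3) = 0"
  shows "i + j \<le> 5 \<Longrightarrow> a i j = 0" "n < 6 \<Longrightarrow> K n k = 0"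
proof -
  have a0: "a i j = 0" if ij: "i + j \<le> 5" for i j
  proof -
    have "(\<Sum>j\<le>5 - i. a i j * t ^ j) = 0" if t: "7/20 < t" "t < 37/100" and i: "i \<le> 5" for t i
    proof (rule polyfun_zero_on_interval[OF _ _ i])
      show "(\<Sum>i\<le>5. (\<Sum>j\<le>5 - i. a i j * t ^ j) * s ^ i) = 0" if s: "1/5 < s" "s < 11/50" for s
      proof -
        have "(\<Sum>i\<le>5. \<Sum>j\<le>5 - i. a i j * s ^ i * t ^ j) = 0"
          using H[of s t "1 - s - t"] s t by (simp add: tpow_nonpos)
        then show ?thesis by (simp add: sum_distrib_left sum_distrib_right mult_ac)
      qed
    qed simp
    then have "a i j = 0" if "i \<le> 5" "j \<le> 5 - i" for i j
      using polyfun_zero_on_interval[where l = "7/20" and u = "37/100" and n = "5 - i" and c = "a i" and i = j] that by simp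
    then show ?thesis using ij by simp
  qed
  then have S0: "(\<Sum>i\<le>5. \<Sum>j\<le>5 - i. a i j * b1 ^ i * b2 ^ j) = 0" for b1 b2
    by (intro sum.neutral) auto
  note H' = H[unfolded S0 add_0]
  have z2: "K 2 1 = 0 \<and> K 2 2 = 0 \<and> K 2 3 = 0"
  proof -
    have "K 2 1 * (10/100) + K 2 2 * (20/100) + K 2 3 * (70/100) = 0" "K 2 1 * (11/100) + K 2 2 * (19/100) + K 2 3 * (70/100) = 0" "K 2 1 * (10/100) + K 2 2 * (21/100) + K 2 3 * (69/100) = 0"
      using H'[of "10/100" "20/100" "70/100"] H'[of "11/100" "19/100" "70/100"] H'[of "10/100" "21/100" "69/100"]
      by (simp_all add:  tpow_nonpos tpow_pos)
    then have "K 2 1 = 0" "K 2 2 = 0" "K 2 3 = 0" by - linarith+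
    then show ?thesis by blast
  qed
  have z3: "K 3 1 = 0 \<and> K 3 2 = 0 \<and> K 3 3 = 0"
  proof -
    have "K 3 1 * (35/100) + K 3 2 * (20/100) + K 3 3 * (45/100) = 0" "K 3 1 * (36/100) + K 3 2 * (20/100) + K 3 3 * (44/100) = 0" "K 3 1 * (34/100) + K 3 2 * (21/100) + K 3 3 * (45/100) = 0"
      using H'[of "35/100" "20/100" "45/100"] H'[of "36/100" "20/100" "44/100"] H'[of "34/100" "21/100" "45/100"]
      by (simp_all add: z2 tpow_nonpos tpow_pos)
    then have "K 3 1 = 0" "K 3 2 = 0" "K 3 3 = 0" by - linarith+
    then show ?thesis by blast
  qed
  have z5: "K 5 1 = 0 \<and> K 5 2 = 0 \<and> K 5 3 = 0"
  proof -
    have "K 5 1 * (20/100) + K 5 2 * (45/100) + K 5 3 * (35/100) = 0" "K 5 1 * (20/100) + K 5 2 * (44/100) + K 5 3 * (36/100) = 0" "K 5 1 * (21/100) + K 5 2 * (45/100) + K 5 3 * (34/100) = 0"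
      using H'[of "20/100" "45/100" "35/100"] H'[of "20/100" "44/100" "36/100"] H'[of "21/100" "45/100" "34/100"]
      by (simp_all add: z2 z3 tpow_nonpos tpow_pos)
    then have "K 5 1 = 0" "K 5 2 = 0" "K 5 3 = 0" by - linarith+
    then show ?thesis by blast
  qed
  have z4: "K 4 1 = 0 \<and> K 4 2 = 0 \<and> K 4 3 = 0"
  proof -
    have "K 4 1 * (45/100) + K 4 2 * (20/100) + K 4 3 * (35/100) = 0" "K 4 1 * (44/100) + K 4 2 * (20/100) + K 4 3 * (36/100) = 0" "K 4 1 * (45/100) + K 4 2 * (21/100) + K 4 3 * (34/100) = 0"
      using H'[of "45/100" "20/100" "35/100"] H'[of "44/100" "20/100" "36/100"] H'[of "45/100" "21/100" "34/100"]
      by (simp_all add: z2 z3 z5 tpow_nonpos tpow_pos)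
    then have "K 4 1 = 0" "K 4 2 = 0" "K 4 3 = 0" by - linarith+
    then show ?thesis by blast
  qed
  have z0: "K 0 1 = 0 \<and> K 0 2 = 0 \<and> K 0 3 = 0"
  proof -
    have "K 0 1 * (70/100) + K 0 2 * (20/100) + K 0 3 * (10/100) = 0" "K 0 1 * (70/100) + K 0 2 * (19/100) + K 0 3 * (11/100) = 0" "K 0 1 * (69/100) + K 0 2 * (21/100) + K 0 3 * (10/100) = 0"
      using H'[of "70/100" "20/100" "10/100"] H'[of "70/100" "19/100" "11/100"] H'[of "69/100" "21/100" "10/100"]
      by (simp_all add: z2 z3 z5 z4 tpow_nonpos tpow_pos)
    then have "K 0 1 = 0" "K 0 2 = 0" "K 0 3 = 0" by - linarith+
    then show ?thesis by blast
  qed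
  have z1: "K 1 1 = 0 \<and> K 1 2 = 0 \<and> K 1 3 = 0"
  proof -
    have "K 1 1 * (20/100) + K 1 2 * (70/100) + K 1 3 * (10/100) = 0" "K 1 1 * (19/100) + K 1 2 * (70/100) + K 1 3 * (11/100) = 0" "K 1 1 * (21/100) + K 1 2 * (69/100) + K 1 3 * (10/100) = 0"
      using H'[of "20/100" "70/100" "10/100"] H'[of "19/100" "70/100" "11/100"] H'[of "21/100" "69/100" "10/100"]
      by (simp_all add: z2 z3 z5 z4 z0 tpow_nonpos tpow_pos)
    then have "K 1 1 = 0" "K 1 2 = 0" "K 1 3 = 0" by - linarith+
    then show ?thesis by blast
  qed
  show "i + j \<le> 5 \<Longrightarrow> a i j = 0" by (rule a0)
  show "K n k = 0" if "n < 6"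
    using that
  proof -
    have "K n 1 = 0 \<and> K n 2 = 0 \<and> K n 3 = 0"
      using that by (cases rule: less_6_cases) (use z0 z1 z2 z3 z4 z5 in simp_all)
    then show ?thesis using forall_3[of "\<lambda>i. K n i = 0"] by blast
  qed
qed

lemma gens_independent:
  assumes nc: "\<not> collinear {v 1, v 2, v 3}"
  shows "independent (gens v)" "card (gens v) = 39"
proof -
  \<comment> \<open>a vanishing combination of functions is evaluated at the point with prescribed coordinates\<close>
  have zero: "\<forall>t\<in>generator_indices. c t = 0" if c: "(\<Sum>t\<in>generator_indices. c t *\<^sub>R generator v t) = 0" for c
  proof -
    define a where "a = (\<lambda>i j. c (Inl (i, j)))"
    define K where "K = (\<lambda>n k. c (Inr (n, k)))"
    have fin: "finite (Inl ` (SIGMA i:{..5::nat}. {..5 - i}) :: ((nat \<times> nat) + (nat \<times> 3)) set)"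
      "finite (Inr ` ({..<6::nat} \<times> (UNIV :: 3 set)) :: ((nat \<times> nat) + (nat \<times> 3)) set)" by auto
    have split: "(\<Sum>t\<in>generator_indices. f t) = (\<Sum>i\<le>5. \<Sum>j\<le>5 - i. f (Inl (i, j))) + (\<Sum>n<6. \<Sum>k\<in>UNIV. f (Inr (n, k)))"
      for f :: "_ \<Rightarrow> real"
      unfolding generator_indices_def
      by (subst sum.union_disjoint[OF fin]) (auto simp: sum.reindex sum.Sigma sum.cartesian_product)
    have H: "(\<Sum>i\<le>5. \<Sum>j\<le>5 - i. a i j * b1 ^ i * b2 ^ j)
       + tpow 4 (b1 - b2 - b3) * (K 0 1 * b1 + K 0 2 * b2 + K 0 3 * b3)
       + tpow 4 (b2 - b1 - b3) * (K 1 1 * b1 + K 1 2 * b2 + K 1 3 * b3)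
       + tpow 4 (b3 - b1 - b2) * (K 2 1 * b1 + K 2 2 * b2 + K 2 3 * b3)
       + tpow 4 (b1 - b2) * (K 3 1 * b1 + K 3 2 * b2 + K 3 3 * b3)
       + tpow 4 (b1 - b3) * (K 4 1 * b1 + K 4 2 * b2 + K 4 3 * b3)
       + tpow 4 (b2 - b3) * (K 5 1 * b1 + K 5 2 * b2 + K 5 3 * b3) = 0"
      if b: "0 \<le> b1" "0 \<le> b2" "0 \<le> b3" "b1 + b2 + b3 = 1" for b1 b2 b3
    proof -
      define b :: "3 \<Rightarrow> real" where "b = (\<lambda>i. if i = 1 then b1 else if i = 2 then b2 else b3)"
      have bv: "b 1 = b1" "b 2 = b2" "b 3 = b3" by (simp_all add: b_def)
      obtain x where x: "barycentric v x = b" using bary_surj[OF nc, of b] b(4) bv by metis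
      have "x \<in> triangle_of v" using b(1-3) by (simp add: mem_triangle_iff[OF nc] x b_def)
      moreover have "(\<Sum>t\<in>generator_indices. c t * generator v t x) = 0"
        using fun_cong[OF c, of x] by (simp add: sum_fun_apply scaleR_fun_def)
      ultimately have "(\<Sum>i\<le>5. \<Sum>j\<le>5 - i. a i j * (b 1 ^ i * b 2 ^ j)) + (\<Sum>n<6. \<Sum>k\<in>UNIV. K n k * (b k * tpow 4 (line_form n b))) = 0"
        unfolding split by (simp add: generator_def on_triangle_def x gen_mono_def gen_trunc_def a_def K_def)
      moreover have "(\<Sum>n<6. f n) = f 0 + f (Suc 0) + f 2 + f 3 + f 4 + f 5" for f :: "nat \<Rightarrow> real"
        by (simp add: eval_nat_numeral)
      ultimately have "(\<Sum>i\<le>5. \<Sum>j\<le>5 - i. a i j * b1 ^ i * b2 ^ j) + ((\<Sum>k\<in>UNIV. K 0 k * (b k * tpow 4 (b1 - b2 - b3)))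
          + (\<Sum>k\<in>UNIV. K 1 k * (b k * tpow 4 (b2 - b1 - b3))) + (\<Sum>k\<in>UNIV. K 2 k * (b k * tpow 4 (b3 - b1 - b2)))
          + (\<Sum>k\<in>UNIV. K 3 k * (b k * tpow 4 (b1 - b2))) + (\<Sum>k\<in>UNIV. K 4 k * (b k * tpow 4 (b1 - b3)))
          + (\<Sum>k\<in>UNIV. K 5 k * (b k * tpow 4 (b2 - b3)))) = 0"
        unfolding bv by (simp only: line_form_simps bv mult.assoc One_nat_def)
      then show ?thesis unfolding sum_3 bv by (simp only: distrib_left mult_ac add_ac)
    qed
    have "c (Inl (i, j)) = 0" if "i + j \<le> 5" for i j
      using generators_unique(1)[of a K, OF H that] unfolding a_def .
    moreover have "c (Inr (n, k)) = 0" if "n < 6" for n k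
      using generators_unique(2)[of a K, OF H that] unfolding K_def .
    ultimately show ?thesis unfolding generator_indices_def by auto
  qed
  show "independent (gens v)"
    unfolding gens_eq_image by (rule independent_family(1)[OF card_generator_indices(1) zero])
  show "card (gens v) = 39"
    unfolding gens_eq_image
    by (rule trans[OF independent_family(2)[OF card_generator_indices(1) zero] card_generator_indices(2)])
qed

section \<open>Comparing the two spanning families\<close>

lemma on_triangle_closed:
  assumes W: "subspace W"
  shows on_triangle_add: "on_triangle v G \<in> W \<Longrightarrow> on_triangle v H \<in> W \<Longrightarrow> on_triangle v (\<lambda>b. G b + H b) \<in> W"
    and on_triangle_cmult: "on_triangle v G \<in> W \<Longrightarrow> on_triangle v (\<lambda>b. c * G b) \<in> W"
proof -
  have "on_triangle v (\<lambda>b. G b + H b) = on_triangle v G + on_triangle v H"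
    "on_triangle v (\<lambda>b. c * G b) = c *\<^sub>R on_triangle v G"
    by (auto simp: fun_eq_iff on_triangle_def scaleR_fun_def)
  then show "on_triangle v G \<in> W \<Longrightarrow> on_triangle v H \<in> W \<Longrightarrow> on_triangle v (\<lambda>b. G b + H b) \<in> W"
    "on_triangle v G \<in> W \<Longrightarrow> on_triangle v (\<lambda>b. c * G b) \<in> W"
    using subspace_add[OF W] subspace_scale[OF W] by simp_all
qed

lemma trunc_to_eq: "trunc_to v F i j k = on_triangle v (\<lambda>b. F (b i) (b j) (b k))"
  by (simp add: trunc_to_def on_triangle_def)

text \<open>The form needed for membership in a span: scalars times monomials or times products of a coordinate and a truncated fourth power.\<close>

lemma F_expand:
  "F1 x y z = x * tpow 4 (x - y - z) + (-1) * (y * tpow 4 (x - y - z)) + (-1) * (z * tpow 4 (x - y - z))"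
  "F2 x y z = 10 * (y * tpow 4 (x - y - z))"
  "F3 x y z = 4 * (x * tpow 4 (x - z)) + (-4) * (z * tpow 4 (x - z))
     + (-4) * (x * tpow 4 (x - y - z)) + (-16) * (y * tpow 4 (x - y - z)) + 4 * (z * tpow 4 (x - y - z))"
  "F4 x y z = 20 * (y * tpow 4 (x - z)) + 8 * (z * tpow 4 (x - z)) + (-8) * (x * tpow 4 (x - z))
     + 8 * (x * tpow 4 (x - y - z)) + 12 * (y * tpow 4 (x - y - z)) + (-8) * (z * tpow 4 (x - y - z))"
  "F5 x y z = 3 * (x * tpow 4 (x + y - z)) + 3 * (y * tpow 4 (x + y - z)) + (-3) * (z * tpow 4 (x + y - z))
     + 12 * (x * tpow 4 (x - z)) + (-60) * (y * tpow 4 (x - z)) + (-12) * (z * tpow 4 (x - z))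
     + 12 * (y * tpow 4 (y - z)) + (-60) * (x * tpow 4 (y - z)) + (-12) * (z * tpow 4 (y - z))
     + (-15) * (x * tpow 4 (x - y - z)) + (-15) * (y * tpow 4 (x - y - z)) + 15 * (z * tpow 4 (x - y - z))
     + (-15) * (x * tpow 4 (y - x - z)) + (-15) * (y * tpow 4 (y - x - z)) + 15 * (z * tpow 4 (y - x - z))"
  "F6 x y z = 4 * x ^ 5 + (-4) * (x * tpow 4 (x - z)) + 4 * (z * tpow 4 (x - z))
     + (-4) * (x * tpow 4 (x - y)) + 4 * (y * tpow 4 (x - y))
     + 4 * (x * tpow 4 (x - y - z)) + (-4) * (y * tpow 4 (x - y - z)) + (-4) * (z * tpow 4 (x - y - z))"
  "F7 x y z = 4 * x ^ 5 + (-4) * (x * tpow 4 (x - z)) + 4 * (z * tpow 4 (x - z))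
     + (-4) * (x * tpow 4 (x - y)) + (-16) * (y * tpow 4 (x - y))
     + 4 * (x * tpow 4 (x - y - z)) + 16 * (y * tpow 4 (x - y - z)) + (-4) * (z * tpow 4 (x - y - z))"
  "F8 x y z = 36 * x ^ 5 + (-120) * (x ^ 4 * y) + 120 * (x ^ 3 * y ^ 2)
     + (-3) * (x * tpow 4 (x + y - z)) + (-3) * (y * tpow 4 (x + y - z)) + 3 * (z * tpow 4 (x + y - z))
     + (-36) * (x * tpow 4 (x - y)) + (-24) * (y * tpow 4 (x - y))
     + (-12) * (x * tpow 4 (x - z)) + 60 * (y * tpow 4 (x - z)) + 12 * (z * tpow 4 (x - z))
     + 12 * (y * tpow 4 (y - z)) + (-12) * (z * tpow 4 (y - z))
     + 15 * (x * tpow 4 (x - y - z)) + 15 * (y * tpow 4 (x - y - z)) + (-15) * (z * tpow 4 (x - y - z))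
     + (-21) * (x * tpow 4 (y - x - z)) + (-9) * (y * tpow 4 (y - x - z)) + 9 * (z * tpow 4 (y - x - z))"
  unfolding F_defs tpow_unfold(1) by - algebra+

lemma poly_on_triangle_span:
  assumes nc: "\<not> collinear {v 1, v 2, v 3}" and "is_poly2 5 (\<lambda>x. G (barycentric v x))"
  shows "on_triangle v G \<in> span (gens v)"
  using poly_span[OF assms] by (simp add: on_triangle_def)

text \<open>The sign is left open as truncated powers of opposite forms differ by a polynomial.\<close>

definition split_line :: "((3 \<Rightarrow> real) \<Rightarrow> real) \<Rightarrow> bool" where
  "split_line l \<longleftrightarrow> (\<exists>n<6. (\<forall>b. l b = line_form n b) \<or> (\<forall>b. l b = - line_form n b))"

lemma distinct3_cases:
  assumes "i \<noteq> j" "j \<noteq> k" "i \<noteq> (k :: 3)"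
  obtains "i = 1" "j = 2" "k = 3" | "i = 1" "j = 3" "k = 2" | "i = 2" "j = 1" "k = 3"
    | "i = 2" "j = 3" "k = 1" | "i = 3" "j = 1" "k = 2" | "i = 3" "j = 2" "k = 1"
  using assms exhaust_3[of i] exhaust_3[of j] exhaust_3[of k] by blast

lemma split_line_distinct:
  assumes d: "i \<noteq> j" "j \<noteq> k" "i \<noteq> k"
  shows "split_line (\<lambda>b. b i - b j)" "split_line (\<lambda>b. b i - b j - b k)" "split_line (\<lambda>b. b i + b j - b k)"
proof -
  have I: "split_line l" if "(\<forall>b. l b = line_form n b) \<or> (\<forall>b. l b = - line_form n b)" "n < 6" for n l
    using that unfolding split_line_def by blast
  show "split_line (\<lambda>b. b i - b j)" "split_line (\<lambda>b. b i - b j - b k)" "split_line (\<lambda>b. b i + b j - b k)"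
    by - (rule distinct3_cases[OF d]; simp only:;
       ((rule I[of _ 0], (simp add: algebra_simps; fail), simp; fail)
        | (rule I[of _ "Suc 0"], (simp add: algebra_simps; fail), simp; fail)
        | (rule I[of _ 2], (simp add: algebra_simps; fail), simp; fail)
        | (rule I[of _ 3], (simp add: algebra_simps; fail), simp; fail)
        | (rule I[of _ 4], (simp add: algebra_simps; fail), simp; fail)
        | (rule I[of _ 5], (simp add: algebra_simps; fail), simp; fail)))+
qed

lemma trunc_span:
  assumes nc: "\<not> collinear {v 1, v 2, v 3}" and l: "split_line l"
  shows "on_triangle v (\<lambda>b. b m * tpow 4 (l b)) \<in> span (gens v)"
proof -
  obtain n where n: "n < 6" and e: "(\<forall>b. l b = line_form n b) \<or> (\<forall>b. l b = - line_form n b)"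
    using l unfolding split_line_def by blast
  have base: "on_triangle v (\<lambda>b. b m * tpow 4 (line_form n b)) \<in> span (gens v)"
    by (rule span_base) (use n in \<open>auto simp: gens_def gen_trunc_def[abs_def]\<close>)
  from e show ?thesis
  proof
    assume "\<forall>b. l b = line_form n b"
    then show ?thesis using base by simp
  next
    assume e: "\<forall>b. l b = - line_form n b"
    obtain A c where A: "\<And>x. line_form n (barycentric v x) = A \<bullet> x + c" using line_form_affine[OF nc n] by blast
    have "is_poly2 (1 + 1 * 4) (\<lambda>x. barycentric v x m * line_form n (barycentric v x) ^ 4)"
      unfolding A by (intro is_poly2_mult is_poly2_power is_poly2_affine is_poly2_bary nc)
    then have "on_triangle v (\<lambda>b. b m * line_form n b ^ 4) \<in> span (gens v)"
      by (intro poly_on_triangle_span nc) simp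
    then have "on_triangle v (\<lambda>b. b m * line_form n b ^ 4 + (-1) * (b m * tpow 4 (line_form n b))) \<in> span (gens v)"
      using base by (intro on_triangle_add on_triangle_cmult subspace_span)
    then show ?thesis using e by (simp add: tpow_flip algebra_simps)
  qed
qed

lemma F_span:
  assumes nc: "\<not> collinear {v 1, v 2, v 3}" and d: "i \<noteq> j" "j \<noteq> k" "i \<noteq> k"
    and F: "F \<in> {F1, F2, F3, F4, F5, F6, F7, F8}"
  shows "trunc_to v F i j k \<in> span (gens v)"
proof -
  note i = on_triangle_add on_triangle_cmult subspace_span
  have poly: "on_triangle v (\<lambda>b. b i ^ 5) \<in> span (gens v)"
    "on_triangle v (\<lambda>b. b i ^ 4 * b j) \<in> span (gens v)"
    "on_triangle v (\<lambda>b. b i ^ 3 * b j ^ 2) \<in> span (gens v)"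
    by (rule poly_on_triangle_span[OF nc], rule is_poly2_mono[rotated, OF order_refl[of 5]],
       use is_poly2_power[OF is_poly2_bary[OF nc, of i], of 5]
         is_poly2_mult[OF is_poly2_power[OF is_poly2_bary[OF nc, of i], of 4] is_poly2_bary[OF nc, of j]]
         is_poly2_mult[OF is_poly2_power[OF is_poly2_bary[OF nc, of i], of 3] is_poly2_power[OF is_poly2_bary[OF nc, of j], of 2]]
       in simp)+
  have t1: "on_triangle v (\<lambda>b. b m * tpow 4 (b i - b j)) \<in> span (gens v)"
    and t2: "on_triangle v (\<lambda>b. b m * tpow 4 (b i - b j - b k)) \<in> span (gens v)"
    and t3: "on_triangle v (\<lambda>b. b m * tpow 4 (b i + b j - b k)) \<in> span (gens v)"
    if "i \<noteq> j" "j \<noteq> k" "i \<noteq> k" for m i j k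
    by (intro trunc_span nc split_line_distinct[OF that])+
  note t = t1[OF d] t1[of k i j] t1[of j i k] t1[of i k j] t1[of j k i] t2[OF d] t2[of j i k] t3[OF d]
  show ?thesis
    using F d unfolding trunc_to_eq
    by (elim insertE emptyE; simp only: F_expand; intro i t poly; simp)
qed

lemma lin3_unit: "lin3 (\<lambda>n. if n = m then 1 else 0) b = b m"
  using exhaust_3[of m] by (auto simp: lin3_def)

text \<open>Polarization of a product of five factors; \<open>1920 = 2 ^ 4 * 5!\<close>.\<close>

lemma polarization5:
  fixes x1 x2 x3 x4 x5 :: real
  shows "1920 * (x1 * x2 * x3 * x4 * x5) =
      (x1 + x2 + x3 + x4 + x5) ^ 5 - (x1 - x2 + x3 + x4 + x5) ^ 5
    - (x1 + x2 - x3 + x4 + x5) ^ 5 + (x1 - x2 - x3 + x4 + x5) ^ 5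
    - (x1 + x2 + x3 - x4 + x5) ^ 5 + (x1 - x2 + x3 - x4 + x5) ^ 5
    + (x1 + x2 - x3 - x4 + x5) ^ 5 - (x1 - x2 - x3 - x4 + x5) ^ 5
    - (x1 + x2 + x3 + x4 - x5) ^ 5 + (x1 - x2 + x3 + x4 - x5) ^ 5
    + (x1 + x2 - x3 + x4 - x5) ^ 5 - (x1 - x2 - x3 + x4 - x5) ^ 5
    + (x1 + x2 + x3 - x4 - x5) ^ 5 - (x1 - x2 + x3 - x4 - x5) ^ 5
    - (x1 + x2 - x3 - x4 - x5) ^ 5 + (x1 - x2 - x3 - x4 - x5) ^ 5"
  by algebra

lemma product_in_subspace:
  assumes W: "subspace W" and pow: "\<And>c. on_triangle v (\<lambda>b. lin3 c b ^ 5) \<in> W"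
    and len: "length ks = 5"
  shows "on_triangle v (\<lambda>b. prod_list (map (\<lambda>k. lin3 k b) ks)) \<in> W"
proof -
  obtain k1 k2 k3 k4 k5 where ks: "ks = [k1, k2, k3, k4, k5]"
    using len by (auto simp: eval_nat_numeral length_Suc_conv)
  have p: "on_triangle v (\<lambda>b. (lin3 k1 b + e2 * lin3 k2 b + e3 * lin3 k3 b + e4 * lin3 k4 b + e5 * lin3 k5 b) ^ 5) \<in> W" for e2 e3 e4 e5
    using pow[of "\<lambda>m. k1 m + e2 * k2 m + e3 * k3 m + e4 * k4 m + e5 * k5 m"]
    by (simp add: lin3_def algebra_simps)
  have "on_triangle v (\<lambda>b.
      (1 / 1920) * (lin3 k1 b + 1 * lin3 k2 b + 1 * lin3 k3 b + 1 * lin3 k4 b + 1 * lin3 k5 b) ^ 5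
      + (-1 / 1920) * (lin3 k1 b + (-1) * lin3 k2 b + 1 * lin3 k3 b + 1 * lin3 k4 b + 1 * lin3 k5 b) ^ 5
      + (-1 / 1920) * (lin3 k1 b + 1 * lin3 k2 b + (-1) * lin3 k3 b + 1 * lin3 k4 b + 1 * lin3 k5 b) ^ 5
      + (1 / 1920) * (lin3 k1 b + (-1) * lin3 k2 b + (-1) * lin3 k3 b + 1 * lin3 k4 b + 1 * lin3 k5 b) ^ 5
      + (-1 / 1920) * (lin3 k1 b + 1 * lin3 k2 b + 1 * lin3 k3 b + (-1) * lin3 k4 b + 1 * lin3 k5 b) ^ 5
      + (1 / 1920) * (lin3 k1 b + (-1) * lin3 k2 b + 1 * lin3 k3 b + (-1) * lin3 k4 b + 1 * lin3 k5 b) ^ 5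
      + (1 / 1920) * (lin3 k1 b + 1 * lin3 k2 b + (-1) * lin3 k3 b + (-1) * lin3 k4 b + 1 * lin3 k5 b) ^ 5
      + (-1 / 1920) * (lin3 k1 b + (-1) * lin3 k2 b + (-1) * lin3 k3 b + (-1) * lin3 k4 b + 1 * lin3 k5 b) ^ 5
      + (-1 / 1920) * (lin3 k1 b + 1 * lin3 k2 b + 1 * lin3 k3 b + 1 * lin3 k4 b + (-1) * lin3 k5 b) ^ 5
      + (1 / 1920) * (lin3 k1 b + (-1) * lin3 k2 b + 1 * lin3 k3 b + 1 * lin3 k4 b + (-1) * lin3 k5 b) ^ 5
      + (1 / 1920) * (lin3 k1 b + 1 * lin3 k2 b + (-1) * lin3 k3 b + 1 * lin3 k4 b + (-1) * lin3 k5 b) ^ 5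
      + (-1 / 1920) * (lin3 k1 b + (-1) * lin3 k2 b + (-1) * lin3 k3 b + 1 * lin3 k4 b + (-1) * lin3 k5 b) ^ 5
      + (1 / 1920) * (lin3 k1 b + 1 * lin3 k2 b + 1 * lin3 k3 b + (-1) * lin3 k4 b + (-1) * lin3 k5 b) ^ 5
      + (-1 / 1920) * (lin3 k1 b + (-1) * lin3 k2 b + 1 * lin3 k3 b + (-1) * lin3 k4 b + (-1) * lin3 k5 b) ^ 5
      + (-1 / 1920) * (lin3 k1 b + 1 * lin3 k2 b + (-1) * lin3 k3 b + (-1) * lin3 k4 b + (-1) * lin3 k5 b) ^ 5
      + (1 / 1920) * (lin3 k1 b + (-1) * lin3 k2 b + (-1) * lin3 k3 b + (-1) * lin3 k4 b + (-1) * lin3 k5 b) ^ 5) \<in> W" (is "on_triangle v ?g \<in> W")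
    by (intro on_triangle_add on_triangle_cmult W p)
  moreover have "?g = (\<lambda>b. prod_list (map (\<lambda>k. lin3 k b) ks))"
  proof
    show "?g b = prod_list (map (\<lambda>k. lin3 k b) ks)" for b
      using polarization5[of "lin3 k1 b" "lin3 k2 b" "lin3 k3 b" "lin3 k4 b" "lin3 k5 b"]
      unfolding ks by (simp add: mult.assoc)
  qed
  ultimately show ?thesis by simp
qed

text \<open>Quintics come from fifth powers of linear forms by polarization. With \<open>h = b i - b j - b k\<close>, the first two families contain
\<open>h\<^sub>+\<^sup>5\<close>, \<open>b j h\<^sub>+\<^sup>4\<close> and \<open>b k h\<^sub>+\<^sup>4\<close>, which settles the midlines. Modulo these and the quintics, and with
\<open>m = b i - b k\<close>, the third family contains \<open>m\<^sub>+\<^sup>5\<close>, the fourth then \<open>b j m\<^sub>+\<^sup>4\<close>, and the seventh then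
\<open>(b i + 4 b k) m\<^sub>+\<^sup>4\<close>, which settles the medians.\<close>

lemma gens_subset:
  assumes nc: "\<not> collinear {v 1, v 2, v 3}" and W: "subspace W"
    and pow: "\<And>c. on_triangle v (\<lambda>b. lin3 c b ^ 5) \<in> W"
    and F: "\<And>F i j k. F \<in> {F1, F2, F3, F4, F7} \<Longrightarrow> i \<noteq> j \<Longrightarrow> j \<noteq> k \<Longrightarrow> i \<noteq> k \<Longrightarrow> trunc_to v F i j k \<in> W"
  shows "gens v \<subseteq> W"
proof -
  note W_intros = on_triangle_add[OF W] on_triangle_cmult[OF W]
  have W_eq: "on_triangle v H \<in> W" if "on_triangle v G \<in> W" "\<And>b. G b = H b" for G H
  proof -
    have "G = H" using that(2) by (rule ext)
    then show ?thesis using that(1) by simp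
  qed
  let ?e = "\<lambda>m n. if n = m then 1 else (0::real)"
  have mono: "on_triangle v (gen_mono i j) \<in> W" if ij: "i + j \<le> 5" for i j
  proof -
    \<comment> \<open>multiplying by a power of the coordinate sum makes the monomial homogeneous of degree 5\<close>
    let ?ks = "replicate i (?e 1) @ replicate j (?e 2) @ replicate (5 - (i + j)) (\<lambda>n. 1)"
    have "on_triangle v (gen_mono i j) = on_triangle v (\<lambda>b. prod_list (map (\<lambda>k. lin3 k b) ?ks))"
      using bary_sum[OF nc]
      by (simp add: on_triangle_def fun_eq_iff gen_mono_def lin3_unit prod_list_replicate map_replicate lin3_def[of "\<lambda>n. 1"])
    then show ?thesis using product_in_subspace[OF W pow, of ?ks] ij by simp
  qed
  have pow5: "on_triangle v (\<lambda>b. b i ^ 5) \<in> W" for i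
    using pow[of "?e i"] by (simp add: lin3_unit)
  have midline: "on_triangle v (\<lambda>b. b m * tpow 4 (b i - b j - b k)) \<in> W"
    if d: "i \<noteq> j" "j \<noteq> k" "i \<noteq> k" for i j k m
  proof -
    have "on_triangle v (\<lambda>b. F2 (b i) (b j) (b k)) \<in> W" using F[of F2, OF _ d] by (simp add: trunc_to_eq)
    then have "on_triangle v (\<lambda>b. (1/10) * F2 (b i) (b j) (b k)) \<in> W" by (intro W_intros)
    then have tj: "on_triangle v (\<lambda>b. b j * tpow 4 (b i - b j - b k)) \<in> W"
      by (rule W_eq) (simp add: F2_def)
    have "on_triangle v (\<lambda>b. F2 (b i) (b k) (b j)) \<in> W" using F[of F2 i k j] d by (simp add: trunc_to_eq)
    then have "on_triangle v (\<lambda>b. (1/10) * F2 (b i) (b k) (b j)) \<in> W" by (intro W_intros)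
    then have tk: "on_triangle v (\<lambda>b. b k * tpow 4 (b i - b j - b k)) \<in> W"
      by (rule W_eq) (simp add: F2_def algebra_simps)
    have "on_triangle v (\<lambda>b. F1 (b i) (b j) (b k)) \<in> W" using F[of F1, OF _ d] by (simp add: trunc_to_eq)
    then have "on_triangle v (\<lambda>b. F1 (b i) (b j) (b k) + b j * tpow 4 (b i - b j - b k) + b k * tpow 4 (b i - b j - b k)) \<in> W"
      by (intro W_intros tj tk)
    then have ti: "on_triangle v (\<lambda>b. b i * tpow 4 (b i - b j - b k)) \<in> W"
      by (rule W_eq) (simp add: F_expand)
    have "m = i \<or> m = j \<or> m = k" using distinct3_UNIV[OF d] by blast
    then show ?thesis using ti tj tk by blast
  qed
  have diff: "on_triangle v (\<lambda>b. (b i - b k) * tpow 4 (b i - b k)) \<in> W"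
    if d: "i \<noteq> j" "j \<noteq> k" "i \<noteq> k" for i j k
  proof -
    have "on_triangle v (\<lambda>b. F3 (b i) (b j) (b k)) \<in> W" using F[of F3, OF _ d] by (simp add: trunc_to_eq)
    then have "on_triangle v (\<lambda>b. (1/4) * F3 (b i) (b j) (b k) + b i * tpow 4 (b i - b j - b k)
        + 4 * (b j * tpow 4 (b i - b j - b k)) + (-1) * (b k * tpow 4 (b i - b j - b k))) \<in> W"
      by (intro W_intros midline d)
    then show ?thesis by (rule W_eq) (simp add: F3_def algebra_simps)
  qed
  have median: "on_triangle v (\<lambda>b. b m * tpow 4 (b i - b k)) \<in> W"
    if d: "i \<noteq> j" "j \<noteq> k" "i \<noteq> k" for i j k m
  proof -
    have d': "i \<noteq> k" "k \<noteq> j" "i \<noteq> j" using d by auto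
    have f4: "on_triangle v (\<lambda>b. F4 (b i) (b j) (b k)) \<in> W" using F[of F4, OF _ d] by (simp add: trunc_to_eq)
    have f7: "on_triangle v (\<lambda>b. F7 (b i) (b k) (b j)) \<in> W" using F[of F7, OF _ d'] by (simp add: trunc_to_eq)
    have "on_triangle v (\<lambda>b. (1/20) * F4 (b i) (b j) (b k) + (2/5) * ((b i - b k) * tpow 4 (b i - b k))
          + (-2/5) * (b i * tpow 4 (b i - b j - b k)) + (-3/5) * (b j * tpow 4 (b i - b j - b k)) + (2/5) * (b k * tpow 4 (b i - b j - b k))) \<in> W"
      by (intro W_intros midline diff[OF d] f4 d)
    then have tj: "on_triangle v (\<lambda>b. b j * tpow 4 (b i - b k)) \<in> W"
      by (rule W_eq) (simp add: F4_def algebra_simps)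
    have "on_triangle v (\<lambda>b. (-1/20) * F7 (b i) (b k) (b j) + (1/5) * b i ^ 5 + (-1/5) * ((b i - b j) * tpow 4 (b i - b j))
          + (1/5) * (b i * tpow 4 (b i - b k - b j)) + (4/5) * (b k * tpow 4 (b i - b k - b j)) + (-1/5) * (b j * tpow 4 (b i - b k - b j))
          + (-1/5) * ((b i - b k) * tpow 4 (b i - b k))) \<in> W"
      by (intro W_intros midline diff[OF d] diff[OF d'] pow5 f7 d')
    then have tk: "on_triangle v (\<lambda>b. b k * tpow 4 (b i - b k)) \<in> W"
      by (rule W_eq) (simp add: F7_def algebra_simps)
    have "on_triangle v (\<lambda>b. (b i - b k) * tpow 4 (b i - b k) + b k * tpow 4 (b i - b k)) \<in> W"
      by (intro W_intros diff[OF d] tk)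
    then have ti: "on_triangle v (\<lambda>b. b i * tpow 4 (b i - b k)) \<in> W"
      by (rule W_eq) (simp add: algebra_simps)
    have "m = i \<or> m = j \<or> m = k" using distinct3_UNIV[OF d] by blast
    then show ?thesis using ti tj tk by blast
  qed
  have "on_triangle v (gen_trunc n m) \<in> W" if "n < 6" for n m
    using that
    by (cases rule: less_6_cases)
       (use midline[of 1 2 3 m] midline[of 2 1 3 m] midline[of 3 1 2 m] median[of 1 3 2 m] median[of 1 2 3 m] median[of 2 1 3 m]
        in \<open>simp_all add: gen_trunc_def[abs_def]\<close>)
  then show ?thesis using mono by (auto simp: gens_def)
qed

section \<open>The orbits of the seeds\<close>

definition spline_pairs :: "(3 \<Rightarrow> real^2) \<Rightarrow> (real \<Rightarrow> real \<Rightarrow> real \<Rightarrow> real) \<Rightarrow> (real \<Rightarrow> real \<Rightarrow> real \<Rightarrow> real)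
    \<Rightarrow> (3 \<times> 3 \<times> 3) list \<Rightarrow> ((real^2 \<Rightarrow> real) \<times> ((3 \<Rightarrow> real) \<Rightarrow> real)) list" where
  "spline_pairs v F P ts = map (\<lambda>(i, j, k). (trunc_to v F i j k, \<lambda>c. P (c i) (c j) (c k))) ts"

definition perms3 :: "(3 \<times> 3 \<times> 3) list" where
  "perms3 = [(1, 2, 3), (1, 3, 2), (2, 1, 3), (2, 3, 1), (3, 1, 2), (3, 2, 1)]"

text \<open>Half orbits for the families that are invariant under a transposition, in the order of \<open>marsden_reals\<close>. That the listing has
no repetitions is a consequence of the dimension count.\<close>

definition Bc_listing :: "(3 \<Rightarrow> real^2) \<Rightarrow> ((real^2 \<Rightarrow> real) \<times> ((3 \<Rightarrow> real) \<Rightarrow> real)) list" where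
  "Bc_listing v = spline_pairs v F1 P1 [(1, 2, 3), (2, 1, 3), (3, 1, 2)] @ spline_pairs v F2 P2 perms3
    @ spline_pairs v F3 P3 perms3 @ spline_pairs v F4 P4 perms3
    @ spline_pairs v F5 P5 [(1, 2, 3), (1, 3, 2), (2, 3, 1)]
    @ spline_pairs v F6 P6 [(1, 2, 3), (2, 1, 3), (3, 1, 2)]
    @ spline_pairs v F7 P7 perms3 @ spline_pairs v F8 P8 perms3"

lemma mem_perms3_iff: "(i, j, k) \<in> set perms3 \<longleftrightarrow> i \<noteq> j \<and> j \<noteq> k \<and> i \<noteq> k"
proof
  assume "(i, j, k) \<in> set perms3"
  then show "i \<noteq> j \<and> j \<noteq> k \<and> i \<noteq> k" unfolding perms3_def by (simp, elim disjE) simp_all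
next
  assume "i \<noteq> j \<and> j \<noteq> k \<and> i \<noteq> k"
  then have "i \<noteq> j" "j \<noteq> k" "i \<noteq> k" by blast+
  then show "(i, j, k) \<in> set perms3" by (cases rule: distinct3_cases) (simp_all add: perms3_def)
qed

lemma permutes_perms3:
  assumes "\<pi> permutes (UNIV :: 3 set)"
  shows "(\<pi> 1, \<pi> 2, \<pi> 3) \<in> set perms3"
  using permutes_inj[OF assms] by (simp add: mem_perms3_iff inj_eq)

lemma perms3_permutes:
  assumes "(i, j, k) \<in> set perms3"
  obtains \<pi> where "\<pi> permutes (UNIV :: 3 set)" "\<pi> 1 = i" "\<pi> 2 = j" "\<pi> 3 = k"
proof -
  define \<pi> where "\<pi> = (\<lambda>n :: 3. if n = 1 then i else if n = 2 then j else k)"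
  have e: "\<pi> 1 = i" "\<pi> 2 = j" "\<pi> 3 = k" by (simp_all add: \<pi>_def)
  have d: "i \<noteq> j" "j \<noteq> k" "i \<noteq> k" using assms by (simp_all add: mem_perms3_iff)
  have "inj \<pi>"
  proof
    fix m n :: 3 assume "\<pi> m = \<pi> n"
    then show "m = n" using e d exhaust_3[of m] exhaust_3[of n] by auto
  qed
  then have "bij \<pi>" using finite_UNIV_inj_surj[of \<pi>] by (simp add: bij_def)
  then have "\<pi> permutes UNIV" by (rule bij_imp_permutes) simp
  then show ?thesis using that e by blast
qed

lemma trunc_to_perm:
  assumes nc: "\<not> collinear {v 1, v 2, v 3}" and \<pi>: "\<pi> permutes (UNIV :: 3 set)"
  shows "trunc_to (v \<circ> \<pi>) F i j k = trunc_to v F (\<pi> i) (\<pi> j) (\<pi> k)"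
  unfolding trunc_to_def bary_perm[OF nc \<pi>] triangle_perm[OF \<pi>] o_apply ..

text \<open>The sixth and the seventh seed are centred at the second vertex and are reduced to the closed forms by exchanging
the first two vertices.\<close>

lemma image_seeds:
  assumes nc: "\<not> collinear {v 1, v 2, v 3}"
  shows "(\<lambda>(a, m, \<Psi>). (\<lambda>x. a * simplex_spline v m x, \<Psi>)) ` seeds =
    set (spline_pairs v F1 P1 [(1, 2, 3)] @ spline_pairs v F2 P2 [(1, 2, 3)] @ spline_pairs v F3 P3 [(1, 2, 3)]
     @ spline_pairs v F4 P4 [(1, 2, 3)] @ spline_pairs v F5 P5 [(1, 2, 3)] @ spline_pairs v F6 P6 [(2, 1, 3)]
     @ spline_pairs v F7 P7 [(2, 1, 3)] @ spline_pairs v F8 P8 [(1, 2, 3)])"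
proof -
  let ?\<tau> = "Transposition.transpose (1::3) 2"
  have \<tau>: "?\<tau> permutes UNIV" by (simp add: permutes_swap_id)
  have nc': "\<not> collinear {(v \<circ> ?\<tau>) 1, (v \<circ> ?\<tau>) 2, (v \<circ> ?\<tau>) 3}" using nc collinear_perm[OF \<tau>] by blast
  have \<tau>s: "?\<tau> 1 = 2" "?\<tau> 2 = 1" "?\<tau> 3 = 3" by (simp_all add: Transposition.transpose_def)
  note s = seed_splines[OF nc] seed_splines(6,7)[OF nc', unfolded simplex_spline_swap trunc_to_perm[OF nc \<tau>] \<tau>s]
  have P: "(\<lambda>c :: 3 \<Rightarrow> real. c 1 ^ 5) = (\<lambda>c. P1 (c 1) (c 2) (c 3))"
    "(\<lambda>c :: 3 \<Rightarrow> real. c 1 ^ 4 * ((c 1 + c 2) / 2)) = (\<lambda>c. P2 (c 1) (c 2) (c 3))"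
    "(\<lambda>c :: 3 \<Rightarrow> real. c 1 ^ 3 * ((c 1 + c 2) / 2) ^ 2) = (\<lambda>c. P3 (c 1) (c 2) (c 3))"
    "(\<lambda>c :: 3 \<Rightarrow> real. c 1 ^ 2 * c 2 * ((c 1 + c 2) / 2) ^ 2) = (\<lambda>c. P4 (c 1) (c 2) (c 3))"
    "(\<lambda>c :: 3 \<Rightarrow> real. c 1 * c 2 * ((c 1 + c 2) / 2) ^ 2 * ((c 1 + c 2 + c 3) / 3)) = (\<lambda>c. P5 (c 1) (c 2) (c 3))"
    "(\<lambda>c :: 3 \<Rightarrow> real. c 2 ^ 3 * ((c 1 + c 2) / 2) * ((c 2 + c 3) / 2)) = (\<lambda>c. P6 (c 2) (c 1) (c 3))"
    "(\<lambda>c :: 3 \<Rightarrow> real. c 1 * c 2 ^ 2 * ((c 1 + c 2) / 2) * ((c 2 + c 3) / 2)) = (\<lambda>c. P7 (c 2) (c 1) (c 3))"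
    "(\<lambda>c :: 3 \<Rightarrow> real. c 1 * c 2 * ((c 1 + c 2) / 2) * ((c 2 + c 3) / 2) * ((c 1 + c 2 + c 3) / 3)) = (\<lambda>c. P8 (c 1) (c 2) (c 3))"
    by (simp_all add: fun_eq_iff P_defs add.commute mult.commute)
  show ?thesis
    unfolding seeds_def Let_def P spline_pairs_def
    by (simp only: image_insert image_empty prod.case s list.map append.simps list.set)
qed

definition orbit_pairs :: "(3 \<Rightarrow> real^2) \<Rightarrow> ((real^2 \<Rightarrow> real) \<times> ((3 \<Rightarrow> real) \<Rightarrow> real)) list" where
  "orbit_pairs v = concat (map (\<lambda>(F, P). spline_pairs v F P perms3)
     [(F1, P1), (F2, P2), (F3, P3), (F4, P4), (F5, P5), (F6, P6), (F7, P7), (F8, P8)])"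

lemma orbit_set:
  "(\<Union>\<pi>\<in>{\<pi>. \<pi> permutes UNIV}. set (spline_pairs v F P [(\<pi> 1, \<pi> 2, \<pi> 3)])) = set (spline_pairs v F P perms3)"
  "(\<Union>\<pi>\<in>{\<pi>. \<pi> permutes UNIV}. set (spline_pairs v F P [(\<pi> 2, \<pi> 1, \<pi> 3)])) = set (spline_pairs v F P perms3)"
proof -
  have "(\<lambda>\<pi>. (\<pi> 1, \<pi> 2, \<pi> 3)) ` {\<pi>. \<pi> permutes UNIV} = set perms3" (is "?A = _")
  proof
    show "?A \<subseteq> set perms3" using permutes_perms3 by blast
    show "set perms3 \<subseteq> ?A"
    proof
      fix t assume t: "t \<in> set perms3"
      obtain i j k where e: "t = (i, j, k)" by (cases t)
      obtain \<pi> where "\<pi> permutes (UNIV :: 3 set)" "\<pi> 1 = i" "\<pi> 2 = j" "\<pi> 3 = k"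
        using perms3_permutes[OF t[unfolded e]] .
      then show "t \<in> ?A" unfolding e by (intro image_eqI[of _ _ \<pi>]) simp_all
    qed
  qed
  moreover have "(\<lambda>\<pi>. (\<pi> 2, \<pi> 1, \<pi> 3)) ` {\<pi>. \<pi> permutes UNIV} = set perms3" (is "?B = _")
  proof
    have sw: "(j, i, k) \<in> set perms3" if "(i, j, k) \<in> set perms3" for i j k
      using that unfolding mem_perms3_iff by blast
    show "?B \<subseteq> set perms3" using permutes_perms3 sw by blast
    show "set perms3 \<subseteq> ?B"
    proof
      fix t assume t: "t \<in> set perms3"
      obtain i j k where e: "t = (i, j, k)" by (cases t)
      obtain \<pi> where "\<pi> permutes (UNIV :: 3 set)" "\<pi> 1 = j" "\<pi> 2 = i" "\<pi> 3 = k"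
        using perms3_permutes[OF sw[OF t[unfolded e]]] .
      then show "t \<in> ?B" unfolding e by (intro image_eqI[of _ _ \<pi>]) simp_all
    qed
  qed
  moreover have singletons: "(\<Union>\<pi>\<in>A. set (map f [t \<pi>])) = f ` t ` A" for f :: "'b \<Rightarrow> 'c" and t and A :: "'a set"
    by auto
  ultimately show
    "(\<Union>\<pi>\<in>{\<pi>. \<pi> permutes UNIV}. set (spline_pairs v F P [(\<pi> 1, \<pi> 2, \<pi> 3)])) = set (spline_pairs v F P perms3)"
    "(\<Union>\<pi>\<in>{\<pi>. \<pi> permutes UNIV}. set (spline_pairs v F P [(\<pi> 2, \<pi> 1, \<pi> 3)])) = set (spline_pairs v F P perms3)"
    unfolding spline_pairs_def set_map[of _ perms3] singletons by simp_all
qed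

lemma Bc_eq_orbit_pairs:
  assumes nc: "\<not> collinear {v 1, v 2, v 3}"
  shows "Bc v = set (orbit_pairs v)"
proof -
  let ?f = "\<lambda>\<pi>. \<lambda>(a, m, \<Psi>). (\<lambda>x. a * simplex_spline (v \<circ> \<pi>) m x, \<Psi>)"
  let ?g = "\<lambda>\<pi>. \<lambda>(S :: real^2 \<Rightarrow> real, \<Psi> :: (3 \<Rightarrow> real) \<Rightarrow> real). (S, \<lambda>c. \<Psi> (c \<circ> \<pi>))"
  have "Bc v = (\<Union>\<pi>\<in>{\<pi>. \<pi> permutes UNIV}. ?g \<pi> ` ?f \<pi> ` seeds)"
  proof (intro equalityI subsetI)
    fix p assume "p \<in> Bc v"
    then obtain a m \<Psi> \<pi> where p: "p = (\<lambda>x. a * simplex_spline (v \<circ> \<pi>) m x, \<lambda>c. \<Psi> (c \<circ> \<pi>))"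
      "(a, m, \<Psi>) \<in> seeds" "\<pi> permutes UNIV"
      unfolding Bc_def by blast
    have "p = ?g \<pi> (?f \<pi> (a, m, \<Psi>))" by (simp add: p(1))
    then show "p \<in> (\<Union>\<pi>\<in>{\<pi>. \<pi> permutes UNIV}. ?g \<pi> ` ?f \<pi> ` seeds)" using p(2,3) by blast
  next
    fix p assume "p \<in> (\<Union>\<pi>\<in>{\<pi>. \<pi> permutes UNIV}. ?g \<pi> ` ?f \<pi> ` seeds)"
    then obtain \<pi> q where q: "\<pi> permutes UNIV" "q \<in> seeds" "p = ?g \<pi> (?f \<pi> q)" by blast
    obtain a m \<Psi> where "q = (a, m, \<Psi>)" by (cases q)
    then have "p = (\<lambda>x. a * simplex_spline (v \<circ> \<pi>) m x, \<lambda>c. \<Psi> (c \<circ> \<pi>))" "(a, m, \<Psi>) \<in> seeds"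
      using q(2,3) by simp_all
    then show "p \<in> Bc v" using q(1) unfolding Bc_def by blast
  qed
  also have "\<dots> = (\<Union>\<pi>\<in>{\<pi>. \<pi> permutes UNIV}. set (let t = [(\<pi> 1, \<pi> 2, \<pi> 3)]; t' = [(\<pi> 2, \<pi> 1, \<pi> 3)] in
      spline_pairs v F1 P1 t @ spline_pairs v F2 P2 t @ spline_pairs v F3 P3 t @ spline_pairs v F4 P4 t
     @ spline_pairs v F5 P5 t @ spline_pairs v F6 P6 t' @ spline_pairs v F7 P7 t' @ spline_pairs v F8 P8 t))"
  proof (rule SUP_cong[OF refl])
    fix \<pi> :: "3 \<Rightarrow> 3" assume "\<pi> \<in> {\<pi>. \<pi> permutes UNIV}"
    then have \<pi>: "\<pi> permutes UNIV" by simp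
    have nc': "\<not> collinear {(v \<circ> \<pi>) 1, (v \<circ> \<pi>) 2, (v \<circ> \<pi>) 3}" using nc collinear_perm[OF \<pi>] by blast
    show "?g \<pi> ` ?f \<pi> ` seeds
      = set (let t = [(\<pi> 1, \<pi> 2, \<pi> 3)]; t' = [(\<pi> 2, \<pi> 1, \<pi> 3)] in
      spline_pairs v F1 P1 t @ spline_pairs v F2 P2 t @ spline_pairs v F3 P3 t @ spline_pairs v F4 P4 t
     @ spline_pairs v F5 P5 t @ spline_pairs v F6 P6 t' @ spline_pairs v F7 P7 t' @ spline_pairs v F8 P8 t)"
      unfolding image_seeds[OF nc']
      by (simp only: Let_def spline_pairs_def trunc_to_perm[OF nc \<pi>] list.map prod.case append.simps list.set
          image_insert image_empty o_apply)
  qed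
  also have "\<dots> = set (orbit_pairs v)"
    unfolding Let_def set_append UN_Un_distrib orbit_set
    by (simp add: orbit_pairs_def)
  finally show ?thesis .
qed

lemma orbit_pairs_eq: "set (orbit_pairs v) = set (Bc_listing v)"
proof -
  let ?p = "\<lambda>F P i j k. (trunc_to v F i j k, \<lambda>c. P (c i) (c j) (c k) :: real)"
  have sym1: "?p F1 P1 i k j = ?p F1 P1 i j k" for i j k
    by (auto simp: trunc_to_def F1_def P1_def fun_eq_iff algebra_simps)
  have sym5: "?p F5 P5 j i k = ?p F5 P5 i j k" for i j k
    by (auto simp: trunc_to_def F5_def P5_def fun_eq_iff algebra_simps)
  have "P6 x z y = P6 x y z" for x y z by (simp only: P6_def mult_ac)
  then have sym6: "?p F6 P6 i k j = ?p F6 P6 i j k" for i j k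
    by (auto simp: trunc_to_def F6_def fun_eq_iff algebra_simps)
  have "set (spline_pairs v F1 P1 perms3) = set (spline_pairs v F1 P1 [(1, 2, 3), (2, 1, 3), (3, 1, 2)])"
    unfolding spline_pairs_def perms3_def list.map prod.case sym1[of 1 3 2] sym1[of 2 3 1] sym1[of 3 2 1] list.set by blast
  moreover have "set (spline_pairs v F5 P5 perms3) = set (spline_pairs v F5 P5 [(1, 2, 3), (1, 3, 2), (2, 3, 1)])"
    unfolding spline_pairs_def perms3_def list.map prod.case sym5[of 2 1 3] sym5[of 3 1 2] sym5[of 3 2 1] list.set by blast
  moreover have "set (spline_pairs v F6 P6 perms3) = set (spline_pairs v F6 P6 [(1, 2, 3), (2, 1, 3), (3, 1, 2)])"
    unfolding spline_pairs_def perms3_def list.map prod.case sym6[of 1 3 2] sym6[of 2 3 1] sym6[of 3 2 1] list.set by blast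
  ultimately show ?thesis by (simp add: orbit_pairs_def Bc_listing_def)
qed

lemma Bc_eq_listing:
  assumes "\<not> collinear {v 1, v 2, v 3}"
  shows "Bc v = set (Bc_listing v)"
  using Bc_eq_orbit_pairs[OF assms] orbit_pairs_eq by simp

lemma length_Bc_listing: "length (Bc_listing v) = 39"
  by (simp add: Bc_listing_def spline_pairs_def perms3_def)

lemma marsden_list:
  "(\<Sum>(S, \<Psi>)\<leftarrow>Bc_listing v. S x * \<Psi> c) = on_triangle v (\<lambda>b. lin3 c b ^ 5) x"
proof (cases "x \<in> triangle_of v")
  case True
  show ?thesis
    using marsden_reals[of "c 1" "barycentric v x 1" "c 2" "barycentric v x 2" "c 3" "barycentric v x 3"] True
    unfolding Bc_listing_def spline_pairs_def perms3_def lin3_def on_triangle_def trunc_to_def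
    by (simp only: list.map map_append sum_list_append sum_list.Cons sum_list.Nil prod.case if_True add.assoc append.simps add_0_right)
next
  case False
  have "S x = 0" if "(S, \<Psi>) \<in> set (Bc_listing v)" for S \<Psi>
    using that False by (auto simp: Bc_listing_def spline_pairs_def trunc_to_def)
  then have "(\<Sum>(S, \<Psi>)\<leftarrow>Bc_listing v. S x * \<Psi> c) = (\<Sum>_\<leftarrow>Bc_listing v. 0)"
    by (intro arg_cong[where f = sum_list] map_cong) auto
  then show ?thesis using False by (simp add: on_triangle_def)
qed

lemma sum_list_in_subspace:
  assumes W: "subspace W" and "fst ` set L \<subseteq> W"
  shows "(\<lambda>x. \<Sum>(S, \<Psi>)\<leftarrow>L. S x * (\<Psi> c :: real)) \<in> W"
  using assms(2)
proof (induction L)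
  case Nil
  then show ?case using subspace_0[OF W] by (simp add: zero_fun_def)
next
  case (Cons p L)
  have "(\<lambda>x. \<Sum>(S, \<Psi>)\<leftarrow>p # L. S x * \<Psi> c) = snd p c *\<^sub>R fst p + (\<lambda>x. \<Sum>(S, \<Psi>)\<leftarrow>L. S x * \<Psi> c)"
    by (auto simp: fun_eq_iff scaleR_fun_def split_beta)
  then show ?case using Cons subspace_add[OF W] subspace_scale[OF W] by auto
qed

text \<open>Each family spans the other: the closed forms are combinations of generators, and \<open>gens_subset\<close> gives the converse.\<close>

lemma span_Bc:
  assumes nc: "\<not> collinear {v 1, v 2, v 3}"
  shows "span (fst ` Bc v) = span (gens v)"
proof (rule antisym)
  show "span (fst ` Bc v) \<subseteq> span (gens v)"
  proof (rule span_minimal[OF _ subspace_span], rule image_subsetI)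
    have s: "fst q \<in> span (gens v)"
      if q: "q \<in> set (spline_pairs v F P perms3)" and F: "F \<in> {F1, F2, F3, F4, F5, F6, F7, F8}" for q F P
    proof -
      obtain i j k where "(i, j, k) \<in> set perms3" "q = (trunc_to v F i j k, \<lambda>c. P (c i) (c j) (c k))"
        using q unfolding spline_pairs_def set_map by auto
      then show ?thesis using F_span[OF nc _ _ _ F, of i j k] unfolding mem_perms3_iff by simp
    qed
    fix p assume p: "p \<in> Bc v"
    show "fst p \<in> span (gens v)"
      using p unfolding Bc_eq_orbit_pairs[OF nc] orbit_pairs_def
      by simp (elim disjE; (rule s, assumption, simp))
  qed
next
  let ?W = "span (fst ` Bc v)"
  have pow: "on_triangle v (\<lambda>b. lin3 c b ^ 5) \<in> ?W" for c
    using sum_list_in_subspace[OF subspace_span, of "Bc_listing v" "fst ` Bc v" c] span_superset[of "fst ` Bc v"]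
    unfolding marsden_list Bc_eq_listing[OF nc] by simp
  have "trunc_to v F i j k \<in> ?W" if F: "F \<in> {F1, F2, F3, F4, F7}" and d: "i \<noteq> j" "j \<noteq> k" "i \<noteq> k" for F i j k
  proof (rule span_base)
    have "(i, j, k) \<in> set perms3" unfolding mem_perms3_iff using d by blast
    then have "(trunc_to v F i j k, \<lambda>c. P (c i) (c j) (c k)) \<in> set (spline_pairs v F P perms3)" for P
      unfolding spline_pairs_def set_map by (rule image_eqI[rotated]) simp
    moreover obtain P where "(F, P) \<in> {(F1, P1), (F2, P2), (F3, P3), (F4, P4), (F7, P7)}" using F by blast
    ultimately have "(trunc_to v F i j k, \<lambda>c. P (c i) (c j) (c k)) \<in> set (orbit_pairs v)"
      unfolding orbit_pairs_def by auto
    then show "trunc_to v F i j k \<in> fst ` Bc v" unfolding Bc_eq_orbit_pairs[OF nc] by (rule image_eqI[rotated]) simp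
  qed
  then have "gens v \<subseteq> ?W" by (intro gens_subset nc subspace_span pow)
  then show "span (gens v) \<subseteq> ?W" by (simp add: span_minimal)
qed

theorem mainTheorem3:
  fixes v :: "3 \<Rightarrow> real^2"
  assumes "\<not> collinear {v 1, v 2, v 3}"
  shows "card (Bc v) = 39 \<and> inj_on fst (Bc v)
    \<and> independent (fst ` Bc v) \<and> span (fst ` Bc v) = spline_space 3 5 v
    \<and> (\<forall>x\<in>triangle_of v. \<forall>c :: 3 \<Rightarrow> real.
         (\<Sum>i\<in>UNIV. c i * barycentric v x i) ^ 5 = (\<Sum>(S, \<Psi>)\<in>Bc v. S x * \<Psi> c))"
proof -
  note nc = assms
  let ?A = "fst ` Bc v"
  have fin: "finite (Bc v)" by (simp add: Bc_eq_listing[OF nc])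
  have lower: "39 \<le> card X" if "finite X" "gens v \<subseteq> span X" for X
    using independent_span_bound[OF that(1) gens_independent(1)[OF nc] that(2)] gens_independent(2)[OF nc] by simp
  \<comment> \<open>a spanning set has at least 39 elements, the listing at most 39\<close>
  have "39 \<le> card ?A" using lower[of ?A] fin span_Bc[OF nc] span_superset[of "gens v"] by simp
  moreover have "card ?A \<le> card (Bc v)" using fin by (rule card_image_le)
  moreover have "card (Bc v) \<le> 39" using card_length[of "Bc_listing v"] by (simp add: Bc_eq_listing[OF nc] length_Bc_listing)
  ultimately have card: "card (Bc v) = 39" "card ?A = 39" by linarith+
  have inj: "inj_on fst (Bc v)" using card fin by (simp add: eq_card_imp_inj_on)
  have ind: "independent ?A"
  proof
    assume "dependent ?A"
    then obtain a where a: "a \<in> ?A" "a \<in> span (?A - {a})" by (auto simp: dependent_def)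
    \<comment> \<open>a dependent family would still span after dropping an element\<close>
    have "span (?A - {a}) = span ?A" using a by (metis insert_Diff span_redundant)
    then have "39 \<le> card (?A - {a})"
      using lower[of "?A - {a}"] fin span_Bc[OF nc] span_superset[of "gens v"] by simp
    then show False using a(1) card(2) fin by simp
  qed
  have "distinct (Bc_listing v)" using card(1) by (simp add: Bc_eq_listing[OF nc] card_distinct length_Bc_listing)
  then have sum: "(\<Sum>(S, \<Psi>)\<in>Bc v. S x * \<Psi> c) = on_triangle v (\<lambda>b. lin3 c b ^ 5) x" for x c
    unfolding Bc_eq_listing[OF nc] marsden_list[symmetric] by (simp add: sum_list_distinct_conv_sum_set)
  have "\<forall>x\<in>triangle_of v. \<forall>c :: 3 \<Rightarrow> real.
         (\<Sum>i\<in>UNIV. c i * barycentric v x i) ^ 5 = (\<Sum>(S, \<Psi>)\<in>Bc v. S x * \<Psi> c)"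
    unfolding sum by (simp add: on_triangle_def lin3_def sum_3)
  then show ?thesis
    using card(1) inj ind span_Bc[OF nc] spline_space_eq_span[OF nc] by simp
qed

end
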